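(* Let $X$ be a complex Banach space and let $T$ be a bounded asymptotically analytic $C_0$-semigroup on $X$ with generator $A$. Suppose that $i\sigma(A)\cap\mathbb{R}$ is of spectral synthesis and let $\mu$ be any bounded Borel measure on $\mathbb{R}_+$ such that $(\mathcal{F}\mu)(s)=0$ for all $s\in i\sigma(A)\cap\mathbb{R}$. Then $\|T(t)\widehat{\mu}(T)\|\to0$ as $t\to\infty$.
   Context: Notation: $\mathbb{R}_+=[0,\infty)$; $\mathcal{B}(X)$ is the space of bounded linear operators on $X$; $\sigma(A)$ is the spectrum of $A$ and $i\sigma(A)=\{i\lambda:\lambda\in\sigma(A)\}$. A $C_0$-semigroup $T$ is bounded if $\sup_{t\ge0}\|T(t)\|<\infty$. Fourier transforms: for $a\in L^1(\mathbb{R})$, $(\mathcal{F}a)(s)=\int_{\mathbb{R}}e^{-ist}a(t)\,dt$ for $s\in\mathbb{R}$; for a bounded (i.e. finite, complex) Borel measure $\mu$ on $\mathbb{R}$ (in particular on $\mathbb{R}_+$), $(\mathcal{F}\mu)(s)=\int e^{-ist}\,d\mu(t)$. For a bounded Borel measure $\mu$ on $\mathbb{R}_+$ and a bounded $C_0$-semigroup $T$ on $X$, the operator $\widehat{\mu}(T)\in\mathcal{B}(X)$ is given by $\widehat{\mu}(T)x=\int_{\mathbb{R}_+}T(t)x\,d\mu(t)$, $x\in X$. Spectral synthesis: a closed set $\Lambda\subset\mathbb{R}$ is of spectral synthesis if every $a\in L^1(\mathbb{R})$ with $(\mathcal{F}a)(s)=0$ for all $s\in\Lambda$ can be approximated in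 $L^1$-norm by elements of $L^1(\mathbb{R})$ whose Fourier transforms vanish in an open neighbourhood of $\Lambda$. Asymptotic analyticity: for a set $\Omega\subset\mathbb{C}$, a function $S:\Omega\to\mathcal{B}(X)$ is exponentially bounded if there are $C\ge0$, $\omega\in\mathbb{R}$ with $\|S(\lambda)\|\le Ce^{\omega|\lambda|}$ for all $\lambda\in\Omega$. $H(\Omega;\mathcal{B}(X))$ denotes the space of all exponentially bounded holomorphic $\mathcal{B}(X)$-valued functions on $\Omega$. For an exponentially bounded function $S$ defined on $(0,\infty)$, its growth bound is $\omega_0(S)=\inf\{\omega\in\mathbb{R}:\|S(t)\|\le Me^{\omega t}\text{ for some }M\ge1\text{ and all }t>0\}$. For $\theta>0$ let $\Sigma_\theta=\{\lambda\in\mathbb{C}\setminus\{0\}:|\arg(\lambda)|<\theta\}$. The non-analytic growth bound of a $C_0$-semigroup $T$ is $\zeta(T)=\inf\{\omega_0(T-S):S\in H(\Sigma_\theta;\mathcal{B}(X))\text{ for some }\theta>0\}$ (with $T-S$ considered on $(0,\infty)$). $T$ is called asymptotically analytic if $\zeta(T)<0$. *)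

theory Defs
  imports "HOL-Analysis.Analysis"
begin

section \<open>Complex normed and Banach spaces\<close>

class complex_normed_vector = real_normed_vector +
  fixes scaleC :: "complex \<Rightarrow> 'a \<Rightarrow> 'a" (infixr \<open>*\<^sub>C\<close> 75)
  assumes scaleC_add_right: "c *\<^sub>C (x + y) = c *\<^sub>C x + c *\<^sub>C y"
    and scaleC_add_left: "(c + d) *\<^sub>C x = c *\<^sub>C x + d *\<^sub>C x"
    and scaleC_scaleC: "c *\<^sub>C (d *\<^sub>C x) = (c * d) *\<^sub>C x"
    and scaleC_of_real: "complex_of_real r *\<^sub>C x = r *\<^sub>R x"
    and norm_scaleC: "norm (c *\<^sub>C x) = cmod c * norm x"

class complex_banach = complex_normed_vector + banach

instantiation complex :: complex_normed_vector
begin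
definition scaleC_complex :: "complex \<Rightarrow> complex \<Rightarrow> complex" where
  "scaleC_complex c x = c * x"
instance
  by standard (simp_all add: scaleC_complex_def algebra_simps norm_mult scaleR_conv_of_real)
end

instance complex :: complex_banach ..

lemma bounded_linear_scaleC: "bounded_linear (\<lambda>x :: 'a :: complex_normed_vector. c *\<^sub>C x)"
proof (rule bounded_linear_intro)
  fix x y :: 'a and r :: real
  show "c *\<^sub>C (x + y) = c *\<^sub>C x + c *\<^sub>C y"
    by (rule scaleC_add_right)
  show "c *\<^sub>C (r *\<^sub>R x) = r *\<^sub>R (c *\<^sub>C x)"
    by (simp add: scaleC_scaleC mult.commute flip: scaleC_of_real)
  show "norm (c *\<^sub>C x) \<le> norm x * cmod c"
    by (simp add: norm_scaleC mult.commute)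
qed

instantiation blinfun :: (real_normed_vector, complex_normed_vector) complex_normed_vector
begin

lift_definition scaleC_blinfun :: "complex \<Rightarrow> 'a \<Rightarrow>\<^sub>L 'b \<Rightarrow> 'a \<Rightarrow>\<^sub>L 'b"
  is "\<lambda>c f x. c *\<^sub>C f x"
  by (rule bounded_linear_compose[OF bounded_linear_scaleC])

instance
proof
  fix c d :: complex and r :: real and f g :: "'a \<Rightarrow>\<^sub>L 'b"
  show "c *\<^sub>C (f + g) = c *\<^sub>C f + c *\<^sub>C g"
    by transfer (simp add: scaleC_add_right)
  show "(c + d) *\<^sub>C f = c *\<^sub>C f + d *\<^sub>C f"
    by transfer (simp add: scaleC_add_left)
  show "c *\<^sub>C (d *\<^sub>C f) = (c * d) *\<^sub>C f"
    by transfer (simp add: scaleC_scaleC)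
  show "complex_of_real r *\<^sub>C f = r *\<^sub>R f"
    by transfer (simp add: scaleC_of_real)
  have le: "norm (a *\<^sub>C h) \<le> cmod a * norm h" for a and h :: "'a \<Rightarrow>\<^sub>L 'b"
  proof (rule norm_blinfun_bound)
    fix x
    have "norm (blinfun_apply (a *\<^sub>C h) x) = cmod a * norm (blinfun_apply h x)"
      by (simp add: scaleC_blinfun.rep_eq norm_scaleC)
    also have "\<dots> \<le> cmod a * (norm h * norm x)"
      by (intro mult_left_mono norm_blinfun) auto
    finally show "norm (blinfun_apply (a *\<^sub>C h) x) \<le> cmod a * norm h * norm x"
      by (simp add: mult.assoc)
  qed simp
  show "norm (c *\<^sub>C f) = cmod c * norm f"
  proof (cases "c = 0")
    case True
    then show ?thesis using le[of c f] by simp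
  next
    case False
    have "inverse c *\<^sub>C (c *\<^sub>C f) = f"
      using False by transfer (simp add: scaleC_scaleC scaleC_of_real[of 1, simplified])
    then have "norm f \<le> cmod (inverse c) * norm (c *\<^sub>C f)"
      using le[of "inverse c" "c *\<^sub>C f"] by simp
    then have "cmod c * norm f \<le> norm (c *\<^sub>C f)"
      using False by (simp add: norm_inverse norm_divide field_simps)
    then show ?thesis using le[of c f] by simp
  qed
qed

end

instance blinfun :: (real_normed_vector, complex_banach) complex_banach ..

text \<open>
  Elements of \<^typ>\<open>'a \<Rightarrow>\<^sub>L 'a\<close> are only real-linear; the space of bounded operators of a complex
  Banach space consists of the complex-linear ones. The norm of \<^typ>\<open>'a \<Rightarrow>\<^sub>L 'a\<close> is the operator norm.
\<close>

definition bounded_ops :: "('a::complex_normed_vector \<Rightarrow>\<^sub>L 'a) set" where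
  "bounded_ops = {B. \<forall>c x. blinfun_apply B (c *\<^sub>C x) = c *\<^sub>C blinfun_apply B x}"


section \<open>Semigroups, generators and spectra\<close>

text \<open>Only the values of \<open>T\<close> on \<open>[0, \<infinity>)\<close> are relevant.\<close>

definition C0_semigroup :: "(real \<Rightarrow> 'a::complex_banach \<Rightarrow>\<^sub>L 'a) \<Rightarrow> bool" where
  "C0_semigroup T \<longleftrightarrow>
     (\<forall>t\<ge>0. T t \<in> bounded_ops) \<and>
     T 0 = id_blinfun \<and>
     (\<forall>s\<ge>0. \<forall>t\<ge>0. T (s + t) = T s o\<^sub>L T t) \<and>
     (\<forall>x. ((\<lambda>t. blinfun_apply (T t) x) \<longlongrightarrow> x) (at_right 0))"

definition bounded_semigroup :: "(real \<Rightarrow> 'a::complex_banach \<Rightarrow>\<^sub>L 'a) \<Rightarrow> bool" where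
  "bounded_semigroup T \<longleftrightarrow> (\<exists>K. \<forall>t\<ge>0. norm (T t) \<le> K)"

definition generator_dom :: "(real \<Rightarrow> 'a::complex_banach \<Rightarrow>\<^sub>L 'a) \<Rightarrow> 'a set" where
  "generator_dom T =
     {x. \<exists>y. ((\<lambda>t. (blinfun_apply (T t) x - x) /\<^sub>R t) \<longlongrightarrow> y) (at_right 0)}"

definition generator :: "(real \<Rightarrow> 'a::complex_banach \<Rightarrow>\<^sub>L 'a) \<Rightarrow> 'a \<Rightarrow> 'a" where
  "generator T x = Lim (at_right 0) (\<lambda>t. (blinfun_apply (T t) x - x) /\<^sub>R t)"

text \<open>Resolvent set and spectrum of a possibly unbounded operator \<open>A\<close> with domain \<open>D\<close>.\<close>

definition resolvent_set :: "'a::complex_normed_vector set \<Rightarrow> ('a \<Rightarrow> 'a) \<Rightarrow> complex set" where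
  "resolvent_set D A =
     {l. \<exists>R\<in>bounded_ops.
           (\<forall>y. blinfun_apply R y \<in> D \<and> l *\<^sub>C blinfun_apply R y - A (blinfun_apply R y) = y) \<and>
           (\<forall>x\<in>D. blinfun_apply R (l *\<^sub>C x - A x) = x)}"

definition spectrum :: "'a::complex_normed_vector set \<Rightarrow> ('a \<Rightarrow> 'a) \<Rightarrow> complex set" where
  "spectrum D A = - resolvent_set D A"

text \<open>The set \<open>i\<sigma>(A) \<inter> \<real>\<close> for the generator \<open>A\<close> of \<open>T\<close>, as a set of real numbers.\<close>

definition real_spectrum_iA :: "(real \<Rightarrow> 'a::complex_banach \<Rightarrow>\<^sub>L 'a) \<Rightarrow> real set" where
  "real_spectrum_iA T =
     {s. complex_of_real s \<in> (\<lambda>l. \<i> * l) ` spectrum (generator_dom T) (generator T)}"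


section \<open>Asymptotic analyticity\<close>

definition exponentially_bounded_on :: "complex set \<Rightarrow> (complex \<Rightarrow> 'b::real_normed_vector) \<Rightarrow> bool" where
  "exponentially_bounded_on \<Omega> S \<longleftrightarrow>
     (\<exists>C\<ge>0. \<exists>\<omega>. \<forall>z\<in>\<Omega>. norm (S z) \<le> C * exp (\<omega> * cmod z))"

text \<open>The library's \<^const>\<open>holomorphic_on\<close> covers scalar-valued functions only.\<close>

definition vector_holomorphic_on :: "complex set \<Rightarrow> (complex \<Rightarrow> 'b::complex_normed_vector) \<Rightarrow> bool" where
  "vector_holomorphic_on \<Omega> S \<longleftrightarrow>
     (\<forall>z\<in>\<Omega>. \<exists>D. ((\<lambda>w. inverse (w - z) *\<^sub>C (S w - S z)) \<longlongrightarrow> D) (at z within \<Omega>))"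

definition H_space :: "complex set \<Rightarrow> (complex \<Rightarrow> 'a::complex_banach \<Rightarrow>\<^sub>L 'a) set" where
  "H_space \<Omega> = {S. (\<forall>z\<in>\<Omega>. S z \<in> bounded_ops) \<and>
                   exponentially_bounded_on \<Omega> S \<and> vector_holomorphic_on \<Omega> S}"

definition sector :: "real \<Rightarrow> complex set" where
  "sector \<theta> = {z. z \<noteq> 0 \<and> \<bar>Arg z\<bar> < \<theta>}"

text \<open>Growth bounds are extended reals, since the infima may be \<open>-\<infinity>\<close>.\<close>

definition growth_bound :: "(real \<Rightarrow> 'b::real_normed_vector) \<Rightarrow> ereal" where
  "growth_bound f = Inf {ereal \<omega> |\<omega>. \<exists>M\<ge>1. \<forall>t>0. norm (f t) \<le> M * exp (\<omega> * t)}"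

definition nonanalytic_growth_bound :: "(real \<Rightarrow> 'a::complex_banach \<Rightarrow>\<^sub>L 'a) \<Rightarrow> ereal" where
  "nonanalytic_growth_bound T =
     Inf {growth_bound (\<lambda>t. T t - S (complex_of_real t)) |S \<theta>. \<theta> > 0 \<and> S \<in> H_space (sector \<theta>)}"

definition asymptotically_analytic :: "(real \<Rightarrow> 'a::complex_banach \<Rightarrow>\<^sub>L 'a) \<Rightarrow> bool" where
  "asymptotically_analytic T \<longleftrightarrow> nonanalytic_growth_bound T < 0"


section \<open>Integration with respect to complex measures\<close>

text \<open>
  The library's Bochner integral is restricted to second countable, hence separable, spaces. The
  following is its definition without that restriction. Approximability by simple functions
  enforces almost separable range.
\<close>

definition has_vector_integral ::
    "'x measure \<Rightarrow> ('x \<Rightarrow> 'b::real_normed_vector) \<Rightarrow> 'b \<Rightarrow> bool" where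
  "has_vector_integral M f y \<longleftrightarrow>
     f \<in> borel_measurable M \<and>
     (\<exists>s. (\<forall>i. Bochner_Integration.simple_bochner_integrable M (s i)) \<and>
          (\<lambda>i. \<integral>\<^sup>+x. ennreal (norm (f x - s i x)) \<partial>M) \<longlonglongrightarrow> 0 \<and>
          (\<lambda>i. Bochner_Integration.simple_bochner_integral M (s i)) \<longlonglongrightarrow> y)"

definition vector_integral :: "'x measure \<Rightarrow> ('x \<Rightarrow> 'b::real_normed_vector) \<Rightarrow> 'b" where
  "vector_integral M f =
     (if \<exists>y. has_vector_integral M f y then THE y. has_vector_integral M f y else 0)"

lemma vector_integral_eq_lebesgue_integral:
  fixes f :: "'x \<Rightarrow> 'b::{banach, second_countable_topology}"
  shows "vector_integral M f = integral\<^sup>L M f"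
proof -
  have "has_vector_integral M f = has_bochner_integral M f"
    by (auto simp: fun_eq_iff has_vector_integral_def has_bochner_integral.simps)
  then show ?thesis
    by (simp add: vector_integral_def lebesgue_integral_def)
qed

text \<open>
  A complex measure on the \<open>\<sigma>\<close>-algebra of \<open>M\<close> is a countably additive complex set function; the
  measure carried by \<open>M\<close> itself plays no role. Such a set function is automatically of bounded
  total variation.
\<close>

definition complex_measure :: "'x measure \<Rightarrow> ('x set \<Rightarrow> complex) \<Rightarrow> bool" where
  "complex_measure M \<mu> \<longleftrightarrow>
     (\<forall>A. range A \<subseteq> sets M \<and> disjoint_family A \<longrightarrow>
          (\<lambda>n. \<mu> (A n)) sums \<mu> (\<Union>n::nat. A n))"

text \<open>
  The positive part in the Jordan decomposition of a real-valued signed measure \<open>\<nu>\<close>; the negative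
  part is the positive part of \<open>-\<nu>\<close>. Negative values of \<open>\<nu> B\<close> are truncated to \<open>0\<close> by
  \<^const>\<open>ennreal\<close>, which is harmless as \<open>\<nu> {} = 0\<close>.
\<close>

definition positive_part :: "'x measure \<Rightarrow> ('x set \<Rightarrow> real) \<Rightarrow> 'x measure" where
  "positive_part M \<nu> =
     measure_of (space M) (sets M) (\<lambda>A. SUP B\<in>{B \<in> sets M. B \<subseteq> A}. ennreal (\<nu> B))"

definition signed_integral ::
    "'x measure \<Rightarrow> ('x set \<Rightarrow> real) \<Rightarrow> ('x \<Rightarrow> 'b::real_normed_vector) \<Rightarrow> 'b" where
  "signed_integral M \<nu> f =
     vector_integral (positive_part M \<nu>) f - vector_integral (positive_part M (\<lambda>A. - \<nu> A)) f"

definition complex_measure_integral ::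
    "'x measure \<Rightarrow> ('x set \<Rightarrow> complex) \<Rightarrow> ('x \<Rightarrow> 'b::complex_normed_vector) \<Rightarrow> 'b" where
  "complex_measure_integral M \<mu> f =
     signed_integral M (\<lambda>A. Re (\<mu> A)) f + \<i> *\<^sub>C signed_integral M (\<lambda>A. Im (\<mu> A)) f"

abbreviation borel_Rplus :: "real measure" where
  "borel_Rplus \<equiv> restrict_space borel {0..}"


section \<open>Fourier transforms and spectral synthesis\<close>

definition fourier_L1 :: "(real \<Rightarrow> complex) \<Rightarrow> real \<Rightarrow> complex" where
  "fourier_L1 a s = (LINT t|lborel. exp (- \<i> * complex_of_real (s * t)) * a t)"

definition fourier_measure :: "(real set \<Rightarrow> complex) \<Rightarrow> real \<Rightarrow> complex" where
  "fourier_measure \<mu> s =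
     complex_measure_integral borel_Rplus \<mu> (\<lambda>t. exp (- \<i> * complex_of_real (s * t)))"

definition spectral_synthesis :: "real set \<Rightarrow> bool" where
  "spectral_synthesis \<Lambda> \<longleftrightarrow> closed \<Lambda> \<and>
     (\<forall>a. integrable lborel a \<and> (\<forall>s\<in>\<Lambda>. fourier_L1 a s = 0) \<longrightarrow>
       (\<forall>\<epsilon>>0. \<exists>b. integrable lborel b \<and>
          (\<exists>U. open U \<and> \<Lambda> \<subseteq> U \<and> (\<forall>s\<in>U. fourier_L1 b s = 0)) \<and>
          (LINT t|lborel. cmod (a t - b t)) < \<epsilon>))"

text \<open>The operator \<open>x \<mapsto> \<integral> T(t)x d\<mu>(t)\<close>, which is bounded when \<open>T\<close> is a bounded semigroup.\<close>

definition measure_calculus ::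
    "(real \<Rightarrow> 'a::complex_banach \<Rightarrow>\<^sub>L 'a) \<Rightarrow> (real set \<Rightarrow> complex) \<Rightarrow> 'a \<Rightarrow>\<^sub>L 'a" where
  "measure_calculus T \<mu> =
     Blinfun (\<lambda>x. complex_measure_integral borel_Rplus \<mu> (\<lambda>t. blinfun_apply (T t) x))"

end

theory Submission
  imports Defs "HOL-Complex_Analysis.Complex_Analysis"
begin

text \<open>
  By Hahn--Banach the norm of an operator \<open>B\<close> is the supremum of \<open>\<bar>\<xi> (B x)\<bar>\<close> over \<open>x\<close> in the unit ball and
  contractive complex-linear functionals \<open>\<xi>\<close>. The claim is therefore that \<open>\<integral> f(t + s) d\<mu>(s)\<close> tends to \<open>0\<close> as
  \<open>t \<rightarrow> \<infinity>\<close>, uniformly over all scalar orbits \<open>f(t) = \<xi> (T(t) x)\<close>, extended by \<open>0\<close> to negative times.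
  Throughout, \<open>\<Lambda>\<close> stands for \<open>i\<sigma>(A) \<inter> \<real>\<close>, \<open>F\<close> for the Fourier transform and \<open>R(s)\<close> for the resolvent of the
  generator at \<open>-is\<close>. Two properties of the scalar orbits carry the argument.

  Asymptotic equicontinuity (\<open>asymptotic_equicontinuity\<close>): for large \<open>t\<close> and small \<open>h\<close> the difference
  \<open>f(t + h) - f(t)\<close> is small. Indeed \<open>f\<close> is, up to an exponentially small error, a bounded function on the
  half-line with an exponentially bounded holomorphic extension to a sector. A Phragmen--Lindelof argument
  bounds this extension on a horizontal strip, and Cauchy's inequality then bounds its derivative. Consequently,
  averaging \<open>f\<close> against a kernel \<open>\<psi>\<close> concentrated near \<open>0\<close> hardly changes \<open>f(t)\<close> for large \<open>t\<close>
  (\<open>orbit_smoothing\<close>). The kernel can be chosen such that \<open>\<psi>(u) = \<integral> e\<^sup>i\<^sup>s\<^sup>u m(s) ds\<close> with \<open>m\<close> continuous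
  of compact support.

  Boundary values of the Laplace transform (\<open>laplace_orbit_resolvent\<close>): for \<open>s \<notin> \<Lambda>\<close> the Laplace transform of
  \<open>f\<close> at \<open>\<alpha> - is\<close> tends to \<open>\<xi> (R(s) x)\<close> as \<open>\<alpha> \<down> 0\<close>, with an error controlled by the norm of \<open>R(s)\<close>.

  Now let \<open>b\<close> be integrable with \<open>F b = 0\<close> near \<open>\<Lambda>\<close>. By the first property \<open>b\<close> may be replaced by \<open>b * \<psi>\<close>; by
  the second, \<open>\<integral> f(t + w) (b * \<psi>)(w) dw\<close> equals \<open>\<integral> \<xi> (P(s) x) e\<^sup>-\<^sup>i\<^sup>s\<^sup>t ds\<close> for the operator function
  \<open>P(s) = m(s) (F b)(s) R(s)\<close>. It is norm continuous with compact support, because \<open>F b\<close> vanishes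
  near the points where \<open>R\<close> does not exist, and the Riemann--Lebesgue lemma holds uniformly (\<open>band_limited_decay\<close>,
  \<open>spectral_gap_decay\<close>).

  Finally \<open>\<mu>\<close> is replaced by the integrable function \<open>\<psi> * \<mu>\<close>, again by equicontinuity (\<open>measure_smoothing\<close>).
  Its Fourier transform vanishes on \<open>\<Lambda>\<close>, so spectral synthesis approximates it by functions \<open>b\<close> as above.
\<close>

section \<open>Norming functionals\<close>

text \<open>
  Domination by the norm is part of the definition, as it bounds these functionals from below as well and so
  makes the infima below exist.
\<close>

definition sublinear :: "('a::real_normed_vector \<Rightarrow> real) \<Rightarrow> bool" where
  "sublinear p \<longleftrightarrow>
     (\<forall>x y. p (x + y) \<le> p x + p y) \<and> (\<forall>r\<ge>0. \<forall>x. p (r *\<^sub>R x) = r * p x) \<and> (\<forall>x. p x \<le> norm x)"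

lemma sublinear_lower:
  assumes "sublinear p" shows "- norm x \<le> - p (- x)" "- p (- x) \<le> p x" "p 0 = 0"
proof -
  have s: "p (x + y) \<le> p x + p y" "r \<ge> 0 \<Longrightarrow> p (r *\<^sub>R x) = r * p x" "p x \<le> norm x" for x y r
    using assms by (auto simp: sublinear_def)
  show z: "p 0 = 0" using s(2)[of 0 0] by simp
  show "- norm x \<le> - p (- x)" using s(3)[of "-x"] by simp
  show "- p (- x) \<le> p x" using s(1)[of x "-x"] z by simp
qed

text \<open>
  The directional modification of the Hahn--Banach proof: it takes the smallest value at \<open>-y\<close>
  that a sublinear minorant of \<open>p\<close> can take. A minimal \<open>p\<close> must agree with all of these, and this
  forces additivity.
\<close>

definition tilt :: "('a::real_normed_vector \<Rightarrow> real) \<Rightarrow> 'a \<Rightarrow> 'a \<Rightarrow> real" where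
  "tilt p y x = (INF t\<in>{0..}. p (x + t *\<^sub>R y) - t * p y)"

lemma tilt_bdd_below:
  assumes "sublinear p"
  shows "bdd_below ((\<lambda>t. p (x + t *\<^sub>R y) - t * p y) ` {0..})"
proof (rule bdd_belowI2)
  fix t :: real assume "t \<in> {0..}"
  then have "t * p y = p ((x + t *\<^sub>R y) + (- x))"
    using assms by (simp add: sublinear_def)
  also have "\<dots> \<le> p (x + t *\<^sub>R y) + p (- x)"
    using assms unfolding sublinear_def by blast
  finally show "- p (- x) \<le> p (x + t *\<^sub>R y) - t * p y" by simp
qed

lemma tilt_le:
  assumes "sublinear p" "t \<ge> 0"
  shows "tilt p y x \<le> p (x + t *\<^sub>R y) - t * p y"
  unfolding tilt_def by (rule cINF_lower[OF tilt_bdd_below[OF assms(1)]]) (use assms in auto)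

lemma sublinear_tilt:
  assumes p: "sublinear p"
  shows "sublinear (tilt p y)"
proof -
  have s: "p (x + y) \<le> p x + p y" "r \<ge> 0 \<Longrightarrow> p (r *\<^sub>R x) = r * p x" "p x \<le> norm x" for x y r
    using assms by (auto simp: sublinear_def)
  have le: "tilt p y x \<le> p x" for x
    using tilt_le[OF p, of 0 y x] by simp
  have ge: "c \<le> tilt p y x" if "\<And>t. t \<ge> 0 \<Longrightarrow> c \<le> p (x + t *\<^sub>R y) - t * p y" for c x
    unfolding tilt_def by (rule cINF_greatest) (use that in auto)
  have add: "tilt p y (a + b) \<le> tilt p y a + tilt p y b" for a b
  proof -
    have "tilt p y (a + b) - (p (b + t *\<^sub>R y) - t * p y) \<le> tilt p y a" if t: "t \<ge> 0" for t
    proof (rule ge)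
      fix u :: real assume u: "u \<ge> 0"
      have "tilt p y (a + b) \<le> p ((a + u *\<^sub>R y) + (b + t *\<^sub>R y)) - (u + t) * p y"
        using tilt_le[OF p, of "u + t" y "a + b"] t u by (simp add: algebra_simps)
      also have "\<dots> \<le> p (a + u *\<^sub>R y) + p (b + t *\<^sub>R y) - (u + t) * p y"
        using s(1)[of "a + u *\<^sub>R y" "b + t *\<^sub>R y"] by simp
      finally show "tilt p y (a + b) - (p (b + t *\<^sub>R y) - t * p y) \<le> p (a + u *\<^sub>R y) - u * p y"
        by (simp add: algebra_simps)
    qed
    then have "tilt p y (a + b) - tilt p y a \<le> tilt p y b"
      by (intro ge) (smt (verit))
    then show ?thesis by simp
  qed
  have hle: "r * tilt p y x \<le> tilt p y (r *\<^sub>R x)" if "r > 0" for r x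
  proof (rule ge)
    fix t :: real assume "t \<ge> 0"
    then have "tilt p y x \<le> p (x + (t/r) *\<^sub>R y) - (t/r) * p y"
      using that by (intro tilt_le[OF p]) auto
    then have "r * tilt p y x \<le> r * p (x + (t/r) *\<^sub>R y) - t * p y"
      using that by (simp add: field_simps)
    also have "r * p (x + (t/r) *\<^sub>R y) = p (r *\<^sub>R (x + (t/r) *\<^sub>R y))"
      using that by (simp add: s(2))
    also have "r *\<^sub>R (x + (t/r) *\<^sub>R y) = r *\<^sub>R x + t *\<^sub>R y"
      using that by (simp add: scaleR_add_right)
    finally show "r * tilt p y x \<le> p (r *\<^sub>R x + t *\<^sub>R y) - t * p y" .
  qed
  have hom: "tilt p y (r *\<^sub>R x) = r * tilt p y x" if r: "r \<ge> 0" for r x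
  proof (cases "r = 0")
    case True
    have "tilt p y 0 = 0"
      using le[of 0] ge[of 0 0] sublinear_lower[OF p] by (force simp: s(2))
    then show ?thesis using True by simp
  next
    case False
    then have r: "r > 0" using r by simp
    have "inverse r * tilt p y (r *\<^sub>R x) \<le> tilt p y x"
      using hle[of "inverse r" "r *\<^sub>R x"] r by simp
    then have "tilt p y (r *\<^sub>R x) \<le> r * tilt p y x"
      using r by (simp add: field_simps)
    with hle[OF r, of x] show ?thesis by simp
  qed
  show ?thesis
    unfolding sublinear_def using add hom le s(3) by (meson order_trans)
qed

text \<open>
  Only subadditivity uses that the functionals form a chain: two members can be compared, and the smaller
  one serves in both summands.
\<close>

lemma sublinear_INF_chain:
  assumes C: "C \<noteq> {}" "\<And>p. p \<in> C \<Longrightarrow> sublinear p"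
    and chain: "\<And>p q. p \<in> C \<Longrightarrow> q \<in> C \<Longrightarrow> p \<le> q \<or> q \<le> p"
  shows "sublinear (\<lambda>x. INF p\<in>C. p x)" "\<And>p. p \<in> C \<Longrightarrow> (\<lambda>x. INF p\<in>C. p x) \<le> p"
proof -
  have bdd: "bdd_below ((\<lambda>p. p x) ` C)" for x
    by (rule bdd_belowI2[of _ "- norm x"])
       (use C(2) sublinear_lower in \<open>meson order_trans\<close>)
  have le: "(INF p\<in>C. p x) \<le> p x" if "p \<in> C" for p x
    by (rule cINF_lower[OF bdd that])
  have ge: "c \<le> (INF p\<in>C. p x)" if "\<And>p. p \<in> C \<Longrightarrow> c \<le> p x" for c x
    by (rule cINF_greatest) (use that C in auto)
  show "\<And>p. p \<in> C \<Longrightarrow> (\<lambda>x. INF p\<in>C. p x) \<le> p"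
    using le by (auto simp: le_fun_def)
  have s: "p (x + y) \<le> p x + p y" "r \<ge> 0 \<Longrightarrow> p (r *\<^sub>R x) = r * p x" "p x \<le> norm x" if "p \<in> C" for x y r p
    using C(2)[OF that] by (auto simp: sublinear_def)
  have add: "(INF p\<in>C. p (a + b)) \<le> (INF p\<in>C. p a) + (INF p\<in>C. p b)" for a b
  proof -
    have "(INF p\<in>C. p (a + b)) \<le> p a + q b" if "p \<in> C" "q \<in> C" for p q
    proof (cases "p \<le> q")
      case True
      then show ?thesis using le[OF that(1), of "a + b"] s(1)[OF that(1), of a b]
        by (smt (verit) le_fun_def)
    next
      case False
      then have "q \<le> p" using chain that by blast
      then show ?thesis using le[OF that(2), of "a + b"] s(1)[OF that(2), of a b]
        by (smt (verit) le_fun_def)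
    qed
    then have "(INF p\<in>C. p (a + b)) - q b \<le> (INF p\<in>C. p a)" if "q \<in> C" for q
      using that by (intro ge) (smt (verit))
    then have "(INF p\<in>C. p (a + b)) - (INF p\<in>C. p a) \<le> (INF p\<in>C. p b)"
      by (intro ge) (smt (verit))
    then show ?thesis by simp
  qed
  have hle: "r * (INF p\<in>C. p x) \<le> (INF p\<in>C. p (r *\<^sub>R x))" if "r \<ge> 0" for r x
    by (rule ge) (use le that in \<open>simp add: s(2) mult_left_mono\<close>)
  have hom: "(INF p\<in>C. p (r *\<^sub>R x)) = r * (INF p\<in>C. p x)" if r: "r \<ge> 0" for r x
  proof (cases "r = 0")
    case True
    obtain q where "q \<in> C" using C by auto
    have "p 0 = 0" if "p \<in> C" for p using s(2)[OF that, of 0 0] by simp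
    then have "(\<lambda>p. p 0) ` C = {0}" using \<open>q \<in> C\<close> by force
    with True show ?thesis by (simp add: image_def)
  next
    case False
    then have r: "r > 0" using r by simp
    have "inverse r * (INF p\<in>C. p (r *\<^sub>R x)) \<le> (INF p\<in>C. p x)"
      using hle[of "inverse r" "r *\<^sub>R x"] r by simp
    then have "(INF p\<in>C. p (r *\<^sub>R x)) \<le> r * (INF p\<in>C. p x)"
      using r by (simp add: field_simps)
    with hle[of r x] r show ?thesis by simp
  qed
  have "(INF p\<in>C. p x) \<le> norm x" for x
    using C(1) le s(3) by (meson ex_in_conv order_trans)
  then show "sublinear (\<lambda>x. INF p\<in>C. p x)"
    unfolding sublinear_def using add hom by blast
qed

text \<open>
  Working with minimal sublinear functionals avoids the partially defined functionals of the usual proof of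
  the Hahn--Banach theorem.
\<close>

lemma minimal_sublinear:
  assumes p: "sublinear p"
  obtains q where "sublinear q" "q \<le> p" "\<And>r. sublinear r \<Longrightarrow> r \<le> q \<Longrightarrow> r = q"
proof -
  let ?A = "{q. sublinear q \<and> q \<le> p}"
  \<comment> \<open>The order is reversed, since Zorn's lemma provides maximal elements.\<close>
  let ?P = "\<lambda>q r :: 'a \<Rightarrow> real. r \<le> q"
  have "\<exists>m\<in>?A. \<forall>a\<in>?A. ?P m a \<longrightarrow> a = m"
  proof (rule predicate_Zorn)
    show "partial_order_on ?A (relation_of ?P ?A)"
      by (rule partial_order_on_relation_ofI) auto
  next
    fix C assume C: "C \<in> Chains (relation_of ?P ?A)"
    then have CA: "q \<in> ?A" if "q \<in> C" for q
      using that by (auto simp: Chains_def relation_of_def)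
    show "\<exists>u\<in>?A. \<forall>a\<in>C. ?P a u"
    proof (cases "C = {}")
      case True
      then show ?thesis using p by auto
    next
      case False
      have ch: "q \<le> r \<or> r \<le> q" if "q \<in> C" "r \<in> C" for q r
        using C that by (auto simp: Chains_def relation_of_def)
      have sl: "sublinear q" if "q \<in> C" for q using CA[OF that] by simp
      obtain q where q: "q \<in> C" using False by auto
      have "(\<lambda>x. INF p\<in>C. p x) \<le> p"
        using sublinear_INF_chain(2)[OF False sl ch q] CA[OF q] by auto
      then show ?thesis
        using sublinear_INF_chain[OF False sl ch] by blast
    qed
  qed
  then obtain q where q: "q \<in> ?A" "\<And>a. a \<in> ?A \<Longrightarrow> a \<le> q \<Longrightarrow> a = q" by blast
  show ?thesis
    using q by (intro that[of q]) (auto intro: order_trans)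
qed

text \<open>
  Starting from the norm tilted along \<open>x\<close> forces the value at \<open>-x\<close> down to \<open>-norm x\<close>.
\<close>

lemma real_norming_functional:
  fixes x :: "'a::real_normed_vector"
  obtains g :: "'a \<Rightarrow> real" where "linear g" "\<And>y. g y \<le> norm y" "g x = norm x"
proof -
  have "sublinear (norm :: 'a \<Rightarrow> real)"
    by (auto simp: sublinear_def norm_triangle_ineq)
  note n = this
  obtain q where q: "sublinear q" "q \<le> tilt norm x"
    and min: "\<And>r. sublinear r \<Longrightarrow> r \<le> q \<Longrightarrow> r = q"
    using minimal_sublinear[OF sublinear_tilt[OF n]] by metis
  have s: "q (x + y) \<le> q x + q y" "r \<ge> 0 \<Longrightarrow> q (r *\<^sub>R x) = r * q x" "q x \<le> norm x" for x y r
    using q(1) by (auto simp: sublinear_def)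
  have "tilt q y \<le> q" for y
    using tilt_le[OF q(1), of 0 y] by (auto simp: le_fun_def)
  then have tq: "tilt q y = q" for y
    by (intro min sublinear_tilt q)
  have add: "q (a + b) = q a + q b" for a b
    using tilt_le[OF q(1), of 1 b a] s(1)[of a b] by (simp add: tq)
  have neg: "q (- a) = - q a" for a
    using add[of a "-a"] sublinear_lower(3)[OF q(1)] by simp
  have "linear q"
  proof (rule linearI)
    fix r :: real and a
    show "q (r *\<^sub>R a) = r *\<^sub>R q a"
    proof (cases "r \<ge> 0")
      case False
      then have "q (r *\<^sub>R a) = - q ((- r) *\<^sub>R a)" using neg[of "r *\<^sub>R a"] by simp
      also have "\<dots> = r * q a" using False by (subst s(2)) auto
      finally show ?thesis by simp
    qed (simp add: s)
  qed (rule add)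
  moreover have "q x = norm x"
  proof -
    have "q (- x) \<le> tilt norm x (- x)" using q(2) by (simp add: le_fun_def)
    also have "\<dots> \<le> - norm x" using tilt_le[OF n, of 1 x "-x"] by simp
    finally show ?thesis using neg[of x] s(3)[of x] by simp
  qed
  ultimately show ?thesis using that s(3) by blast
qed

definition contractive_functional :: "('a::complex_normed_vector \<Rightarrow> complex) \<Rightarrow> bool" where
  "contractive_functional \<xi> \<longleftrightarrow>
     (\<forall>x y. \<xi> (x + y) = \<xi> x + \<xi> y) \<and> (\<forall>c x. \<xi> (c *\<^sub>C x) = c * \<xi> x) \<and> (\<forall>x. cmod (\<xi> x) \<le> norm x)"

text \<open>
  The complexification \<open>y \<mapsto> g y - i g(iy)\<close> of a real norming functional remains contractive, since a rotation
  makes any of its values real and positive.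
\<close>

lemma norming_functional:
  fixes x :: "'a::complex_normed_vector"
  obtains \<xi> where "contractive_functional \<xi>" "\<xi> x = of_real (norm x)"
proof -
  obtain g :: "'a \<Rightarrow> real" where g: "linear g" "\<And>y. g y \<le> norm y" "g x = norm x"
    using real_norming_functional by blast
  interpret linear g by fact
  define \<xi> where "\<xi> y = Complex (g y) (- g (\<i> *\<^sub>C y))" for y
  have ii: "\<i> *\<^sub>C (\<i> *\<^sub>C y) = - y" for y :: 'a
    using scaleC_scaleC[of \<i> \<i> y] scaleC_of_real[of "-1" y] by simp
  have sc: "c *\<^sub>C y = Re c *\<^sub>R y + Im c *\<^sub>R (\<i> *\<^sub>C y)" for c and y :: 'a
  proof -
    have "c = complex_of_real (Re c) + complex_of_real (Im c) * \<i>"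
      by (simp add: complex_eq_iff)
    then have "c *\<^sub>C y = (complex_of_real (Re c) + complex_of_real (Im c) * \<i>) *\<^sub>C y" by simp
    also have "\<dots> = Re c *\<^sub>R y + Im c *\<^sub>R (\<i> *\<^sub>C y)"
      by (simp only: scaleC_add_left scaleC_scaleC[symmetric] scaleC_of_real)
    finally show ?thesis .
  qed
  have hom: "\<xi> (c *\<^sub>C y) = c * \<xi> y" for c y
  proof -
    have "\<i> *\<^sub>C (c *\<^sub>C y) = Re c *\<^sub>R (\<i> *\<^sub>C y) - Im c *\<^sub>R y"
      using sc[of "\<i> * c" y] by (simp add: scaleC_scaleC)
    then have "g (\<i> *\<^sub>C (c *\<^sub>C y)) = Re c * g (\<i> *\<^sub>C y) - Im c * g y"
      by (simp only: diff scale) simp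
    moreover have "g (c *\<^sub>C y) = Re c * g y + Im c * g (\<i> *\<^sub>C y)"
      by (subst sc) (simp add: add scale)
    ultimately show ?thesis
      by (simp add: \<xi>_def complex_eq_iff algebra_simps)
  qed
  have bd: "cmod (\<xi> y) \<le> norm y" for y
  proof (cases "\<xi> y = 0")
    case False
    \<comment> \<open>The rotation that makes the value at \<open>y\<close> positive.\<close>
    define c where "c = cnj (\<xi> y) / of_real (cmod (\<xi> y))"
    have c1: "cmod c = 1" using False by (simp add: c_def norm_divide)
    have "cnj (\<xi> y) * \<xi> y = of_real (cmod (\<xi> y)) * of_real (cmod (\<xi> y))"
      using complex_norm_square[of "\<xi> y"] by (simp only: power2_eq_square mult.commute[of "cnj (\<xi> y)" "\<xi> y"] of_real_mult)
    then have "c * \<xi> y = of_real (cmod (\<xi> y))"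
      using False by (simp add: c_def divide_eq_eq)
    then have "cmod (\<xi> y) = Re (\<xi> (c *\<^sub>C y))" by (simp add: hom)
    also have "\<dots> = g (c *\<^sub>C y)" by (simp add: \<xi>_def)
    also have "\<dots> \<le> norm (c *\<^sub>C y)" by (rule g)
    finally show ?thesis using c1 by (simp add: norm_scaleC)
  qed simp
  have cf: "contractive_functional \<xi>"
  proof -
    have "\<xi> (a + b) = \<xi> a + \<xi> b" for a b
      by (simp add: \<xi>_def scaleC_add_right add complex_eq_iff)
    then show ?thesis using hom bd by (simp add: contractive_functional_def)
  qed
  have "Re (\<xi> x) = norm x" by (simp add: \<xi>_def g)
  moreover have "Im (\<xi> x) = 0"
  proof -
    have "(cmod (\<xi> x))\<^sup>2 \<le> (norm x)\<^sup>2" using bd by (intro power_mono) auto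
    then show ?thesis using \<open>Re (\<xi> x) = norm x\<close> by (simp add: cmod_power2)
  qed
  ultimately have "\<xi> x = of_real (norm x)" by (simp add: complex_eq_iff)
  with cf show ?thesis using that by blast
qed

lemma contractive_functionalD:
  assumes "contractive_functional \<xi>"
  shows "\<xi> (x + y) = \<xi> x + \<xi> y" "\<xi> (c *\<^sub>C x) = c * \<xi> x" "cmod (\<xi> x) \<le> norm x"
    and "bounded_linear \<xi>" "\<xi> (x - y) = \<xi> x - \<xi> y" "\<xi> 0 = 0"
proof -
  show a: "\<xi> (x + y) = \<xi> x + \<xi> y" "\<xi> (c *\<^sub>C x) = c * \<xi> x" "cmod (\<xi> x) \<le> norm x" for x y c
    using assms by (auto simp: contractive_functional_def)
  show bl: "bounded_linear \<xi>"
  proof (rule bounded_linear_intro)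
    show "\<xi> (r *\<^sub>R x) = r *\<^sub>R \<xi> x" for r x
      using a(2)[of "of_real r" x] by (simp add: scaleC_of_real scaleR_conv_of_real)
    show "norm (\<xi> x) \<le> norm x * 1" for x using a(3) by simp
  qed (rule a)
  interpret bounded_linear \<xi> by fact
  show "\<xi> (x - y) = \<xi> x - \<xi> y" "\<xi> 0 = 0" by (rule diff zero)+
qed

lemma norm_le_functionals:
  fixes x :: "'a::complex_normed_vector"
  assumes "\<And>\<xi>. contractive_functional \<xi> \<Longrightarrow> cmod (\<xi> x) \<le> B"
  shows "norm x \<le> B"
proof (rule norming_functional[of x])
  fix \<xi> :: "'a \<Rightarrow> complex"
  assume a: "contractive_functional \<xi>" and b: "\<xi> x = of_real (norm x)"
  have "cmod (\<xi> x) \<le> B" by (rule assms[OF a])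
  then show ?thesis unfolding b by simp
qed

lemma eq_functionals:
  fixes x :: "'a::complex_normed_vector"
  assumes "\<And>\<xi>. contractive_functional \<xi> \<Longrightarrow> \<xi> x = \<xi> y"
  shows "x = y"
proof -
  have "norm (x - y) \<le> 0"
  proof (rule norm_le_functionals)
    fix \<xi> :: "'a \<Rightarrow> complex" assume \<xi>: "contractive_functional \<xi>"
    show "cmod (\<xi> (x - y)) \<le> 0"
      unfolding contractive_functionalD(5)[OF \<xi>, of x y] assms[OF \<xi>] by simp
  qed
  then show ?thesis by simp
qed

section \<open>Finite measures and vector integrals\<close>

text \<open>
  If \<open>\<nu>\<close> is unbounded on the subsets of a set, one of the two parts of a suitable splitting has the same
  defect while \<open>\<nu>\<close> has modulus at least \<open>1\<close> on the other. Iterating produces disjoint sets whose \<open>\<nu>\<close>-values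
  form a convergent series without tending to \<open>0\<close>.
\<close>

lemma countably_additive_bounded:
  fixes \<nu> :: "'a set \<Rightarrow> real"
  assumes \<nu>: "\<And>A :: nat \<Rightarrow> 'a set. range A \<subseteq> sets M \<Longrightarrow> disjoint_family A \<Longrightarrow> (\<lambda>n. \<nu> (A n)) sums \<nu> (\<Union>n. A n)"
  shows "\<exists>K. \<forall>A\<in>sets M. \<bar>\<nu> A\<bar> \<le> K"
proof (rule ccontr)
  have e: "\<nu> {} = 0"
  proof -
    have "(\<lambda>n::nat. \<nu> {}) sums \<nu> {}" using \<nu>[of "\<lambda>_. {}"] by (simp add: disjoint_family_on_def)
    then have "(\<lambda>n::nat. \<nu> {}) \<longlonglongrightarrow> 0" by (meson sums_summable summable_LIMSEQ_zero)
    then show ?thesis by (simp add: LIMSEQ_const_iff)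
  qed
  have add: "\<nu> (A \<union> B) = \<nu> A + \<nu> B" if "A \<in> sets M" "B \<in> sets M" "A \<inter> B = {}" for A B
  proof -
    have "(\<lambda>n. \<nu> (binaryset A B n)) sums \<nu> (\<Union>n. binaryset A B n)"
      using that by (intro \<nu>) (auto simp: binaryset_def disjoint_family_on_def)
    moreover have "(\<lambda>n. \<nu> (binaryset A B n)) sums (\<Sum>n<2. \<nu> (binaryset A B n))"
      by (rule sums_finite) (auto simp: binaryset_def e)
    ultimately have "\<nu> (\<Union>n. binaryset A B n) = (\<Sum>n<2. \<nu> (binaryset A B n))"
      by (rule sums_unique2)
    then show ?thesis
      by (simp add: UN_binaryset_eq) (simp add: binaryset_def numeral_2_eq_2)
  qed
  define bad where "bad E \<longleftrightarrow> E \<in> sets M \<and> (\<forall>K. \<exists>A\<in>sets M. A \<subseteq> E \<and> \<bar>\<nu> A\<bar> > K)" for E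
  have step: "\<exists>E'. bad E' \<and> E' \<subseteq> E \<and> \<bar>\<nu> (E - E')\<bar> \<ge> 1" if "bad E" for E
  proof -
    have large: "\<exists>A\<in>sets M. A \<subseteq> E \<and> \<bar>\<nu> A\<bar> > K" for K
      using that unfolding bad_def by simp
    obtain B where B: "B \<in> sets M" "B \<subseteq> E" "\<bar>\<nu> B\<bar> > \<bar>\<nu> E\<bar> + 1"
      using large[of "\<bar>\<nu> E\<bar> + 1"] by auto
    have E: "E \<in> sets M" using that by (simp add: bad_def)
    have "\<nu> E = \<nu> B + \<nu> (E - B)"
      using add[of B "E - B"] B E by (auto simp: Un_absorb1)
    then have big: "\<bar>\<nu> (E - B)\<bar> \<ge> 1" "\<bar>\<nu> B\<bar> \<ge> 1" using B by linarith+
    have EB: "E - (E - B) = B" using B by auto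
    show ?thesis
    proof (cases "bad B")
      case True
      then show ?thesis using B big by auto
    next
      case False
      then obtain K1 where K1: "\<And>A. A \<in> sets M \<Longrightarrow> A \<subseteq> B \<Longrightarrow> \<bar>\<nu> A\<bar> \<le> K1"
        using B(1) unfolding bad_def not_less[symmetric] by blast
      have "bad (E - B)"
        unfolding bad_def
      proof (intro conjI allI)
        fix K
        obtain A where A: "A \<in> sets M" "A \<subseteq> E" "\<bar>\<nu> A\<bar> > K + K1"
          using large[of "K + K1"] by auto
        have "(A \<inter> B) \<union> (A - B) = A" by auto
        then have "\<nu> A = \<nu> (A \<inter> B) + \<nu> (A - B)"
          using add[of "A \<inter> B" "A - B"] A B by auto
        moreover have "\<bar>\<nu> (A \<inter> B)\<bar> \<le> K1" using K1[of "A \<inter> B"] A B by auto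
        ultimately have "\<bar>\<nu> (A - B)\<bar> > K" using A by linarith
        then show "\<exists>A\<in>sets M. A \<subseteq> E - B \<and> \<bar>\<nu> A\<bar> > K"
          using A B by (intro bexI[of _ "A - B"]) auto
      qed (use B E in auto)
      then show ?thesis using big EB by (intro exI[of _ "E - B"]) auto
    qed
  qed
  assume "\<not> ?thesis"
  then have "\<exists>A\<in>sets M. \<bar>\<nu> A\<bar> > K" for K by (simp add: not_le)
  then have "\<exists>A\<in>sets M. A \<subseteq> space M \<and> \<bar>\<nu> A\<bar> > K" for K
    using sets.sets_into_space by metis
  then have b0: "bad (space M)"
    unfolding bad_def by simp
  have "\<exists>E. \<forall>n::nat. bad (E n) \<and> (E (Suc n) \<subseteq> E n \<and> \<bar>\<nu> (E n - E (Suc n))\<bar> \<ge> 1)"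
  proof (rule dependent_nat_choice[where P="\<lambda>_. bad" and Q="\<lambda>_ E E'. E' \<subseteq> E \<and> \<bar>\<nu> (E - E')\<bar> \<ge> 1"])
    show "\<exists>E. bad E" using b0 by (rule exI)
    show "\<exists>E'. bad E' \<and> E' \<subseteq> E \<and> \<bar>\<nu> (E - E')\<bar> \<ge> 1" if "bad E" for E and n :: nat
      using step[OF that] .
  qed
  then obtain E where E0: "\<forall>n::nat. bad (E n) \<and> (E (Suc n) \<subseteq> E n \<and> \<bar>\<nu> (E n - E (Suc n))\<bar> \<ge> 1)"
    by (rule exE)
  have E: "bad (E n)" "E (Suc n) \<subseteq> E n" "\<bar>\<nu> (E n - E (Suc n))\<bar> \<ge> 1" for n
    using spec[OF E0, of n] by simp_all
  define D where "D n = E n - E (Suc n)" for n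
  have anti: "E n \<subseteq> E m" if "m \<le> n" for m n
    by (rule lift_Suc_antimono_le[of E, OF E(2) that])
  have "D m \<inter> D n = {}" if "m < n" for m n
    using anti[of "Suc m" n] that by (auto simp: D_def)
  then have "disjoint_family D"
    unfolding disjoint_family_on_def by (intro ballI impI) (metis linorder_neqE_nat Int_commute)
  moreover have "range D \<subseteq> sets M"
    using E(1) by (auto simp: D_def bad_def)
  ultimately have "(\<lambda>n. \<nu> (D n)) sums \<nu> (\<Union>n. D n)" by (intro \<nu>)
  then have "(\<lambda>n. \<nu> (D n)) \<longlonglongrightarrow> 0" by (meson sums_summable summable_LIMSEQ_zero)
  then have "(\<lambda>n. \<bar>\<nu> (D n)\<bar>) \<longlonglongrightarrow> \<bar>0\<bar>" by (rule tendsto_rabs)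
  then have "eventually (\<lambda>n. \<bar>\<nu> (D n)\<bar> < 1) sequentially"
    by (rule order_tendstoD(2)) simp
  then obtain n where "\<bar>\<nu> (D n)\<bar> < 1"
    by (auto simp: eventually_sequentially)
  then show False using E(3)[of n] by (simp add: D_def)
qed

text \<open>
  The total mass is either the supremum of \<open>\<nu>\<close> or, if the set function fails to be a measure, \<open>0\<close> by the
  convention in \<open>measure_of\<close>.
\<close>

lemma finite_measure_positive_part:
  assumes "\<And>A. A \<in> sets M \<Longrightarrow> \<nu> A \<le> K"
  shows "finite_measure (positive_part M \<nu>)" "sets (positive_part M \<nu>) = sets M"
proof -
  show s: "sets (positive_part M \<nu>) = sets M"
    by (simp add: positive_part_def)
  have sp: "space (positive_part M \<nu>) = space M"
    by (simp add: positive_part_def space_measure_of_conv)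
  have le: "(SUP B\<in>{B \<in> sets M. B \<subseteq> A}. ennreal (\<nu> B)) \<le> ennreal K" for A
    using assms by (intro SUP_least) (auto intro: ennreal_leI)
  have "(SUP B\<in>{B \<in> sets M. B \<subseteq> A}. ennreal (\<nu> B)) < \<infinity>" for A
    using le_less_trans[OF le ennreal_less_top] by simp
  then have "emeasure (positive_part M \<nu>) (space M) < \<infinity>"
    unfolding positive_part_def emeasure_measure_of_conv by auto
  then show "finite_measure (positive_part M \<nu>)"
    by (intro finite_measureI) (simp add: sp)
qed

text \<open>
  Functionals turn the vector integral into a scalar Bochner integral; every statement about the former is
  reduced in this way to one about the latter.
\<close>

lemma has_vector_integral_functional:
  assumes \<xi>: "contractive_functional \<xi>" and f: "has_vector_integral M f y"
  shows "has_bochner_integral M (\<lambda>t. \<xi> (f t)) (\<xi> y)"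
proof -
  note D = contractive_functionalD[OF \<xi>]
  interpret bounded_linear \<xi> by (rule D)
  obtain s where s: "\<And>i. Bochner_Integration.simple_bochner_integrable M (s i)"
    "(\<lambda>i. \<integral>\<^sup>+x. ennreal (norm (f x - s i x)) \<partial>M) \<longlonglongrightarrow> 0"
    "(\<lambda>i. Bochner_Integration.simple_bochner_integral M (s i)) \<longlonglongrightarrow> y"
    and f: "f \<in> borel_measurable M"
    using f by (auto simp: has_vector_integral_def)
  show ?thesis
  proof (rule has_bochner_integral.intros)
    have [measurable]: "\<xi> \<in> borel_measurable borel"
      by (intro borel_measurable_continuous_onI continuous_on continuous_on_id)
    show "(\<lambda>t. \<xi> (f t)) \<in> borel_measurable M"
      using f by measurable
    show "Bochner_Integration.simple_bochner_integrable M (\<lambda>t. \<xi> (s i t))" for i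
      by (rule simple_bochner_integrable_compose2[OF _ s(1) s(1), of "\<lambda>x y. \<xi> x"]) (simp add: D)
    show "(\<lambda>i. Bochner_Integration.simple_bochner_integral M (\<lambda>t. \<xi> (s i t))) \<longlonglongrightarrow> \<xi> y"
      using tendsto[OF s(3)]
      by (simp add: simple_bochner_integral_linear[OF linear_axioms s(1)])
    show "(\<lambda>i. \<integral>\<^sup>+x. ennreal (norm (\<xi> (f x) - \<xi> (s i x))) \<partial>M) \<longlonglongrightarrow> 0"
    proof (rule tendsto_sandwich[OF _ _ tendsto_const s(2)])
      show "\<forall>\<^sub>F i in sequentially. (\<integral>\<^sup>+x. ennreal (norm (\<xi> (f x) - \<xi> (s i x))) \<partial>M) \<le> (\<integral>\<^sup>+x. ennreal (norm (f x - s i x)) \<partial>M)"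
        by (intro always_eventually allI nn_integral_mono ennreal_leI) (metis D(3,5))
    qed simp
  qed
qed

lemma has_vector_integral_unique:
  fixes f :: "_ \<Rightarrow> 'b::complex_normed_vector"
  assumes "has_vector_integral M f y" "has_vector_integral M f z"
  shows "y = z"
  by (rule eq_functionals) (meson assms has_vector_integral_functional has_bochner_integral_eq)

lemma vector_integral_eq:
  fixes f :: "_ \<Rightarrow> 'b::complex_normed_vector"
  assumes "has_vector_integral M f y"
  shows "vector_integral M f = y"
  unfolding vector_integral_def using assms has_vector_integral_unique by (auto intro!: the_equality)

text \<open>
  The step functions that freeze \<open>f\<close> on a grid of mesh \<open>1/(i+1)\<close> and vanish beyond \<open>i\<close> converge pointwise and
  boundedly, so their integrals form a Cauchy sequence.
\<close>

lemma has_vector_integral_exists: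
  fixes f :: "real \<Rightarrow> 'b::banach"
  assumes "finite_measure N" and N: "sets N = sets borel_Rplus"
    and f: "continuous_on {0..} f" "\<And>t. t \<ge> 0 \<Longrightarrow> norm (f t) \<le> K"
  shows "\<exists>y. has_vector_integral N f y"
proof -
  interpret finite_measure N by fact
  have sp: "space N = {0..}" using sets_eq_imp_space_eq[OF N] by (simp add: space_restrict_space)
  have K: "K \<ge> 0" using f(2)[of 0] norm_ge_zero[of "f 0"] by linarith
  \<comment> \<open>The grid index of \<open>t\<close>; the value \<open>-1\<close> marks the points beyond \<open>i\<close>, where the step function is \<open>0\<close>.\<close>
  define g where "g i t = (if t < real i then \<lfloor>t * (real i + 1)\<rfloor> else - 1)" for i and t :: real
  define c where "c i k = (if k < 0 then 0 else f (real_of_int k / (real i + 1)))" for i :: nat and k :: int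
  define s where "s i t = c i (g i t)" for i t
  have mN: "h \<in> measurable N M" if "h \<in> measurable borel_Rplus M" for h and M :: "'c measure"
    using that by (simp cong: measurable_cong_sets add: measurable_cong_sets[OF N refl])
  have gm: "g i \<in> measurable N (count_space UNIV)" for i
    unfolding g_def by (rule mN, rule measurable_restrict_space1) measurable
  have gf: "finite (g i ` space N)" for i
  proof (rule finite_subset)
    show "g i ` space N \<subseteq> {-1..\<lfloor>real i * (real i + 1)\<rfloor>}"
    proof
      fix k assume "k \<in> g i ` space N"
      then obtain t where t: "t \<ge> 0" "k = g i t" by (auto simp: sp)
      have "\<lfloor>t * (real i + 1)\<rfloor> \<le> \<lfloor>real i * (real i + 1)\<rfloor>" if "t < real i"
        using that by (intro floor_mono mult_right_mono) auto
      moreover have "- 1 \<le> \<lfloor>t * (real i + 1)\<rfloor>" "- 1 \<le> \<lfloor>real i * (real i + 1)\<rfloor>"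
        using t by (simp_all add: order_trans[of "-1" 0 "\<lfloor>_\<rfloor>"])
      ultimately show "k \<in> {-1..\<lfloor>real i * (real i + 1)\<rfloor>}" using t(2) by (simp add: g_def)
    qed
  qed simp
  have sg: "simple_function N (g i)" for i
    using gf gm[of i] unfolding simple_function_def by (auto intro: measurable_sets)
  have ss: "simple_function N (s i)" for i
    unfolding s_def by (rule simple_function_compose1[OF sg])
  have si: "Bochner_Integration.simple_bochner_integrable N (s i)" for i
    by (rule Bochner_Integration.simple_bochner_integrable.intros[OF ss]) simp
  have fN: "f \<in> borel_measurable N"
    by (rule mN, rule borel_measurable_continuous_on_restrict[OF f(1)])
  have cs: "norm (c i k) \<le> K" for i k
    using f(2) K by (auto simp: c_def)
  have dm: "(\<lambda>t. norm (f t - s i t)) \<in> borel_measurable N" for i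
    unfolding s_def
  proof (rule measurable_compose_countable[OF _ gm])
    fix k
    show "(\<lambda>t. norm (f t - c i k)) \<in> borel_measurable N"
      by (rule mN, rule borel_measurable_continuous_on_restrict, intro continuous_intros f)
  qed
  have pt: "(\<lambda>i. s i t) \<longlonglongrightarrow> f t" if t: "t \<ge> 0" for t
  proof -
    define q where "q i = real_of_int \<lfloor>t * (real i + 1)\<rfloor> / (real i + 1)" for i :: nat
    have q: "q i \<le> t" "t - 1 / (real i + 1) \<le> q i" "0 \<le> q i" for i
    proof -
      have "real_of_int \<lfloor>t * (real i + 1)\<rfloor> \<le> t * (real i + 1)" "t * (real i + 1) - 1 \<le> real_of_int \<lfloor>t * (real i + 1)\<rfloor>"
        by linarith+
      then show "q i \<le> t" "t - 1 / (real i + 1) \<le> q i"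
        using divide_right_mono[of "t * (real i + 1) - 1" "real_of_int \<lfloor>t * (real i + 1)\<rfloor>" "real i + 1"]
        unfolding q_def by (simp_all add: divide_le_eq diff_divide_distrib)
      show "0 \<le> q i" using t by (simp add: q_def)
    qed
    have "(\<lambda>i. t - 1 / (real i + 1)) \<longlonglongrightarrow> t - 0"
      by (intro tendsto_intros) (use LIMSEQ_inverse_real_of_nat in \<open>simp add: inverse_eq_divide add.commute\<close>)
    then have "q \<longlonglongrightarrow> t"
      by (intro tendsto_sandwich[OF _ _ _ tendsto_const, of _ q]) (auto simp: q)
    then have "(\<lambda>i. f (q i)) \<longlonglongrightarrow> f t"
      using continuous_on_tendsto_compose[OF f(1), of q t sequentially] t q by auto
    moreover have "eventually (\<lambda>i. f (q i) = s i t) sequentially"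
      using eventually_gt_at_top[of "nat \<lceil>t\<rceil>"]
    proof eventually_elim
      case (elim i)
      then have "t < real i" by linarith
      moreover have "0 \<le> t * (real i + 1)" using t by simp
      ultimately show ?case using t by (simp add: s_def c_def g_def q_def mult_less_0_iff)
    qed
    ultimately show ?thesis by (rule Lim_transform_eventually)
  qed
  have lim: "(\<lambda>i. \<integral>\<^sup>+x. ennreal (norm (f x - s i x)) \<partial>N) \<longlonglongrightarrow> 0"
  proof -
    have "(\<lambda>i. \<integral>\<^sup>+x. ennreal (norm (f x - s i x)) \<partial>N) \<longlonglongrightarrow> (\<integral>\<^sup>+x. 0 \<partial>N)"
    proof (rule nn_integral_dominated_convergence[where w="\<lambda>_. ennreal (2 * K)"])
      show "(\<lambda>x. ennreal (norm (f x - s i x))) \<in> borel_measurable N" for i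
        using dm[of i] by measurable
      show "(\<integral>\<^sup>+ x. ennreal (2 * K) \<partial>N) < \<infinity>"
        by (simp add: ennreal_mult_eq_top_iff less_top[symmetric])
      show "AE x in N. ennreal (norm (f x - s i x)) \<le> ennreal (2 * K)" for i
      proof (rule AE_I2, rule ennreal_leI)
        fix x assume "x \<in> space N"
        then have "norm (f x) \<le> K" using f(2) sp by auto
        then show "norm (f x - s i x) \<le> 2 * K"
          using cs[of i "g i x"] norm_triangle_ineq4[of "f x" "s i x"] by (simp add: s_def)
      qed
      show "AE x in N. (\<lambda>i. ennreal (norm (f x - s i x))) \<longlonglongrightarrow> 0"
      proof (rule AE_I2)
        fix x assume "x \<in> space N"
        then have "(\<lambda>i. norm (f x - s i x)) \<longlonglongrightarrow> norm (f x - f x)"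
          using sp by (intro tendsto_intros pt) auto
        then show "(\<lambda>i. ennreal (norm (f x - s i x))) \<longlonglongrightarrow> 0"
          using tendsto_ennrealI by fastforce
      qed
    qed auto
    then show ?thesis by simp
  qed
  let ?I = "\<lambda>i. Bochner_Integration.simple_bochner_integral N (s i)"
  have bd: "ennreal (norm (?I i - ?I j)) \<le> (\<integral>\<^sup>+x. ennreal (norm (f x - s i x)) \<partial>N) + (\<integral>\<^sup>+x. ennreal (norm (f x - s j x)) \<partial>N)" for i j
  proof -
    have dd: "Bochner_Integration.simple_bochner_integrable N (\<lambda>x. s i x - s j x)"
      by (rule simple_bochner_integrable_compose2[OF _ si si]) simp
    have "norm (?I i - ?I j) = norm (Bochner_Integration.simple_bochner_integral N (\<lambda>x. s i x - s j x))"
      by (simp add: simple_bochner_integral_diff[OF si si])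
    also have "\<dots> \<le> Bochner_Integration.simple_bochner_integral N (\<lambda>x. norm (s i x - s j x))"
      by (rule simple_bochner_integral_norm_bound[OF dd])
    finally have "ennreal (norm (?I i - ?I j)) \<le> ennreal \<dots>" by (rule ennreal_leI)
    also have "\<dots> = (\<integral>\<^sup>+x. norm (s i x - s j x) \<partial>N)"
      by (rule simple_bochner_integral_eq_nn_integral)
        (auto intro: simple_bochner_integrable_compose2[OF _ si si, of "\<lambda>x y. norm (x - y)"])
    also have "\<dots> \<le> (\<integral>\<^sup>+x. ennreal (norm (f x - s i x)) + ennreal (norm (f x - s j x)) \<partial>N)"
      by (intro nn_integral_mono)
        (metis ennreal_leI ennreal_plus norm_ge_zero norm_minus_commute norm_diff_triangle_le order_refl)
    also have "\<dots> = (\<integral>\<^sup>+x. ennreal (norm (f x - s i x)) \<partial>N) + (\<integral>\<^sup>+x. ennreal (norm (f x - s j x)) \<partial>N)"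
      using dm[of i] dm[of j] by (intro nn_integral_add) auto
    finally show ?thesis .
  qed
  have "Cauchy ?I"
  proof (rule metric_CauchyI)
    fix e :: real assume e: "e > 0"
    have "\<forall>\<^sub>F i in sequentially. (\<integral>\<^sup>+x. ennreal (norm (f x - s i x)) \<partial>N) < ennreal (e / 3)"
      using lim e by (intro order_tendstoD(2)) auto
    then obtain n where n: "\<And>i. i \<ge> n \<Longrightarrow> (\<integral>\<^sup>+x. ennreal (norm (f x - s i x)) \<partial>N) < ennreal (e / 3)"
      by (auto simp: eventually_sequentially)
    have "norm (?I i - ?I j) < e" if "i \<ge> n" "j \<ge> n" for i j
    proof -
      have "ennreal (norm (?I i - ?I j)) \<le> ennreal (e / 3) + ennreal (e / 3)"
        using n[OF that(1)] n[OF that(2)] by (intro order_trans[OF bd] add_mono) (auto intro: less_imp_le)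
      also have "\<dots> = ennreal (2 * e / 3)" using e by (subst ennreal_plus[symmetric]) auto
      finally have "norm (?I i - ?I j) \<le> 2 * e / 3" using e by (simp add: ennreal_le_iff)
      then show ?thesis using e by simp
    qed
    then show "\<exists>M. \<forall>m\<ge>M. \<forall>n\<ge>M. dist (?I m) (?I n) < e"
      by (auto simp: dist_norm)
  qed
  then obtain y where "?I \<longlonglongrightarrow> y" using Cauchy_convergent convergent_def by blast
  then show ?thesis unfolding has_vector_integral_def using fN si lim by blast
qed

lemma vector_integral_functional:
  fixes f :: "real \<Rightarrow> 'b::complex_banach"
  assumes "finite_measure N" and N: "sets N = sets borel_Rplus"
    and f: "continuous_on {0..} f" "\<And>t. t \<ge> 0 \<Longrightarrow> norm (f t) \<le> K"
    and \<xi>: "contractive_functional \<xi>"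
  shows "\<xi> (vector_integral N f) = (LINT t|N. \<xi> (f t))"
proof -
  obtain y where y: "has_vector_integral N f y" using has_vector_integral_exists[OF assms(1-4)] by blast
  have "has_bochner_integral N (\<lambda>t. \<xi> (f t)) (\<xi> y)"
    by (rule has_vector_integral_functional[OF \<xi> y])
  then show ?thesis using vector_integral_eq[OF y] by (simp add: has_bochner_integral_integral_eq)
qed

text \<open>
  Every estimate for an integral against \<open>\<mu>\<close> is reduced by this to the four finite positive measures, where
  the Bochner integral is at hand.
\<close>

lemma complex_measure_finite_parts:
  assumes "complex_measure borel_Rplus \<mu>"
  shows "\<exists>p1 p2 p3 p4.
      (\<forall>p\<in>{p1, p2, p3, p4}. finite_measure p \<and> sets p = sets borel_Rplus) \<and>
      (\<forall>f :: real \<Rightarrow> 'b::complex_normed_vector. complex_measure_integral borel_Rplus \<mu> f =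
        vector_integral p1 f - vector_integral p2 f + \<i> *\<^sub>C (vector_integral p3 f - vector_integral p4 f)) \<and>
      (\<forall>g :: real \<Rightarrow> complex. complex_measure_integral borel_Rplus \<mu> g =
        (LINT t|p1. g t) - (LINT t|p2. g t) + \<i> * ((LINT t|p3. g t) - (LINT t|p4. g t)))"
proof -
  have \<mu>: "(\<lambda>n. \<mu> (A n)) sums \<mu> (\<Union>n::nat. A n)" if "range A \<subseteq> sets borel_Rplus" "disjoint_family A" for A
    using assms that by (auto simp: complex_measure_def)
  obtain K1 where K1: "\<And>A. A \<in> sets borel_Rplus \<Longrightarrow> \<bar>Re (\<mu> A)\<bar> \<le> K1"
    using countably_additive_bounded[of borel_Rplus "\<lambda>A. Re (\<mu> A)"] sums_Re[OF \<mu>] by blast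
  obtain K2 where K2: "\<And>A. A \<in> sets borel_Rplus \<Longrightarrow> \<bar>Im (\<mu> A)\<bar> \<le> K2"
    using countably_additive_bounded[of borel_Rplus "\<lambda>A. Im (\<mu> A)"] sums_Im[OF \<mu>] by blast
  let ?p = "positive_part borel_Rplus"
  have fp: "finite_measure (?p \<nu>) \<and> sets (?p \<nu>) = sets borel_Rplus"
    if "\<And>A. A \<in> sets borel_Rplus \<Longrightarrow> \<bar>\<nu> A\<bar> \<le> K" for \<nu> and K :: real
    using finite_measure_positive_part[of borel_Rplus \<nu> K] that abs_le_D1 by blast
  have "finite_measure p \<and> sets p = sets borel_Rplus"
    if "p \<in> {?p (\<lambda>A. Re (\<mu> A)), ?p (\<lambda>A. - Re (\<mu> A)), ?p (\<lambda>A. Im (\<mu> A)), ?p (\<lambda>A. - Im (\<mu> A))}" for p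
  proof -
    have "\<bar>- Re (\<mu> A)\<bar> \<le> K1" "\<bar>- Im (\<mu> A)\<bar> \<le> K2" if "A \<in> sets borel_Rplus" for A
      using K1[OF that] K2[OF that] by simp_all
    note fps = fp[OF K1] fp[OF this(1)] fp[OF K2] fp[OF this(2)]
    show ?thesis using that by (elim insertE emptyE) (simp_all only: fps)
  qed
  then show ?thesis
    by (intro exI[of _ "?p (\<lambda>A. Re (\<mu> A))"] exI[of _ "?p (\<lambda>A. - Re (\<mu> A))"]
        exI[of _ "?p (\<lambda>A. Im (\<mu> A))"] exI[of _ "?p (\<lambda>A. - Im (\<mu> A))"])
      (simp add: complex_measure_integral_def signed_integral_def vector_integral_eq_lebesgue_integral scaleC_complex_def)
qed

section \<open>Orbits of a bounded semigroup\<close>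

locale bounded_C0_semigroup =
  fixes T :: "real \<Rightarrow> 'a::complex_banach \<Rightarrow>\<^sub>L 'a" and K :: real
  assumes C0: "C0_semigroup T"
    and bound: "t \<ge> 0 \<Longrightarrow> norm (T t) \<le> K"
begin

lemma T0: "T 0 = id_blinfun" and T_add: "s \<ge> 0 \<Longrightarrow> t \<ge> 0 \<Longrightarrow> T (s + t) = T s o\<^sub>L T t"
  and T_complex: "t \<ge> 0 \<Longrightarrow> T t (c *\<^sub>C x) = c *\<^sub>C T t x"
  and T_right: "((\<lambda>t. T t x) \<longlongrightarrow> x) (at_right 0)"
  using C0 by (auto simp: C0_semigroup_def bounded_ops_def)

lemma K_nonneg: "K \<ge> 0"
  using bound[of 0] norm_ge_zero[of "T 0"] by linarith

lemma norm_T: "t \<ge> 0 \<Longrightarrow> norm (T t x) \<le> K * norm x"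
  using bound[of t] norm_blinfun[of "T t" x] by (meson mult_right_mono norm_ge_zero order_trans)

lemma T_split:
  assumes "0 \<le> s" "s \<le> t" shows "T t x = T s (T (t - s) x)"
  using T_add[of s "t - s"] assms by simp

text \<open>
  The factor \<open>T(min s t)\<close> can be split off, so the modulus of continuity at \<open>0\<close> controls the whole orbit.
\<close>

lemma T_diff_le:
  assumes "0 \<le> s" "0 \<le> t"
  shows "norm (T t x - T s x) \<le> K * norm (T \<bar>t - s\<bar> x - x)"
proof -
  have *: "norm (T t x - T s x) \<le> K * norm (T (t - s) x - x)" if "0 \<le> s" "s \<le> t" for s t
    using T_split[OF that, of x] norm_T[OF that(1), of "T (t - s) x - x"] by (simp add: blinfun.diff_right)
  show ?thesis
    using *[of s t] *[of t s] assms by (cases "s \<le> t") (auto simp: norm_minus_commute abs_if)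
qed

lemma continuous_orbit: "continuous_on {0..} (\<lambda>t. T t x)"
  unfolding continuous_on_def
proof
  fix t :: real assume t: "t \<in> {0..}"
  have "filterlim (\<lambda>s::real. \<bar>s - t\<bar>) (at_right 0) (at t within {0..})"
    unfolding filterlim_at by (auto intro!: tendsto_eq_intros simp: eventually_at_filter)
  then have "((\<lambda>s. T \<bar>s - t\<bar> x) \<longlongrightarrow> x) (at t within {0..})"
    by (rule filterlim_compose[OF T_right])
  then have "((\<lambda>s. norm (T \<bar>s - t\<bar> x - x)) \<longlongrightarrow> 0) (at t within {0..})"
    by (intro tendsto_norm_zero) (simp add: LIM_zero_iff)
  then have "((\<lambda>s. K * norm (T \<bar>s - t\<bar> x - x)) \<longlongrightarrow> K * 0) (at t within {0..})"
    by (intro tendsto_intros)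
  then have "((\<lambda>s. T s x - T t x) \<longlongrightarrow> 0) (at t within {0..})"
    unfolding mult_zero_right
    by (rule Lim_null_comparison[rotated]) (use t in \<open>auto simp: eventually_at_filter intro!: always_eventually T_diff_le\<close>)
  then show "((\<lambda>s. T s x) \<longlongrightarrow> T t x) (at t within {0..})"
    by (simp add: LIM_zero_iff)
qed

lemma generator_limit:
  assumes "y \<in> generator_dom T"
  shows "((\<lambda>t. (T t y - y) /\<^sub>R t) \<longlongrightarrow> generator T y) (at_right 0)"
  using assms unfolding generator_dom_def generator_def
  by (auto simp: tendsto_Lim)

text \<open>
  Splitting off \<open>T\<close> at the left end point reduces left and right difference quotients at \<open>t\<close> to the right
  difference quotient at \<open>0\<close>.
\<close>

lemma orbit_derivative:
  assumes y: "y \<in> generator_dom T" and t: "t \<ge> 0"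
  shows "((\<lambda>t. T t y) has_vector_derivative T t (generator T y)) (at t within {0..})"
proof -
  let ?A = "generator T y"
  define e where "e h = K * norm ((T h y - y) /\<^sub>R h - ?A) + K * norm (T h ?A - ?A)" for h
  have "(e \<longlongrightarrow> K * norm (?A - ?A) + K * norm (?A - ?A)) (at_right 0)"
    unfolding e_def by (intro tendsto_intros generator_limit[OF y] T_right)
  then have e0: "(e \<longlongrightarrow> 0) (at_right 0)" by simp
  have "filterlim (\<lambda>s::real. \<bar>s - t\<bar>) (at_right 0) (at t within {0..})"
    unfolding filterlim_at by (auto intro!: tendsto_eq_intros simp: eventually_at_filter)
  then have lim: "((\<lambda>s. e \<bar>s - t\<bar>) \<longlongrightarrow> 0) (at t within {0..})"
    by (rule filterlim_compose[OF e0])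
  have est: "norm ((T b y - T a y) /\<^sub>R (b - a) - T t ?A) \<le> e (b - a)"
    if "0 \<le> a" "a < b" "t = a \<or> t = b" for a b
  proof -
    let ?D = "(T (b - a) y - y) /\<^sub>R (b - a)"
    have "(T b y - T a y) /\<^sub>R (b - a) = T a ?D"
      using T_split[of a b y] that by (simp add: blinfun.diff_right blinfun.scaleR_right)
    then have "norm ((T b y - T a y) /\<^sub>R (b - a) - T t ?A) = norm (T a (?D - ?A) + (T a ?A - T t ?A))"
      by (simp add: blinfun.diff_right)
    also have "\<dots> \<le> norm (T a (?D - ?A)) + norm (T a ?A - T t ?A)" by (rule norm_triangle_ineq)
    also have "\<dots> \<le> K * norm (?D - ?A) + K * norm (T (b - a) ?A - ?A)"
    proof (rule add_mono)
      show "norm (T a (?D - ?A)) \<le> K * norm (?D - ?A)" using that by (intro norm_T)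
      show "norm (T a ?A - T t ?A) \<le> K * norm (T (b - a) ?A - ?A)"
        using T_diff_le[of t a ?A] that K_nonneg t by auto
    qed
    finally show ?thesis by (simp add: e_def)
  qed
  have "((\<lambda>s. (T s y - T t y) /\<^sub>R (s - t) - T t ?A) \<longlongrightarrow> 0) (at t within {0..})"
  proof (rule Lim_null_comparison[OF _ lim])
    show "\<forall>\<^sub>F s in at t within {0..}. norm ((T s y - T t y) /\<^sub>R (s - t) - T t ?A) \<le> e \<bar>s - t\<bar>"
      unfolding eventually_at_filter
    proof (intro always_eventually allI impI)
      fix s assume s: "s \<noteq> t" "s \<in> {0..}"
      show "norm ((T s y - T t y) /\<^sub>R (s - t) - T t ?A) \<le> e \<bar>s - t\<bar>"
      proof (cases "s < t")
        case True
        have "(T s y - T t y) /\<^sub>R (s - t) = (T t y - T s y) /\<^sub>R (t - s)"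
        proof -
          have "T s y - T t y = - (T t y - T s y)" "s - t = - (t - s)" by simp_all
          then show ?thesis by (simp only: inverse_minus_eq scaleR_minus_left scaleR_minus_right minus_minus)
        qed
        then show ?thesis using est[of s t] True s by simp
      next
        case False
        then show ?thesis using est[of t s] s t by simp
      qed
    qed
  qed
  then have "((\<lambda>s. norm ((T s y - T t y) /\<^sub>R (s - t) - T t ?A)) \<longlongrightarrow> 0) (at t within {0..})"
    by (rule tendsto_norm_zero)
  moreover have "\<forall>\<^sub>F s in at t within {0..}. norm ((T s y - T t y) /\<^sub>R (s - t) - T t ?A)
      = norm (T s y - T t y - (s - t) *\<^sub>R T t ?A) / norm (s - t)"
    unfolding eventually_at_filter
  proof (intro always_eventually allI impI)
    fix s assume "s \<noteq> t"
    then have "T s y - T t y - (s - t) *\<^sub>R T t ?A = (s - t) *\<^sub>R ((T s y - T t y) /\<^sub>R (s - t) - T t ?A)"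
      by (simp add: scaleR_diff_right)
    then show "norm ((T s y - T t y) /\<^sub>R (s - t) - T t ?A) = norm (T s y - T t y - (s - t) *\<^sub>R T t ?A) / norm (s - t)"
      using \<open>s \<noteq> t\<close> by simp
  qed
  ultimately have "((\<lambda>s. norm (T s y - T t y - (s - t) *\<^sub>R T t ?A) / norm (s - t)) \<longlongrightarrow> 0) (at t within {0..})"
    by (rule Lim_transform_eventually)
  then show ?thesis
    unfolding has_vector_derivative_def has_derivative_iff_norm by (simp add: bounded_linear_scaleR_left)
qed

definition orbit_fun :: "('a \<Rightarrow> complex) \<Rightarrow> 'a \<Rightarrow> real \<Rightarrow> complex" where
  "orbit_fun \<xi> x t = (if 0 \<le> t then \<xi> (T t x) else 0)"

lemma continuous_functional_orbit:
  assumes "contractive_functional \<xi>"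
  shows "continuous_on {0..} (\<lambda>t. \<xi> (T t x))"
  using bounded_linear.continuous_on[OF contractive_functionalD(4)[OF assms] continuous_orbit] .

lemma orbit_fun_measurable:
  assumes "contractive_functional \<xi>"
  shows "orbit_fun \<xi> x \<in> borel_measurable borel"
proof -
  have "(\<lambda>t. indicator {0..} t *\<^sub>R \<xi> (T t x)) \<in> borel_measurable borel"
    by (intro borel_measurable_continuous_on_indicator continuous_functional_orbit assms) auto
  moreover have "(\<lambda>t. indicator {0..} t *\<^sub>R \<xi> (T t x)) = orbit_fun \<xi> x"
    by (auto simp: orbit_fun_def indicator_def fun_eq_iff)
  ultimately show ?thesis by simp
qed

lemma orbit_fun_bound:
  assumes "contractive_functional \<xi>"
  shows "cmod (orbit_fun \<xi> x t) \<le> K * norm x"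
  using order_trans[OF contractive_functionalD(3)[OF assms] norm_T[of t x]] K_nonneg
  by (auto simp: orbit_fun_def)

end

section \<open>Laplace transforms of orbits and the resolvent\<close>

definition laplace :: "(real \<Rightarrow> complex) \<Rightarrow> complex \<Rightarrow> complex" where
  "laplace f z = (LINT t|lborel. exp (- z * of_real t) * f t)"

lemma exp_halfline_integral:
  fixes \<alpha> :: real assumes "\<alpha> > 0"
  shows "has_bochner_integral lborel (\<lambda>t. indicator {0..} t * exp (- \<alpha> * t)) (1 / \<alpha>)"
proof -
  have "integral\<^sup>N lborel (\<lambda>t. indicator {0..} t * exp (- \<alpha> * t)) = ennreal (1 / \<alpha>)"
    using nn_integral_has_integral_lebesgue[OF _ has_integral_exp_minus_to_infinity[OF assms, of 0]] by simp
  then show ?thesis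
    using assms by (intro has_bochner_integral_nn_integral) auto
qed

lemma laplace_integrable:
  assumes f: "f \<in> borel_measurable borel" "\<And>t. cmod (f t) \<le> B" "\<And>t. t < 0 \<Longrightarrow> f t = 0"
    and z: "Re z > 0"
  shows "integrable lborel (\<lambda>t. exp (- z * of_real t) * f t)"
    and "cmod (laplace f z) \<le> B / Re z"
proof -
  have B: "B \<ge> 0" using f(2)[of 0] norm_ge_zero[of "f 0"] by linarith
  have hb: "has_bochner_integral lborel (\<lambda>t. B * (indicator {0..} t * exp (- Re z * t))) (B * (1 / Re z))"
    by (rule has_bochner_integral_mult_right[OF exp_halfline_integral[OF z]])
  have le: "norm (exp (- z * of_real t) * f t) \<le> B * (indicator {0..} t * exp (- Re z * t))" for t
    using f(2)[of t] f(3)[of t] by (auto simp: norm_mult indicator_def)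
  show int: "integrable lborel (\<lambda>t. exp (- z * of_real t) * f t)"
    by (rule Bochner_Integration.integrable_bound[OF integrable.intros[OF hb]])
       (use f(1) le B in \<open>auto intro!: AE_I2 order_trans[OF le]\<close>)
  have "cmod (laplace f z) \<le> (LINT t|lborel. norm (exp (- z * of_real t) * f t))"
    unfolding laplace_def by (rule integral_norm_bound)
  also have "\<dots> \<le> (LINT t|lborel. B * (indicator {0..} t * exp (- Re z * t)))"
    by (rule integral_mono[OF integrable_norm[OF int] integrable.intros[OF hb]]) (rule le)
  also have "\<dots> = B / Re z" using has_bochner_integral_integral_eq[OF hb] by simp
  finally show "cmod (laplace f z) \<le> B / Re z" .
qed

text \<open>
  This is integration by parts for the Laplace transform, as \<open>-e\<^sup>-\<^sup>z\<^sup>t F(t)\<close> is a primitive of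
  \<open>e\<^sup>-\<^sup>z\<^sup>t (z F(t) - F'(t))\<close>.
\<close>

lemma laplace_derivative:
  fixes F F' :: "real \<Rightarrow> complex"
  assumes d: "\<And>t. t \<ge> 0 \<Longrightarrow> (F has_vector_derivative F' t) (at t within {0..})"
    and c: "continuous_on {0..} F'"
    and b: "\<And>t. t \<ge> 0 \<Longrightarrow> cmod (F t) \<le> B" "\<And>t. t \<ge> 0 \<Longrightarrow> cmod (F' t) \<le> B"
    and z: "Re z > 0"
  shows "laplace (\<lambda>t. if 0 \<le> t then z * F t - F' t else 0) z = F 0"
proof -
  have cF: "continuous_on {0..} F"
    using has_vector_derivative_continuous[OF d] by (simp add: continuous_on_eq_continuous_within)
  define G where "G t = - (exp (- z * of_real t) * F t)" for t
  define g where "g t = exp (- z * of_real t) * (z * F t - F' t)" for t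
  define h where "h t = (if 0 \<le> t then z * F t - F' t else 0)" for t
  have dG: "(G has_vector_derivative g t) (at t within {0..})" if "t \<ge> 0" for t
  proof -
    have "((\<lambda>w. exp (- z * w)) has_field_derivative exp (- z * of_real t) * - z) (at (of_real t))"
      by (auto intro!: derivative_eq_intros)
    then have e: "((\<lambda>t. exp (- z * of_real t)) has_vector_derivative exp (- z * of_real t) * - z) (at t within {0..})"
      by (rule has_vector_derivative_at_within[OF has_vector_derivative_real_field])
    have "((\<lambda>t. exp (- z * of_real t) * F t) has_vector_derivative
        exp (- z * of_real t) * F' t + exp (- z * of_real t) * - z * F t) (at t within {0..})"
      by (rule has_vector_derivative_mult[OF e d[OF that]])
    then have "(G has_vector_derivative
        - (exp (- z * of_real t) * F' t + exp (- z * of_real t) * - z * F t)) (at t within {0..})"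
      unfolding G_def by (rule has_vector_derivative_minus)
    then show ?thesis by (rule has_vector_derivative_eq_rhs) (simp add: g_def algebra_simps)
  qed
  have cg: "continuous_on {0..} g"
    unfolding g_def by (intro continuous_intros cF c)
  have hm: "h \<in> borel_measurable borel"
  proof -
    have "(\<lambda>t. indicator {0..} t *\<^sub>R (z * F t - F' t)) \<in> borel_measurable borel"
      by (intro borel_measurable_continuous_on_indicator continuous_intros cF c) auto
    moreover have "(\<lambda>t. indicator {0..} t *\<^sub>R (z * F t - F' t)) = h"
      by (auto simp: h_def indicator_def fun_eq_iff)
    ultimately show ?thesis by simp
  qed
  have B: "B \<ge> 0" using b(1)[of 0] norm_ge_zero[of "F 0"] by linarith
  have hb: "cmod (h t) \<le> cmod z * B + B" for t
    using b[of t] B unfolding h_def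
    by (auto intro!: order_trans[OF norm_triangle_ineq4] add_mono simp: norm_mult mult_left_mono)
  have int: "integrable lborel (\<lambda>t. exp (- z * of_real t) * h t)"
    by (rule laplace_integrable(1)[OF hm hb _ z]) (simp add: h_def)
  have fin: "(LINT t|lborel. indicator {0..N} t *\<^sub>R (exp (- z * of_real t) * h t)) = G N - G 0" if "N \<ge> 0" for N
  proof -
    have "(LINT t|lborel. indicator {0..N} t *\<^sub>R g t) = G N - G 0"
      by (rule integral_FTC_atLeastAtMost[OF that])
        (auto intro: has_vector_derivative_within_subset[OF dG] continuous_on_subset[OF cg])
    moreover have "(\<lambda>t. indicator {0..N} t *\<^sub>R (exp (- z * of_real t) * h t)) = (\<lambda>t. indicator {0..N} t *\<^sub>R g t)"
      by (auto simp: h_def g_def indicator_def)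
    ultimately show ?thesis by (simp only:)
  qed
  have "((\<lambda>N. LINT t|lborel. indicator {0..N} t *\<^sub>R (exp (- z * of_real t) * h t)) \<longlongrightarrow> laplace h z) at_top"
    unfolding laplace_def
  proof (rule integral_dominated_convergence_at_top[where w="\<lambda>t. norm (exp (- z * of_real t) * h t)"])
    show "\<forall>\<^sub>F N in at_top. AE t in lborel. norm (indicator {0..N} t *\<^sub>R (exp (- z * of_real t) * h t)) \<le> norm (exp (- z * of_real t) * h t)"
      by (auto intro!: always_eventually AE_I2 simp: indicator_def)
    show "AE t in lborel. ((\<lambda>N. indicator {0..N} t *\<^sub>R (exp (- z * of_real t) * h t)) \<longlongrightarrow> exp (- z * of_real t) * h t) at_top"
    proof (rule AE_I2)
      fix t :: real
      have "\<forall>\<^sub>F N in at_top. indicator {0..N} t *\<^sub>R (exp (- z * of_real t) * h t) = exp (- z * of_real t) * h t"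
        using eventually_ge_at_top[of t] by eventually_elim (auto simp: h_def indicator_def)
      then show "((\<lambda>N. indicator {0..N} t *\<^sub>R (exp (- z * of_real t) * h t)) \<longlongrightarrow> exp (- z * of_real t) * h t) at_top"
        by (rule tendsto_eventually)
    qed
  qed (use int hm in auto)
  moreover have "((\<lambda>N. LINT t|lborel. indicator {0..N} t *\<^sub>R (exp (- z * of_real t) * h t)) \<longlongrightarrow> 0 - G 0) at_top"
  proof (rule Lim_transform_eventually)
    show "\<forall>\<^sub>F N in at_top. G N - G 0 = (LINT t|lborel. indicator {0..N} t *\<^sub>R (exp (- z * of_real t) * h t))"
      using eventually_ge_at_top[of 0] by eventually_elim (rule fin[symmetric])
    have "filterlim (\<lambda>N. - Re z * N) at_bot at_top"
      using z by (intro filterlim_tendsto_neg_mult_at_bot[OF tendsto_const _ filterlim_ident]) auto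
    then have "((\<lambda>N. exp (- Re z * N) * B) \<longlongrightarrow> 0 * B) at_top"
      by (intro tendsto_intros filterlim_compose[OF exp_at_bot])
    then have lim: "((\<lambda>N. exp (- Re z * N) * B) \<longlongrightarrow> 0) at_top" by simp
    have "\<forall>\<^sub>F N in at_top. norm (G N) \<le> exp (- Re z * N) * B"
      using eventually_ge_at_top[of 0] by eventually_elim (simp add: G_def norm_mult b)
    then have "(G \<longlongrightarrow> 0) at_top"
      using lim by (rule Lim_null_comparison)
    then show "((\<lambda>N. G N - G 0) \<longlongrightarrow> 0 - G 0) at_top" by (intro tendsto_intros)
  qed
  ultimately have "laplace h z = 0 - G 0"
    by (rule tendsto_unique[OF trivial_limit_at_top_linorder])
  then show ?thesis by (simp add: G_def h_def[abs_def])
qed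

definition is_resolvent :: "'a::complex_normed_vector set \<Rightarrow> ('a \<Rightarrow> 'a) \<Rightarrow> complex \<Rightarrow> ('a \<Rightarrow>\<^sub>L 'a) \<Rightarrow> bool" where
  "is_resolvent D A l R \<longleftrightarrow>
     (\<forall>y. R y \<in> D \<and> l *\<^sub>C R y - A (R y) = y) \<and> (\<forall>x\<in>D. R (l *\<^sub>C x - A x) = x) \<and> R \<in> bounded_ops"

lemma not_in_real_spectrum:
  assumes "s \<notin> real_spectrum_iA T"
  obtains R where "is_resolvent (generator_dom T) (generator T) (- \<i> * of_real s) R"
proof -
  have "\<i> * (- \<i> * of_real s) = complex_of_real s" by simp
  then have "- \<i> * of_real s \<notin> spectrum (generator_dom T) (generator T)"
    using assms unfolding real_spectrum_iA_def by (metis (mono_tags, lifting) image_eqI mem_Collect_eq)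
  then show ?thesis
    using that unfolding spectrum_def resolvent_set_def is_resolvent_def by auto
qed

lemma resolvent_identity:
  assumes R: "is_resolvent D A l R" and S: "is_resolvent D A m S"
  shows "S x - R x = (l - m) *\<^sub>C R (S x)"
proof -
  have Sx: "S x \<in> D" "m *\<^sub>C S x - A (S x) = x" using S by (auto simp: is_resolvent_def)
  have "l *\<^sub>C S x - A (S x) = (l - m) *\<^sub>C S x + x"
    using Sx(2) scaleC_add_left[of "l - m" m "S x"] by (simp add: algebra_simps)
  then have "R ((l - m) *\<^sub>C S x + x) = S x"
    using R Sx(1) unfolding is_resolvent_def by metis
  then show ?thesis
    using R by (simp add: blinfun.add_right is_resolvent_def bounded_ops_def algebra_simps)
qed

text \<open>
  The resolvent identity first gives \<open>norm S \<le> 2 * norm R\<close>, and then, inserted again, the estimate.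
\<close>

lemma resolvent_diff_norm:
  assumes R: "is_resolvent D A l R" and S: "is_resolvent D A m S"
    and lm: "cmod (m - l) * norm R \<le> 1 / 2"
  shows "norm (S - R) \<le> 2 * cmod (m - l) * (norm R)\<^sup>2"
proof -
  have "norm ((S - R) x) \<le> cmod (m - l) * norm R * norm S * norm x" for x
  proof -
    have "norm ((S - R) x) = cmod (m - l) * norm (R (S x))"
      using resolvent_identity[OF R S, of x] by (simp add: blinfun.diff_left norm_scaleC norm_minus_commute)
    also have "\<dots> \<le> cmod (m - l) * (norm R * (norm S * norm x))"
      by (intro mult_left_mono order_trans[OF norm_blinfun] norm_blinfun) auto
    finally show ?thesis by (simp add: mult_ac)
  qed
  then have le: "norm (S - R) \<le> cmod (m - l) * norm R * norm S"
    by (intro norm_blinfun_bound) auto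
  also have "\<dots> \<le> 1 / 2 * norm S"
    using lm by (intro mult_right_mono) auto
  finally have "norm S \<le> 2 * norm R"
    using norm_triangle_ineq2[of S R] by linarith
  then have "cmod (m - l) * norm R * norm S \<le> cmod (m - l) * norm R * (2 * norm R)"
    by (intro mult_left_mono) auto
  with le show ?thesis by (simp add: power2_eq_square mult_ac)
qed

lemma continuous_on_resolvent:
  assumes R: "\<And>s. s \<in> X \<Longrightarrow> is_resolvent D A (c * of_real s) (R s)"
  shows "continuous_on X R"
  unfolding continuous_on_def
proof
  fix s assume s: "s \<in> X"
  have d0: "((\<lambda>u. cmod (c * of_real u - c * of_real s)) \<longlongrightarrow> 0) (at s within X)"
    by (auto intro!: tendsto_eq_intros)
  have "((\<lambda>u. cmod (c * of_real u - c * of_real s) * norm (R s)) \<longlongrightarrow> 0 * norm (R s)) (at s within X)"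
    by (intro tendsto_intros d0)
  then have "\<forall>\<^sub>F u in at s within X. cmod (c * of_real u - c * of_real s) * norm (R s) < 1 / 2"
    by (intro order_tendstoD(2)) auto
  then have ev: "\<forall>\<^sub>F u in at s within X. norm (R u - R s) \<le> 2 * cmod (c * of_real u - c * of_real s) * (norm (R s))\<^sup>2"
    unfolding eventually_at_filter
    by eventually_elim (use resolvent_diff_norm[OF R[OF s] R] in \<open>auto simp: less_imp_le\<close>)
  have "((\<lambda>u. 2 * cmod (c * of_real u - c * of_real s) * (norm (R s))\<^sup>2) \<longlongrightarrow> 2 * 0 * (norm (R s))\<^sup>2) (at s within X)"
    by (intro tendsto_intros d0)
  then have "((\<lambda>u. R u - R s) \<longlongrightarrow> 0) (at s within X)"
    by (intro Lim_null_comparison[OF ev]) simp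
  then show "(R \<longlongrightarrow> R s) (at s within X)" by (rule LIM_zero_cancel)
qed

context bounded_C0_semigroup
begin

text \<open>
  With \<open>y = R x\<close> one has \<open>x = l y - A y\<close>, so the orbit of \<open>x\<close> is \<open>l F - F'\<close> for the orbit \<open>F\<close> of \<open>y\<close>, and the
  Laplace transform of \<open>(l + \<alpha>) F - F'\<close> at \<open>l + \<alpha>\<close> is \<open>F(0)\<close>.
\<close>

lemma laplace_orbit_step:
  assumes R: "is_resolvent (generator_dom T) (generator T) l R" and l: "Re l = 0" and \<alpha>: "\<alpha> > 0"
    and \<xi>: "contractive_functional \<xi>"
  shows "laplace (orbit_fun \<xi> x) (l + of_real \<alpha>) = \<xi> (R x) - of_real \<alpha> * laplace (orbit_fun \<xi> (R x)) (l + of_real \<alpha>)"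
proof -
  note \<xi>D = contractive_functionalD[OF \<xi>]
  define y where "y = R x"
  let ?A = "generator T y" and ?z = "l + of_real \<alpha>"
  have y: "y \<in> generator_dom T" "l *\<^sub>C y - ?A = x"
    using R by (auto simp: is_resolvent_def y_def)
  define F where "F t = \<xi> (T t y)" for t
  define F' where "F' t = \<xi> (T t ?A)" for t
  have z: "Re ?z > 0" using l \<alpha> by simp
  have "laplace (\<lambda>t. if 0 \<le> t then ?z * F t - F' t else 0) ?z = F 0"
  proof (rule laplace_derivative[where B="K * max (norm y) (norm ?A)"])
    show "(F has_vector_derivative F' t) (at t within {0..})" if "t \<ge> 0" for t
      unfolding F_def F'_def
      by (rule bounded_linear.has_vector_derivative[OF \<xi>D(4) orbit_derivative[OF y(1) that]])
    show "continuous_on {0..} F'"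
      unfolding F'_def by (rule continuous_functional_orbit[OF \<xi>])
    have "cmod (\<xi> (T t w)) \<le> K * max (norm y) (norm ?A)" if "t \<ge> 0" "norm w \<le> max (norm y) (norm ?A)" for t w
      using \<xi>D(3)[of "T t w"] norm_T[OF that(1), of w] mult_left_mono[OF that(2) K_nonneg] by linarith
    then show "cmod (F t) \<le> K * max (norm y) (norm ?A)" "cmod (F' t) \<le> K * max (norm y) (norm ?A)" if "t \<ge> 0" for t
      using that by (auto simp: F_def F'_def)
  qed (rule z)
  moreover have "(\<lambda>t. if 0 \<le> t then ?z * F t - F' t else 0) = (\<lambda>t. orbit_fun \<xi> x t + of_real \<alpha> * orbit_fun \<xi> y t)"
  proof
    fix t
    have "\<xi> (T t x) = l * F t - F' t" if "t \<ge> 0"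
      unfolding F_def F'_def y(2)[symmetric]
      using that by (simp add: blinfun.diff_right T_complex \<xi>D(2,5))
    then show "(if 0 \<le> t then ?z * F t - F' t else 0) = orbit_fun \<xi> x t + of_real \<alpha> * orbit_fun \<xi> y t"
      by (simp add: orbit_fun_def F_def algebra_simps)
  qed
  moreover have "laplace (\<lambda>t. orbit_fun \<xi> x t + of_real \<alpha> * orbit_fun \<xi> y t) ?z
      = laplace (orbit_fun \<xi> x) ?z + of_real \<alpha> * laplace (orbit_fun \<xi> y) ?z"
  proof -
    have int: "integrable lborel (\<lambda>t. exp (- ?z * of_real t) * orbit_fun \<xi> w t)" for w
      by (rule laplace_integrable(1)[OF orbit_fun_measurable[OF \<xi>] orbit_fun_bound[OF \<xi>] _ z]) (simp add: orbit_fun_def)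
    have "laplace (\<lambda>t. orbit_fun \<xi> x t + of_real \<alpha> * orbit_fun \<xi> y t) ?z
      = (LINT t|lborel. exp (- ?z * of_real t) * orbit_fun \<xi> x t + of_real \<alpha> * (exp (- ?z * of_real t) * orbit_fun \<xi> y t))"
      unfolding laplace_def by (simp add: algebra_simps)
    also have "\<dots> = laplace (orbit_fun \<xi> x) ?z + of_real \<alpha> * laplace (orbit_fun \<xi> y) ?z"
      unfolding laplace_def
      by (subst Bochner_Integration.integral_add[OF int integrable_mult_right[OF int]]) simp
    finally show ?thesis .
  qed
  moreover have "F 0 = \<xi> (R x)" by (simp add: F_def T0 y_def)
  ultimately show ?thesis by (simp add: y_def algebra_simps)
qed

text \<open>
  Boundedness of the semigroup alone only bounds the Laplace transform at \<open>l + \<alpha>\<close> by a multiple of \<open>1/\<alpha>\<close>.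
  Applying the previous identity twice gains a factor \<open>\<alpha>\<^sup>2\<close>.
\<close>

lemma laplace_orbit_resolvent:
  assumes R: "is_resolvent (generator_dom T) (generator T) l R" and l: "Re l = 0" and \<alpha>: "\<alpha> > 0"
    and \<xi>: "contractive_functional \<xi>" and x: "norm x \<le> 1"
  shows "cmod (laplace (orbit_fun \<xi> x) (l + of_real \<alpha>) - \<xi> (R x)) \<le> \<alpha> * ((1 + K) * (norm R)\<^sup>2)"
proof -
  let ?z = "l + of_real \<alpha>" and ?L = "\<lambda>w. laplace (orbit_fun \<xi> w) (l + of_real \<alpha>)"
  have nR: "norm (R (R x)) \<le> (norm R)\<^sup>2"
  proof -
    have "norm (R (R x)) \<le> norm R * (norm R * norm x)"
      by (intro order_trans[OF norm_blinfun] mult_left_mono norm_blinfun) auto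
    also have "\<dots> \<le> norm R * (norm R * 1)" by (intro mult_left_mono x) auto
    finally show ?thesis by (simp add: power2_eq_square)
  qed
  have "cmod (?L (R (R x))) \<le> K * norm (R (R x)) / Re ?z"
    by (rule laplace_integrable(2)[OF orbit_fun_measurable[OF \<xi>] orbit_fun_bound[OF \<xi>]]) (use l \<alpha> in \<open>simp_all add: orbit_fun_def\<close>)
  also have "\<dots> = K * norm (R (R x)) / \<alpha>" using l by simp
  also have "\<dots> \<le> K * (norm R)\<^sup>2 / \<alpha>"
    using \<alpha> nR K_nonneg by (intro divide_right_mono mult_left_mono) auto
  finally have "\<alpha> * cmod (?L (R (R x))) \<le> K * (norm R)\<^sup>2"
    using \<alpha> by (simp add: field_simps)
  moreover have "cmod (?L (R x)) \<le> cmod (\<xi> (R (R x))) + \<alpha> * cmod (?L (R (R x)))"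
    using laplace_orbit_step[OF R l \<alpha> \<xi>, of "R x"] norm_triangle_ineq4[of "\<xi> (R (R x))" "of_real \<alpha> * ?L (R (R x))"] \<alpha>
    by (simp add: norm_mult)
  moreover have "cmod (\<xi> (R (R x))) \<le> (norm R)\<^sup>2"
    using contractive_functionalD(3)[OF \<xi>] nR by (rule order_trans)
  ultimately have "cmod (?L (R x)) \<le> (1 + K) * (norm R)\<^sup>2" by (simp add: algebra_simps)
  moreover have "cmod (?L x - \<xi> (R x)) = \<alpha> * cmod (?L (R x))"
    using laplace_orbit_step[OF R l \<alpha> \<xi>, of x] \<alpha> by (simp add: norm_mult)
  ultimately show ?thesis using \<alpha> by (simp add: mult_left_mono)
qed

end

section \<open>A Phragmen--Lindelof estimate in a wedge\<close>

definition wedge :: "real \<Rightarrow> complex set" where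
  "wedge a = {z. 0 < Re z \<and> \<bar>Im z\<bar> < a * Re z}"

lemma open_wedge: "open (wedge a)"
  unfolding wedge_def by (intro open_Collect_conj open_Collect_less continuous_intros)

text \<open>
  A Phragmen--Lindelof principle. Multiplication by \<open>exp (i N w)\<close> compensates the growth of \<open>f\<close> on the slanted
  side without affecting the modulus on the real axis, and \<open>exp (-\<delta> w\<^sup>2)\<close> kills everything far away. The
  maximum principle applies on a triangle, and then \<open>\<delta>\<close> tends to \<open>0\<close>. Shifting the vertex to \<open>1\<close> keeps the
  triangle away from the origin, where \<open>f\<close> need not be continuous.
\<close>

lemma wedge_upper_bound:
  assumes hol: "f holomorphic_on wedge a" and a: "0 < a" "a \<le> 1" and \<omega>: "\<omega> \<ge> 0"
    and C: "\<And>z. z \<in> wedge a \<Longrightarrow> cmod (f z) \<le> C * exp (\<omega> * cmod z)"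
    and B: "\<And>t. t > 0 \<Longrightarrow> cmod (f (of_real t)) \<le> B"
    and w: "0 \<le> Im w" "Im w \<le> a / 2 * Re w"
  shows "cmod (f (1 + w)) \<le> max B (C * exp \<omega>) * exp (4 * \<omega> / a * Im w)"
proof -
  \<comment> \<open>On the side \<open>Im w = a/2 * Re w\<close> this makes \<open>N * Im w\<close> equal to \<open>2 * \<omega> * Re w\<close>.\<close>
  define N where "N = 4 * \<omega> / a"
  define M where "M = max B (C * exp \<omega>)"
  have N: "N \<ge> 0" using a \<omega> by (simp add: N_def)
  have w0: "Re w \<ge> 0"
  proof (rule ccontr)
    assume "\<not> Re w \<ge> 0"
    then have "a / 2 * Re w < 0" using a by (intro mult_pos_neg) auto
    then show False using w by linarith
  qed
  have C0: "C \<ge> 0"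
  proof -
    have "(1::complex) \<in> wedge a" using a by (simp add: wedge_def)
    then have "0 \<le> C * exp (\<omega> * cmod 1)" by (rule order_trans[OF norm_ge_zero C])
    then show ?thesis by (simp add: zero_le_mult_iff)
  qed
  have M: "M \<ge> 0" "B \<le> M" "C * exp \<omega> \<le> M" using C0 by (simp_all add: M_def le_max_iff_disj)
  have key: "cmod (f (1 + w)) * exp (- N * Im w) * exp (- \<delta> * ((Re w)\<^sup>2 - (Im w)\<^sup>2)) \<le> M" if \<delta>: "\<delta> > 0" for \<delta>
  proof -
    \<comment> \<open>Beyond \<open>4 * \<omega> / \<delta>\<close> the Gaussian factor beats the growth of \<open>f\<close>.\<close>
    define X where "X = Re w + 1 + 4 * \<omega> / \<delta>"
    define D where "D = {z. 0 \<le> Im z \<and> Im z \<le> a / 2 * Re z \<and> Re z \<le> X}"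
    define g where "g z = f (1 + z) * exp (\<i> * of_real N * z) * exp (- of_real \<delta> * z\<^sup>2)" for z
    have ng: "cmod (g z) = cmod (f (1 + z)) * exp (- N * Im z) * exp (- \<delta> * ((Re z)\<^sup>2 - (Im z)\<^sup>2))" for z
      by (simp add: g_def norm_mult norm_exp_eq_Re power2_eq_square)
    have D1: "0 \<le> Re z" "Im z \<le> Re z / 2" "0 \<le> Im z" "1 + z \<in> wedge a" if "z \<in> D" for z
    proof -
      have z: "0 \<le> Im z" "Im z \<le> a / 2 * Re z" using that by (auto simp: D_def)
      then have "0 \<le> a / 2 * Re z" by linarith
      then show r: "0 \<le> Re z" using a by (simp add: zero_le_mult_iff)
      have "a * Re z \<le> 1 * Re z" using a r by (intro mult_right_mono) auto
      then show "Im z \<le> Re z / 2" using z by simp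
      have "0 \<le> a * Re z" using a r by simp
      moreover have "a / 2 * Re z = a * Re z / 2" "a * (1 + Re z) = a + a * Re z" by (simp_all add: algebra_simps)
      ultimately have "a / 2 * Re z < a * (1 + Re z)" using a by linarith
      then show "1 + z \<in> wedge a" using z r by (simp add: wedge_def)
    qed (use that in \<open>simp add: D_def\<close>)
    have fg: "cmod (f (1 + z)) \<le> C * exp \<omega> * exp (2 * \<omega> * Re z)" if "z \<in> D" for z
    proof -
      have "cmod (1 + z) \<le> 1 + cmod z" using norm_triangle_ineq[of 1 z] by simp
      also have "cmod z \<le> \<bar>Re z\<bar> + \<bar>Im z\<bar>" by (rule cmod_le)
      finally have "cmod (1 + z) \<le> 1 + 2 * Re z" using D1[OF that] by linarith
      then have "\<omega> * cmod (1 + z) \<le> \<omega> * (1 + 2 * Re z)" using \<omega> by (rule mult_left_mono)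
      then have "C * exp (\<omega> * cmod (1 + z)) \<le> C * exp (\<omega> * (1 + 2 * Re z))"
        using C0 by (intro mult_left_mono) auto
      with C[OF D1(4)[OF that]] show ?thesis by (simp add: exp_add algebra_simps)
    qed
    have gh: "g holomorphic_on D"
    proof -
      have "(\<lambda>z. f (1 + z)) holomorphic_on D"
      proof -
        have "(\<lambda>z. 1 + z) holomorphic_on D" by (intro holomorphic_intros)
        then have "f \<circ> (\<lambda>z. 1 + z) holomorphic_on D"
          by (rule holomorphic_on_compose_gen[OF _ hol]) (use D1(4) in auto)
        then show ?thesis by (simp add: o_def)
      qed
      then show ?thesis unfolding g_def by (intro holomorphic_intros)
    qed
    have Dc: "closed D"
      unfolding D_def by (intro closed_Collect_conj closed_Collect_le continuous_intros)
    have "cmod (g w) \<le> M"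
    proof (rule maximum_modulus_frontier[of g D])
      show "g holomorphic_on interior D" using gh interior_subset by (rule holomorphic_on_subset)
      show "continuous_on (closure D) g" using gh Dc by (simp add: holomorphic_on_imp_continuous_on)
      show "bounded D"
      proof (rule boundedI)
        fix z assume z: "z \<in> D"
        show "norm z \<le> 2 * X" using cmod_le[of z] D1[OF z] z by (auto simp: D_def)
      qed
      show "w \<in> D" using w \<delta> \<omega> by (simp add: D_def X_def)
      fix z assume z: "z \<in> frontier D"
      then have zD: "z \<in> D" using Dc by (simp add: frontier_def)
      have "open {z. 0 < Im z \<and> Im z < a / 2 * Re z \<and> Re z < X}"
        by (intro open_Collect_conj open_Collect_less continuous_intros)
      then have "{z. 0 < Im z \<and> Im z < a / 2 * Re z \<and> Re z < X} \<subseteq> interior D"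
        by (rule interior_maximal[rotated]) (auto simp: D_def)
      moreover have "z \<notin> interior D" using z by (simp add: frontier_def)
      ultimately have "\<not> (0 < Im z \<and> Im z < a / 2 * Re z \<and> Re z < X)" by blast
      then have cases: "Im z = 0 \<or> Im z = a / 2 * Re z \<or> Re z = X"
        using zD unfolding D_def mem_Collect_eq by linarith
      note Dz = D1[OF zD]
      have sq: "3 / 4 * (Re z)\<^sup>2 \<le> (Re z)\<^sup>2 - (Im z)\<^sup>2"
        using power_mono[OF Dz(2,3), of 2] by (simp add: power_divide)
      have e1: "exp (- \<delta> * ((Re z)\<^sup>2 - (Im z)\<^sup>2)) \<le> 1"
      proof -
        have "0 \<le> (Re z)\<^sup>2 - (Im z)\<^sup>2" using sq zero_le_power2[of "Re z"] by linarith
        then have "0 \<le> \<delta> * ((Re z)\<^sup>2 - (Im z)\<^sup>2)" using \<delta> by (intro mult_nonneg_nonneg) auto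
        then show ?thesis by simp
      qed
      have e2: "exp (- N * Im z) \<le> 1" using N Dz by simp
      show "cmod (g z) \<le> M"
        using cases
      proof (elim disjE)
        assume i: "Im z = 0"
        then have "1 + z = of_real (1 + Re z)" by (simp add: complex_eq_iff)
        then have "cmod (f (1 + z)) \<le> B" using B[of "1 + Re z"] Dz by simp
        then have "cmod (f (1 + z)) * exp (- N * Im z) * exp (- \<delta> * ((Re z)\<^sup>2 - (Im z)\<^sup>2)) \<le> M * 1 * 1"
          using M e1 e2 by (intro mult_mono) auto
        then show ?thesis unfolding ng by simp
      next
        assume i: "Im z = a / 2 * Re z"
        then have "N * Im z = 2 * \<omega> * Re z" using a unfolding N_def i by simp
        then have "cmod (f (1 + z)) * exp (- N * Im z) \<le> C * exp \<omega> * exp (2 * \<omega> * Re z) * exp (- (2 * \<omega> * Re z))"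
          using fg[OF zD] by (simp add: mult_right_mono)
        also have "\<dots> = C * exp \<omega>" by (simp add: exp_minus)
        finally have "cmod (f (1 + z)) * exp (- N * Im z) \<le> M" using M by linarith
        then have "cmod (f (1 + z)) * exp (- N * Im z) * exp (- \<delta> * ((Re z)\<^sup>2 - (Im z)\<^sup>2)) \<le> M * 1"
          using M e1 by (intro mult_mono) auto
        then show ?thesis unfolding ng by simp
      next
        assume i: "Re z = X"
        have X: "X \<ge> 4 * \<omega> / \<delta>" "X \<ge> 0" using Dz(1) i w0 by (simp_all add: X_def)
        have "2 * \<omega> \<le> \<delta> * (3 / 4 * X)"
          using X(1) \<delta> \<omega> by (simp add: field_simps)
        then have "2 * \<omega> * X \<le> \<delta> * (3 / 4 * X) * X" using X(2) by (rule mult_right_mono)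
        also have "\<dots> = \<delta> * (3 / 4 * (Re z)\<^sup>2)" by (simp add: i power2_eq_square)
        also have "\<dots> \<le> \<delta> * ((Re z)\<^sup>2 - (Im z)\<^sup>2)" using sq \<delta> by (intro mult_left_mono) auto
        finally have "exp (- \<delta> * ((Re z)\<^sup>2 - (Im z)\<^sup>2)) \<le> exp (- (2 * \<omega> * X))" by simp
        then have "cmod (f (1 + z)) * exp (- N * Im z) * exp (- \<delta> * ((Re z)\<^sup>2 - (Im z)\<^sup>2))
           \<le> (C * exp \<omega> * exp (2 * \<omega> * X)) * 1 * exp (- (2 * \<omega> * X))"
          using fg[OF zD] e2 C0 i by (intro mult_mono) auto
        also have "\<dots> = C * exp \<omega>" by (simp add: exp_minus)
        finally show ?thesis unfolding ng using M by linarith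
      qed
    qed
    then show ?thesis by (simp only: ng)
  qed
  have "((\<lambda>\<delta>. cmod (f (1 + w)) * exp (- N * Im w) * exp (- \<delta> * ((Re w)\<^sup>2 - (Im w)\<^sup>2))) \<longlongrightarrow>
      cmod (f (1 + w)) * exp (- N * Im w) * exp (- 0 * ((Re w)\<^sup>2 - (Im w)\<^sup>2))) (at_right 0)"
    by (intro tendsto_intros)
  then have "cmod (f (1 + w)) * exp (- N * Im w) * exp (- 0 * ((Re w)\<^sup>2 - (Im w)\<^sup>2)) \<le> M"
    by (rule tendsto_upperbound) (use key in \<open>auto simp: eventually_at_filter intro!: always_eventually\<close>)
  then have "cmod (f (1 + w)) * exp (- (N * Im w)) \<le> M" by simp
  then have "cmod (f (1 + w)) * exp (- (N * Im w)) * exp (N * Im w) \<le> M * exp (N * Im w)"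
    by (rule mult_right_mono) simp
  moreover have "exp (- (N * Im w)) * exp (N * Im w) = 1" by (simp add: exp_minus)
  ultimately show ?thesis by (simp add: mult.assoc flip: M_def N_def)
qed

text \<open>
  Far to the right, the wedge contains the unit disc around each real point, and \<open>f\<close> is bounded on these
  discs; Cauchy's inequality bounds the derivative. The lower half of the disc is treated by reflection.
\<close>

lemma wedge_Lipschitz:
  assumes hol: "f holomorphic_on wedge a" and a: "0 < a" "a \<le> 1" and \<omega>: "\<omega> \<ge> 0"
    and C: "\<And>z. z \<in> wedge a \<Longrightarrow> cmod (f z) \<le> C * exp (\<omega> * cmod z)"
    and B: "\<And>t. t > 0 \<Longrightarrow> cmod (f (of_real t)) \<le> B"
    and st: "s \<ge> 2 + 2 / a" "t \<ge> 2 + 2 / a"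
  shows "cmod (f (of_real t) - f (of_real s)) \<le> max B (C * exp \<omega>) * exp (4 * \<omega> / a) * \<bar>t - s\<bar>"
proof -
  define L where "L = max B (C * exp \<omega>) * exp (4 * \<omega> / a)"
  have strip: "cmod (f (1 + w)) \<le> L" if w: "\<bar>Im w\<bar> \<le> 1" "2 / a \<le> Re w" for w
  proof -
    have M0: "max B (C * exp \<omega>) \<ge> 0" using order_trans[OF norm_ge_zero B[of 1]] by (simp add: le_max_iff_disj)
    have w2: "\<bar>Im w\<bar> \<le> a / 2 * Re w" using w a by (simp add: field_simps)
    have "cmod (f (1 + w)) \<le> max B (C * exp \<omega>) * exp (4 * \<omega> / a * \<bar>Im w\<bar>)"
    proof (cases "Im w \<ge> 0")
      case True
      then show ?thesis using wedge_upper_bound[OF hol a \<omega> C B, of w] w2 by simp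
    next
      case False
      define h where "h = cnj \<circ> f \<circ> cnj"
      have im: "cnj ` wedge a = wedge a"
        by (auto simp: wedge_def image_iff intro!: exI[of _ "cnj _"])
      have "h holomorphic_on wedge a"
        unfolding h_def by (rule holomorphic_on_compose_cnj_cnj) (simp_all add: im hol open_wedge)
      moreover have "cmod (h z) \<le> C * exp (\<omega> * cmod z)" if "z \<in> wedge a" for z
        using C[of "cnj z"] that by (simp add: h_def wedge_def)
      moreover have "cmod (h (of_real t)) \<le> B" if "t > 0" for t
        using B[OF that] by (simp add: h_def)
      ultimately have "cmod (h (1 + cnj w)) \<le> max B (C * exp \<omega>) * exp (4 * \<omega> / a * Im (cnj w))"
        by (rule wedge_upper_bound[OF _ a \<omega>]) (use False w2 in auto)
      then show ?thesis using False by (simp add: h_def)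
    qed
    also have "\<dots> \<le> max B (C * exp \<omega>) * exp (4 * \<omega> / a * 1)"
      using M0 \<omega> a w(1) by (intro mult_left_mono) (auto intro!: divide_right_mono mult_left_le)
    finally show ?thesis by (simp add: L_def)
  qed
  have sub: "cball (of_real r) 1 \<subseteq> wedge a" if "r \<ge> 2 + 2 / a" for r
  proof
    fix z :: complex assume z: "z \<in> cball (of_real r) 1"
    then have "\<bar>Im z\<bar> \<le> 1" "\<bar>Re z - r\<bar> \<le> 1"
      using abs_Im_le_cmod[of "z - of_real r"] abs_Re_le_cmod[of "z - of_real r"] by (auto simp: dist_norm norm_minus_commute)
    moreover from this have "1 + 2 / a \<le> Re z" using that by linarith
    moreover from this have "a * (1 + 2 / a) \<le> a * Re z" using a by (intro mult_left_mono) auto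
    moreover have "a * (1 + 2 / a) = a + 2" using a by (simp add: field_simps)
    moreover have "0 < Re z"
      using \<open>1 + 2 / a \<le> Re z\<close> divide_pos_pos[of 2 a] a by linarith
    ultimately have "0 < Re z" "\<bar>Im z\<bar> < a * Re z" using a by linarith+
    then show "z \<in> wedge a" by (simp add: wedge_def)
  qed
  have d: "cmod (deriv f (of_real r)) \<le> L" if r: "r \<ge> 2 + 2 / a" for r
  proof -
    have "cmod ((deriv ^^ 1) f (of_real r)) \<le> fact 1 * L / 1 ^ 1"
    proof (rule Cauchy_inequality)
      have "f holomorphic_on cball (of_real r) 1" using hol sub[OF r] by (rule holomorphic_on_subset)
      then show "f holomorphic_on ball (of_real r) 1" "continuous_on (cball (of_real r) 1) f"
        by (auto intro: holomorphic_on_imp_continuous_on holomorphic_on_subset[OF _ ball_subset_cball])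
      fix z :: complex assume "cmod (of_real r - z) = 1"
      then have "\<bar>Im z\<bar> \<le> 1" "\<bar>Re z - r\<bar> \<le> 1"
        using abs_Im_le_cmod[of "z - of_real r"] abs_Re_le_cmod[of "z - of_real r"] by (auto simp: norm_minus_commute)
      then show "cmod (f z) \<le> L" using strip[of "z - 1"] r by simp
    qed simp
    then show ?thesis by simp
  qed
  have "cmod (f (of_real t) - f (of_real s)) \<le> L * cmod (of_real t - of_real s)"
  proof (rule field_differentiable_bound[where S="of_real ` {2 + 2 / a..}" and f'="deriv f"])
    show "convex (of_real ` {2 + 2 / a..} :: complex set)"
      by (intro convex_linear_image) (auto simp: linear_of_real)
    fix z :: complex assume "z \<in> of_real ` {2 + 2 / a..}"
    then obtain r where r: "r \<ge> 2 + 2 / a" "z = of_real r" by auto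
    have "z \<in> wedge a" using sub[OF r(1)] r(2) by auto
    then show "(f has_field_derivative deriv f z) (at z within of_real ` {2 + 2 / a..})"
      by (rule has_field_derivative_at_within[OF holomorphic_derivI[OF hol open_wedge]])
    show "cmod (deriv f z) \<le> L" using d r by simp
  qed (use st in auto)
  then show ?thesis by (simp add: L_def flip: of_real_diff)
qed

section \<open>Asymptotic equicontinuity of orbits\<close>

lemma wedge_subset_sector:
  assumes "\<theta> > 0"
  obtains a where "0 < a" "a \<le> 1" "wedge a \<subseteq> sector \<theta>"
proof
  define \<theta>' where "\<theta>' = min \<theta> 1"
  have t: "0 < \<theta>'" "\<theta>' \<le> \<theta>" "\<theta>' < pi / 2" using assms pi_gt3 by (auto simp: \<theta>'_def)
  \<comment> \<open>For positive real part, \<open>Arg z\<close> is the arctangent of \<open>Im z / Re z\<close>.\<close>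
  define a where "a = min 1 (tan \<theta>')"
  show "0 < a" using tan_gt_zero[of \<theta>'] t by (simp add: a_def)
  show "a \<le> 1" by (simp add: a_def)
  show "wedge a \<subseteq> sector \<theta>"
  proof
    fix z assume "z \<in> wedge a"
    then have z: "Re z > 0" "\<bar>Im z\<bar> < a * Re z" by (auto simp: wedge_def)
    have "\<bar>Im z / Re z\<bar> < a" using z by (simp add: abs_divide pos_divide_less_eq)
    then have "Im z / Re z < tan \<theta>'" "- tan \<theta>' < Im z / Re z"
      unfolding a_def by linarith+
    then have "arctan (Im z / Re z) < arctan (tan \<theta>')" "arctan (- tan \<theta>') < arctan (Im z / Re z)"
      by (simp_all only: arctan_less_iff)
    moreover have "arctan (tan \<theta>') = \<theta>'" using t by (intro arctan_tan) auto
    ultimately have "\<bar>Arg z\<bar> < \<theta>" using t z by (simp add: arg_conv_arctan arctan_minus)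
    moreover have "z \<noteq> 0" using z by auto
    ultimately show "z \<in> sector \<theta>" by (simp add: sector_def)
  qed
qed

lemma asymptotically_analyticE:
  assumes "asymptotically_analytic T"
  obtains S \<theta> M \<epsilon> where "\<theta> > 0" "S \<in> H_space (sector \<theta>)" "\<epsilon> > 0"
    "\<And>t. t > 0 \<Longrightarrow> norm (T t - S (of_real t)) \<le> M * exp (- \<epsilon> * t)"
proof -
  obtain S \<theta> where S: "\<theta> > 0" "S \<in> H_space (sector \<theta>)" "growth_bound (\<lambda>t. T t - S (complex_of_real t)) < 0"
    using assms unfolding asymptotically_analytic_def nonanalytic_growth_bound_def Inf_less_iff by auto
  then obtain \<omega> M where \<omega>: "ereal \<omega> < 0" "\<forall>t>0. norm (T t - S (complex_of_real t)) \<le> M * exp (\<omega> * t)"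
    unfolding growth_bound_def Inf_less_iff by auto
  show ?thesis
    by (rule that[of \<theta> S "- \<omega>" M]) (use S \<omega> in auto)
qed

lemma scalar_holomorphic:
  fixes S :: "complex \<Rightarrow> 'a::complex_normed_vector \<Rightarrow>\<^sub>L 'a"
  assumes S: "vector_holomorphic_on \<Omega> S" and U: "open U" "U \<subseteq> \<Omega>" and \<xi>: "contractive_functional \<xi>"
  shows "(\<lambda>z. \<xi> (S z x)) holomorphic_on U"
  unfolding holomorphic_on_open[OF U(1)]
proof
  note \<xi>D = contractive_functionalD[OF \<xi>]
  fix z assume z: "z \<in> U"
  then obtain D where "((\<lambda>w. inverse (w - z) *\<^sub>C (S w - S z)) \<longlongrightarrow> D) (at z within \<Omega>)"
    using S U(2) unfolding vector_holomorphic_on_def by blast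
  then have "((\<lambda>w. inverse (w - z) *\<^sub>C (S w - S z)) \<longlongrightarrow> D) (at z within U)"
    using U(2) by (rule tendsto_within_subset)
  then have lim: "((\<lambda>w. inverse (w - z) *\<^sub>C (S w - S z)) \<longlongrightarrow> D) (at z)"
    using at_within_open[OF z U(1)] by simp
  have bl: "bounded_linear (\<lambda>B :: 'a \<Rightarrow>\<^sub>L 'a. \<xi> (B x))"
    by (intro bounded_linear_compose[OF \<xi>D(4)] bounded_linear_intros)
  have "((\<lambda>w. \<xi> (blinfun_apply (inverse (w - z) *\<^sub>C (S w - S z)) x)) \<longlongrightarrow> \<xi> (D x)) (at z)"
    by (rule bounded_linear.tendsto[OF bl lim])
  moreover have "\<xi> (blinfun_apply (inverse (w - z) *\<^sub>C (S w - S z)) x) = (\<xi> (S w x) - \<xi> (S z x)) / (w - z)" for w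
    by (simp add: scaleC_blinfun.rep_eq \<xi>D(2,5) blinfun.diff_left field_simps)
  ultimately show "\<exists>D. ((\<lambda>z. \<xi> (S z x)) has_field_derivative D) (at z)"
    unfolding has_field_derivative_iff by auto
qed

context bounded_C0_semigroup
begin

text \<open>
  The scalar orbits differ from holomorphic functions with uniform bounds by an exponentially small error,
  and those functions are uniformly Lipschitz far to the right.
\<close>

lemma asymptotic_equicontinuity:
  assumes "asymptotically_analytic T" and e: "e > 0"
  obtains \<eta> r0 where "\<eta> > 0" "r0 \<ge> 0"
    "\<And>\<xi> x r v. contractive_functional \<xi> \<Longrightarrow> norm x \<le> 1 \<Longrightarrow> r \<ge> r0 \<Longrightarrow> \<bar>v\<bar> \<le> \<eta> \<Longrightarrow>
       cmod (orbit_fun \<xi> x (r + v) - orbit_fun \<xi> x r) \<le> e"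
proof -
  obtain S \<theta> M \<epsilon> where \<theta>: "\<theta> > 0" and S: "S \<in> H_space (sector \<theta>)" and \<epsilon>: "\<epsilon> > 0"
    and TS: "\<And>t. t > 0 \<Longrightarrow> norm (T t - S (of_real t)) \<le> M * exp (- \<epsilon> * t)"
    using asymptotically_analyticE[OF assms(1)] by metis
  have M: "M \<ge> 0" using order_trans[OF norm_ge_zero TS[of 1]] by (simp add: zero_le_mult_iff)
  obtain a where a: "0 < a" "a \<le> 1" "wedge a \<subseteq> sector \<theta>" by (rule wedge_subset_sector[OF \<theta>])
  obtain C \<omega>' where C: "C \<ge> 0" "\<And>z. z \<in> sector \<theta> \<Longrightarrow> norm (S z) \<le> C * exp (\<omega>' * cmod z)"
    using S unfolding H_space_def exponentially_bounded_on_def by auto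
  define \<omega> where "\<omega> = max \<omega>' 0"
  have \<omega>: "\<omega> \<ge> 0" by (simp add: \<omega>_def)
  have CS: "norm (S z) \<le> C * exp (\<omega> * cmod z)" if "z \<in> wedge a" for z
  proof -
    have "C * exp (\<omega>' * cmod z) \<le> C * exp (\<omega> * cmod z)"
      using C(1) by (intro mult_left_mono) (auto simp: \<omega>_def intro!: mult_right_mono)
    then show ?thesis using C(2)[of z] that a(3) by (meson order_trans subsetD)
  qed
  define L where "L = max (K + M) (C * exp \<omega>) * exp (4 * \<omega> / a)"
  have L: "L \<ge> 0" using K_nonneg M by (simp add: L_def le_max_iff_disj)
  have apply_le: "cmod (\<xi> (blinfun_apply B x)) \<le> norm B" if "contractive_functional \<xi>" "norm x \<le> 1" for \<xi> x and B :: "'a \<Rightarrow>\<^sub>L 'a"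
  proof -
    have "cmod (\<xi> (B x)) \<le> norm B * norm x"
      by (rule order_trans[OF contractive_functionalD(3)[OF that(1)] norm_blinfun])
    also have "\<dots> \<le> norm B * 1" using that(2) by (intro mult_left_mono) auto
    finally show ?thesis by simp
  qed
  have est: "cmod (\<xi> (T t x) - \<xi> (T s x)) \<le> L * \<bar>t - s\<bar> + 2 * M * exp (- \<epsilon> * r)"
    if \<xi>: "contractive_functional \<xi>" and x: "norm x \<le> 1"
      and st: "s \<ge> 2 + 2 / a" "t \<ge> 2 + 2 / a" and r: "s \<ge> r" "t \<ge> r" for \<xi> x s t r
  proof -
    note \<xi>D = contractive_functionalD[OF \<xi>]
    let ?f = "\<lambda>z. \<xi> (S z x)"
    have diff: "cmod (\<xi> (T u x) - ?f (of_real u)) \<le> M * exp (- \<epsilon> * u)" if "u > 0" for u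
      using order_trans[OF apply_le[OF \<xi> x, of "T u - S (of_real u)"] TS[OF that]]
      by (simp add: blinfun.diff_left \<xi>D(5))
    have hol: "?f holomorphic_on wedge a"
      using S unfolding H_space_def by (intro scalar_holomorphic[OF _ open_wedge a(3) \<xi>]) simp
    have "cmod (?f (of_real t) - ?f (of_real s)) \<le> L * \<bar>t - s\<bar>"
      unfolding L_def
    proof (rule wedge_Lipschitz[OF hol a(1,2) \<omega> _ _ st])
      show "cmod (?f z) \<le> C * exp (\<omega> * cmod z)" if "z \<in> wedge a" for z
        using apply_le[OF \<xi> x] CS[OF that] by (rule order_trans)
      show "cmod (?f (of_real u)) \<le> K + M" if "u > 0" for u
      proof -
        have "M * exp (- \<epsilon> * u) \<le> M * 1" using M \<epsilon> that by (intro mult_left_mono) auto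
        moreover have "cmod (\<xi> (T u x)) \<le> K" using order_trans[OF apply_le[OF \<xi> x] bound[of u]] that by simp
        moreover have "cmod (?f (of_real u)) \<le> cmod (\<xi> (T u x)) + cmod (\<xi> (T u x) - ?f (of_real u))"
          by (metis norm_minus_commute norm_triangle_sub)
        ultimately show ?thesis using diff[OF that] by linarith
      qed
    qed
    moreover have dr: "cmod (\<xi> (T u x) - ?f (of_real u)) \<le> M * exp (- \<epsilon> * r)" if "u \<ge> r" "u \<ge> 2 + 2 / a" for u
    proof -
      have "M * exp (- \<epsilon> * u) \<le> M * exp (- \<epsilon> * r)"
        using M \<epsilon> that by (intro mult_left_mono) auto
      moreover have "u > 0" using that(2) divide_pos_pos[of 2 a] a by linarith
      ultimately show ?thesis using diff[of u] by simp
    qed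
    moreover have "cmod (\<xi> (T t x) - \<xi> (T s x)) \<le> cmod (\<xi> (T t x) - ?f (of_real t))
        + cmod (?f (of_real t) - ?f (of_real s)) + cmod (\<xi> (T s x) - ?f (of_real s))"
      using norm_triangle_ineq4[of "\<xi> (T t x) - ?f (of_real t)" "\<xi> (T s x) - ?f (of_real s)"]
        norm_triangle_ineq[of "?f (of_real t) - ?f (of_real s)" "(\<xi> (T t x) - ?f (of_real t)) - (\<xi> (T s x) - ?f (of_real s))"]
      by (simp add: algebra_simps)
    ultimately show ?thesis
      using dr[OF r(1) st(1)] dr[OF r(2) st(2)] by linarith
  qed
  define \<eta> where "\<eta> = min 1 (e / 2 / (L + 1))"
  have \<eta>: "\<eta> > 0" "\<eta> \<le> 1" using e L by (auto simp: \<eta>_def)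
  have L\<eta>: "L * \<eta> \<le> e / 2"
  proof -
    have "L * \<eta> \<le> (L + 1) * (e / 2 / (L + 1))" using L e by (intro mult_mono) (auto simp: \<eta>_def)
    also have "(L + 1) * (e / 2 / (L + 1)) = e / 2" using L by (simp add: field_simps)
    finally show ?thesis .
  qed
  have "((\<lambda>r. 2 * M * exp (- \<epsilon> * r)) \<longlongrightarrow> 2 * M * 0) at_top"
    using \<epsilon> by (intro tendsto_intros filterlim_compose[OF exp_at_bot] filterlim_tendsto_neg_mult_at_bot[OF tendsto_const _ filterlim_ident]) auto
  then have "\<forall>\<^sub>F r in at_top. 2 * M * exp (- \<epsilon> * r) < e / 2"
    by (rule order_tendstoD(2)) (use e in simp)
  then obtain r1 where r1: "\<And>r. r \<ge> r1 \<Longrightarrow> 2 * M * exp (- \<epsilon> * r) < e / 2"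
    by (auto simp: eventually_at_top_linorder)
  show ?thesis
  proof (rule that[of \<eta> "max r1 (2 + 2 / a) + 1"])
    show "max r1 (2 + 2 / a) + 1 \<ge> 0" using a by (simp add: add_nonneg_nonneg le_max_iff_disj)
    fix \<xi> :: "'a \<Rightarrow> complex" and x :: 'a and r v :: real
    assume \<xi>: "contractive_functional \<xi>" and x: "norm x \<le> 1" and r: "r \<ge> max r1 (2 + 2 / a) + 1" and v: "\<bar>v\<bar> \<le> \<eta>"
    have p: "0 < 2 / a" using a by simp
    have rr: "r + v \<ge> max r1 (2 + 2 / a)" "r \<ge> max r1 (2 + 2 / a)" using r v \<eta> by linarith+
    have nn: "0 \<le> r" "0 \<le> r + v" using rr p by linarith+
    have "cmod (\<xi> (T (r + v) x) - \<xi> (T r x)) \<le> L * \<bar>r + v - r\<bar> + 2 * M * exp (- \<epsilon> * max r1 (2 + 2 / a))"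
      by (rule est[OF \<xi> x]) (use rr in auto)
    also have "\<dots> \<le> L * \<eta> + e / 2"
      using r1[of "max r1 (2 + 2 / a)"] v L by (intro add_mono mult_left_mono) auto
    also have "\<dots> \<le> e" using L\<eta> by simp
    finally show "cmod (orbit_fun \<xi> x (r + v) - orbit_fun \<xi> x r) \<le> e"
      using nn by (simp add: orbit_fun_def)
  qed (rule \<eta>)
qed

end

section \<open>A band-limited approximate identity\<close>

abbreviation character :: "real \<Rightarrow> complex" where
  "character r \<equiv> exp (\<i> * complex_of_real r)"

abbreviation cnj_character :: "real \<Rightarrow> complex" where
  "cnj_character r \<equiv> exp (- \<i> * complex_of_real r)"

abbreviation band_limited :: "(real \<Rightarrow> complex) \<Rightarrow> (real \<Rightarrow> complex) \<Rightarrow> real \<Rightarrow> bool" where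
  "band_limited \<psi> m N \<equiv> continuous_on UNIV m \<and> (\<forall>s. N < \<bar>s\<bar> \<longrightarrow> m s = 0)
      \<and> (\<forall>u. \<psi> u = (LINT s|lborel. character (s * u) * m s))"

lemma integrable_inverse_1_plus_square: "integrable lborel (\<lambda>x::real. inverse (1 + x\<^sup>2))"
proof -
  have "integral\<^sup>N lborel (\<lambda>x. ennreal (inverse (1 + x\<^sup>2)) * indicator {0..} x) = ennreal (pi / 2 - arctan 0)"
    by (rule nn_integral_FTC_atLeast) (auto intro: DERIV_arctan tendsto_arctan_at_top)
  then have "integral\<^sup>N lborel (\<lambda>x. ennreal (indicator {0..} x * inverse (1 + x\<^sup>2))) = ennreal (pi / 2)"
    by (simp add: ennreal_mult' mult.commute ennreal_indicator)
  then have i: "integrable lborel (\<lambda>x::real. indicator {0..} x * inverse (1 + x\<^sup>2))"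
    by (intro integrableI_nn_integral_finite[where x="pi/2"]) auto
  then have "integrable lborel (\<lambda>x::real. indicator {0..} (0 + (-1) * x) * inverse (1 + (0 + (-1) * x)\<^sup>2))"
    by (rule lborel_integrable_real_affine) simp
  from Bochner_Integration.integrable_add[OF i this] show ?thesis
    by (rule Bochner_Integration.integrable_bound) (auto simp: indicator_def)
qed

text \<open>
  The Fourier multiplier of the Fejer kernel.
\<close>

definition tent :: "real \<Rightarrow> complex" where
  "tent s = of_real (max 0 (1 - \<bar>s\<bar>))"

definition fejer :: "real \<Rightarrow> complex" where
  "fejer u = (LINT s|lborel. exp (\<i> * of_real (s * u)) * tent s)"

lemma continuous_compact_support_integrable:
  fixes g :: "real \<Rightarrow> complex"
  assumes "continuous_on UNIV g" "\<And>s. N < \<bar>s\<bar> \<Longrightarrow> g s = 0"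
  shows "integrable lborel g"
proof -
  have "integrable lborel (\<lambda>s. indicator {-N..N} s *\<^sub>R g s)"
    by (rule borel_integrable_compact) (auto intro: continuous_on_subset[OF assms(1)])
  moreover have "(\<lambda>s. indicator {-N..N} s *\<^sub>R g s) = g"
    using assms(2) by (auto simp: indicator_def fun_eq_iff not_le)
  ultimately show ?thesis by simp
qed

lemma continuous_tent: "continuous_on UNIV tent"
  unfolding tent_def by (intro continuous_intros)

lemma integrable_fejer_integrand: "integrable lborel (\<lambda>s. exp (\<i> * of_real (s * u)) * tent s)"
  by (rule continuous_compact_support_integrable[where N=1])
     (auto simp: tent_def intro!: continuous_intros)

lemma fejer_eq:
  assumes u: "u \<noteq> 0"
  shows "fejer u = of_real (2 * (1 - cos u) / u\<^sup>2)"
proof -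
  define w where "w = \<i> * complex_of_real u"
  have w: "w \<noteq> 0" using u by (simp add: w_def)
  have e: "((\<lambda>s. exp (w * of_real s)) has_vector_derivative exp (w * of_real s) * w) (at s within S)" for s S
    by (rule has_vector_derivative_at_within[OF has_vector_derivative_real_field])
       (auto intro!: derivative_eq_intros)
  \<comment> \<open>The primitive for the two halves of the tent, \<open>c = -1\<close> on the right and \<open>c = 1\<close> on the left.\<close>
  have d: "((\<lambda>s. (1 + c * of_real s) * exp (w * of_real s) / w - c * exp (w * of_real s) / w\<^sup>2) has_vector_derivative
      (1 + c * of_real s) * exp (w * of_real s)) (at s within S)" for c :: complex and s S
  proof -
    have "((\<lambda>z. (1 + c * z) * exp (w * z) / w - c * exp (w * z) / w\<^sup>2) has_field_derivative
      (1 + c * of_real s) * exp (w * of_real s)) (at (of_real s))"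
      using w by (auto intro!: derivative_eq_intros simp: field_simps power2_eq_square)
    then show ?thesis
      by (rule has_vector_derivative_at_within[OF has_vector_derivative_real_field])
  qed
  have I1: "(LINT s|lborel. indicator {0..1} s *\<^sub>R ((1 + (- 1) * of_real s) * exp (w * of_real s)))
      = (exp w / w\<^sup>2) - (1 / w + 1 / w\<^sup>2)"
    by (subst integral_FTC_atLeastAtMost[OF _ d]) (auto intro!: continuous_intros)
  have I2: "(LINT s|lborel. indicator {-1..0} s *\<^sub>R ((1 + 1 * of_real s) * exp (w * of_real s)))
      = (1 / w - 1 / w\<^sup>2) + exp (- w) / w\<^sup>2"
    by (subst integral_FTC_atLeastAtMost[OF _ d]) (auto intro!: continuous_intros)
  have int: "integrable lborel (\<lambda>s. indicator {0..1} s *\<^sub>R ((1 + (- 1) * of_real s) * exp (w * of_real s)))"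
     "integrable lborel (\<lambda>s. indicator {-1..0} s *\<^sub>R ((1 + 1 * of_real s) * exp (w * of_real s)))"
    by (auto intro!: borel_integrable_compact continuous_intros)
  have "fejer u = (LINT s|lborel. indicator {0..1} s *\<^sub>R ((1 + (- 1) * of_real s) * exp (w * of_real s))
      + indicator {-1..0} s *\<^sub>R ((1 + 1 * of_real s) * exp (w * of_real s)))"
    unfolding fejer_def
  proof (rule integral_cong_AE)
    have "AE s in lborel. s \<noteq> (0::real)" by (rule AE_lborel_singleton)
    then show "AE s in lborel. exp (\<i> * of_real (s * u)) * tent s = indicator {0..1} s *\<^sub>R ((1 + (- 1) * of_real s) * exp (w * of_real s))
      + indicator {-1..0} s *\<^sub>R ((1 + 1 * of_real s) * exp (w * of_real s))"
    proof eventually_elim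
      case (elim s)
      have "\<i> * of_real (s * u) = w * of_real s" by (simp add: w_def mult_ac)
      then show ?case unfolding \<open>\<i> * of_real (s * u) = w * of_real s\<close> using elim by (auto simp: tent_def indicator_def max_def abs_if)
    qed
  qed (use int integrable_fejer_integrand[of u] in auto)
  also have "\<dots> = ((exp w / w\<^sup>2) - (1 / w + 1 / w\<^sup>2)) + ((1 / w - 1 / w\<^sup>2) + exp (- w) / w\<^sup>2)"
    by (subst Bochner_Integration.integral_add[OF int]) (simp only: I1 I2)
  also have "\<dots> = (exp w + exp (- w) - 2) / w\<^sup>2" by (simp add: diff_divide_distrib add_divide_distrib)
  also have "exp w + exp (- w) = of_real (2 * cos u)"
    by (simp add: w_def complex_eq_iff Re_exp Im_exp)
  also have "w\<^sup>2 = - of_real (u\<^sup>2)" by (simp add: w_def power_mult_distrib)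
  also have "(complex_of_real (2 * cos u) - 2) / - of_real (u\<^sup>2) = of_real (2 * (1 - cos u) / u\<^sup>2)"
    by (simp add: minus_divide_left right_diff_distrib)
  finally show ?thesis .
qed

lemma fejer_measurable [measurable]: "fejer \<in> borel_measurable borel"
proof -
  have "fejer = (\<lambda>u. if u = 0 then fejer 0 else of_real (2 * (1 - cos u) / u\<^sup>2))"
    using fejer_eq by auto
  moreover have "(\<lambda>u. if u = 0 then fejer 0 else of_real (2 * (1 - cos u) / u\<^sup>2)) \<in> borel_measurable borel"
    by measurable
  ultimately show ?thesis by metis
qed

lemma fejer_bound:
  assumes "u \<noteq> 0" shows "cmod (fejer u) \<le> 8 * inverse (1 + u\<^sup>2)"
proof -
  have u2: "u\<^sup>2 > 0" using assms by simp
  have c: "0 \<le> 1 - cos u" "1 - cos u \<le> 2" using cos_ge_minus_one[of u] by auto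
  have "1 - cos u \<le> u\<^sup>2 / 2"
  proof -
    have "1 - cos u = 2 * (sin (u / 2))\<^sup>2" using cos_double_sin[of "u / 2"] by simp
    also have "\<dots> \<le> 2 * (u / 2)\<^sup>2" using power_mono[OF abs_sin_x_le_abs_x[of "u / 2"], of 2] by (simp add: power_divide)
    finally show ?thesis by (simp add: power2_eq_square)
  qed
  then have "2 * (1 - cos u) * (1 + u\<^sup>2) \<le> 8 * u\<^sup>2"
  proof (cases "u\<^sup>2 \<le> 1")
    case True
    have "2 * (1 - cos u) * (1 + u\<^sup>2) \<le> 2 * (u\<^sup>2 / 2) * 2"
      using \<open>1 - cos u \<le> u\<^sup>2 / 2\<close> c True by (intro mult_mono) auto
    also have "\<dots> \<le> 8 * u\<^sup>2" using u2 by simp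
    finally show ?thesis .
  next
    case False
    have "2 * (1 - cos u) * (1 + u\<^sup>2) \<le> 2 * 2 * (1 + u\<^sup>2)"
      using c by (intro mult_mono) auto
    also have "\<dots> \<le> 8 * u\<^sup>2" using False by simp
    finally show ?thesis .
  qed
  then have "2 * (1 - cos u) * (1 + u\<^sup>2) * inverse (1 + u\<^sup>2) \<le> 8 * u\<^sup>2 * inverse (1 + u\<^sup>2)"
    by (rule mult_right_mono) simp
  moreover have "(1 + u\<^sup>2) * inverse (1 + u\<^sup>2) = 1"
    using u2 by (intro right_inverse) linarith
  ultimately have "2 * (1 - cos u) \<le> 8 * inverse (1 + u\<^sup>2) * u\<^sup>2" by (simp add: mult.assoc mult.commute[of "u\<^sup>2"])
  moreover have "cmod (fejer u) = 2 * (1 - cos u) / u\<^sup>2"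
    unfolding fejer_eq[OF assms] norm_of_real using c by simp
  ultimately show ?thesis using pos_divide_le_eq[OF u2] by simp
qed

lemma fejer_integrable: "integrable lborel fejer"
proof (rule Bochner_Integration.integrable_bound)
  show "integrable lborel (\<lambda>u. 8 * inverse (1 + u\<^sup>2) :: real)"
    by (intro integrable_mult_right integrable_inverse_1_plus_square)
  show "AE u in lborel. norm (fejer u) \<le> norm (8 * inverse (1 + u\<^sup>2) :: real)"
    using AE_lborel_singleton[of 0] by eventually_elim (use fejer_bound in \<open>auto intro: order_trans\<close>)
qed simp

lemma fejer_integral_nonzero: "(LINT u|lborel. fejer u) \<noteq> 0"
proof
  assume z: "(LINT u|lborel. fejer u) = 0"
  have "(LINT u|lborel. Re (fejer u)) = 0"
    using z integral_Re[OF fejer_integrable] by simp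
  moreover have "AE u in lborel. 0 \<le> Re (fejer u)"
    using AE_lborel_singleton[of 0] by eventually_elim (simp add: fejer_eq)
  ultimately have "AE u in lborel. Re (fejer u) = 0"
    using integral_nonneg_eq_0_iff_AE[OF integrable_Re[OF fejer_integrable]] by simp
  with AE_lborel_singleton[of "0::real"] have "AE u in lborel. u \<notin> {1..2::real}"
  proof eventually_elim
    case (elim u)
    show ?case
    proof
      assume u: "u \<in> {1..2}"
      have "cos u < cos 0" using u pi_gt3 by (intro cos_monotone_0_pi) auto
      then show False using elim fejer_eq[of u] u by simp
    qed
  qed
  then have "emeasure lborel {1..2::real} = 0"
    by (subst (asm) AE_iff_measurable[of "{1..2}"]) auto
  then show False by simp
qed

text \<open>
  Dilations of the normalized Fejer kernel. Dividing by its integral, which is nonzero because the kernel is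
  nonnegative, avoids the evaluation of that integral.
\<close>

lemma band_limited_kernel:
  obtains \<Psi> where "\<And>\<eta> \<epsilon>. \<eta> > 0 \<Longrightarrow> \<epsilon> > 0 \<Longrightarrow> \<exists>\<psi> m N. integrable lborel \<psi> \<and> (LINT u|lborel. \<psi> u) = 1
      \<and> (LINT u|lborel. cmod (\<psi> u)) \<le> \<Psi>
      \<and> (LINT u|lborel. indicator {u. \<bar>u\<bar> > \<eta>} u * cmod (\<psi> u)) < \<epsilon>
      \<and> band_limited \<psi> m N"
proof -
  define \<kappa> where "\<kappa> = (LINT u|lborel. fejer u)"
  have \<kappa>: "\<kappa> \<noteq> 0" using fejer_integral_nonzero by (simp add: \<kappa>_def)
  define \<phi> where "\<phi> u = fejer u / \<kappa>" for u
  have \<phi>: "integrable lborel \<phi>" unfolding \<phi>_def by (intro integrable_divide fejer_integrable)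
  have \<phi>m [measurable]: "\<phi> \<in> borel_measurable borel" using \<phi> by auto
  have \<phi>1: "(LINT u|lborel. \<phi> u) = 1" using \<kappa> by (simp add: \<phi>_def \<kappa>_def)
  define \<Psi> where "\<Psi> = (LINT u|lborel. cmod (\<phi> u))"
  show ?thesis
  proof (rule that[of \<Psi>])
    fix \<eta> \<epsilon> :: real assume \<eta>: "\<eta> > 0" and \<epsilon>: "\<epsilon> > 0"
    have "(\<lambda>n. LINT u|lborel. indicator {u. \<bar>u\<bar> > real (Suc n) * \<eta>} u * cmod (\<phi> u)) \<longlonglongrightarrow> (LINT u|(lborel::real measure). (0::real))"
    proof (rule integral_dominated_convergence[where w="\<lambda>u. cmod (\<phi> u)"])
      show "AE u in lborel. (\<lambda>n. indicator {u. \<bar>u\<bar> > real (Suc n) * \<eta>} u * cmod (\<phi> u)) \<longlonglongrightarrow> 0"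
      proof (rule AE_I2)
        fix u :: real
        obtain n0 where n0: "\<bar>u\<bar> < real n0 * \<eta>" using reals_Archimedean3[OF \<eta>] by blast
        have "\<forall>\<^sub>F n in sequentially. indicator {u. \<bar>u\<bar> > real (Suc n) * \<eta>} u * cmod (\<phi> u) = 0"
          using eventually_ge_at_top[of n0]
        proof eventually_elim
          case (elim n)
          have "real n0 * \<eta> \<le> real (Suc n) * \<eta>" using elim \<eta> by (intro mult_right_mono) auto
          then show ?case using n0 by (simp add: indicator_def)
        qed
        then show "(\<lambda>n. indicator {u. \<bar>u\<bar> > real (Suc n) * \<eta>} u * cmod (\<phi> u)) \<longlonglongrightarrow> 0"
          by (rule tendsto_eventually)
      qed
    qed (use \<phi> in \<open>auto simp: indicator_def\<close>)
    then have "\<forall>\<^sub>F n in sequentially. (LINT u|lborel. indicator {u. \<bar>u\<bar> > real (Suc n) * \<eta>} u * cmod (\<phi> u)) < \<epsilon>"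
      by (intro order_tendstoD(2)) (use \<epsilon> in auto)
    then obtain n where n: "(LINT u|lborel. indicator {u. \<bar>u\<bar> > real (Suc n) * \<eta>} u * cmod (\<phi> u)) < \<epsilon>"
      by (auto simp: eventually_sequentially)
    define k where "k = real (Suc n)"
    have k: "k > 0" by (simp add: k_def)
    define \<psi> where "\<psi> u = of_real k * \<phi> (k * u)" for u
    define m where "m s = tent (s / k) / \<kappa>" for s
    have "integrable lborel (\<lambda>u. \<phi> (0 + k * u))"
      using k by (intro lborel_integrable_real_affine \<phi>) auto
    then have 1: "integrable lborel \<psi>" unfolding \<psi>_def by (intro integrable_mult_right) simp
    have 2: "(LINT u|lborel. \<psi> u) = 1"
      using lborel_integral_real_affine[of k \<phi> 0] k \<phi>1 by (simp add: \<psi>_def scaleR_conv_of_real)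
    have 3: "(LINT u|lborel. cmod (\<psi> u)) = \<Psi>"
      using lborel_integral_real_affine[of k "\<lambda>u. cmod (\<phi> u)" 0] k by (simp add: \<psi>_def \<Psi>_def norm_mult)
    have 4: "(LINT u|lborel. indicator {u. \<bar>u\<bar> > \<eta>} u * cmod (\<psi> u)) < \<epsilon>"
    proof -
      have "(LINT u|lborel. indicator {u. \<bar>u\<bar> > k * \<eta>} u * cmod (\<phi> u))
          = k * (LINT u|lborel. indicator {u. \<bar>u\<bar> > k * \<eta>} (k * u) * cmod (\<phi> (k * u)))"
        using lborel_integral_real_affine[of k "\<lambda>u. indicator {u. \<bar>u\<bar> > k * \<eta>} u * cmod (\<phi> u)" 0] k by simp
      also have "\<dots> = (LINT u|lborel. indicator {u. \<bar>u\<bar> > \<eta>} u * cmod (\<psi> u))"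
        unfolding Bochner_Integration.integral_mult_right_zero[symmetric]
        by (rule Bochner_Integration.integral_cong) (use k in \<open>auto simp: \<psi>_def norm_mult indicator_def abs_mult\<close>)
      finally show ?thesis using n by (simp add: k_def)
    qed
    have 5: "continuous_on UNIV m"
      unfolding m_def using \<kappa> k by (intro continuous_intros continuous_on_compose2[OF continuous_tent]) auto
    have 6: "m s = 0" if "k < \<bar>s\<bar>" for s
      using that k by (simp add: m_def tent_def abs_divide max_def)
    have 7: "\<psi> u = (LINT s|lborel. character (s * u) * m s)" for u
    proof -
      have "(LINT s|lborel. character (s * u) * m s)
          = of_real k * (LINT s|lborel. character (s * (k * u)) * tent s / \<kappa>)"
        using lborel_integral_real_affine[of k "\<lambda>s. character (s * u) * m s" 0] k
        by (simp add: m_def scaleR_conv_of_real mult_ac)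
      then show ?thesis by (simp add: \<psi>_def \<phi>_def fejer_def)
    qed
    show "\<exists>\<psi> m N. integrable lborel \<psi> \<and> (LINT u|lborel. \<psi> u) = 1
      \<and> (LINT u|lborel. cmod (\<psi> u)) \<le> \<Psi>
      \<and> (LINT u|lborel. indicator {u. \<bar>u\<bar> > \<eta>} u * cmod (\<psi> u)) < \<epsilon>
      \<and> band_limited \<psi> m N"
      using 1 2 3 4 5 6 7 by (intro exI[of _ \<psi>] exI[of _ m] exI[of _ k]) auto
  qed
qed

section \<open>Convolutions and Fourier integrals\<close>

text \<open>
  Two instances matter: \<open>M\<close> is Lebesgue measure and \<open>\<beta>\<close> an integrable function, or \<open>M\<close> is a finite measure
  on the half-line and \<open>\<beta> = 1\<close>.
\<close>

lemma convolution_Fubini: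
  fixes M :: "real measure" and \<beta> \<psi> :: "real \<Rightarrow> complex"
  assumes M: "sigma_finite_measure M" and id: "(\<lambda>v. v) \<in> borel_measurable M"
    and \<beta>: "integrable M \<beta>" and \<psi>: "integrable lborel \<psi>"
  shows "integrable lborel (\<lambda>w. LINT v|M. \<beta> v * \<psi> (w - v))"
    and "f \<in> borel_measurable borel \<Longrightarrow> (\<And>w. cmod (f w) \<le> B) \<Longrightarrow>
      (LINT w|lborel. f w * (LINT v|M. \<beta> v * \<psi> (w - v))) = (LINT v|M. \<beta> v * (LINT u|lborel. f (v + u) * \<psi> u))"
proof -
  interpret M: sigma_finite_measure M by fact
  interpret pair_sigma_finite M lborel ..
  note id [measurable]
  have [measurable]: "\<beta> \<in> borel_measurable M" "\<psi> \<in> borel_measurable borel"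
    using \<beta> \<psi> by auto
  have shift: "integrable lborel (\<lambda>w. \<psi> (w - v))" for v
    using lborel_integrable_real_affine[OF \<psi>, of 1 "-v"] by simp
  have shift_norm: "(LINT w|lborel. cmod (\<psi> (w - v))) = (LINT w|lborel. cmod (\<psi> w))" for v
    using lborel_integral_real_affine[of 1 "\<lambda>w. cmod (\<psi> w)" "-v"] by simp
  have int: "integrable (M \<Otimes>\<^sub>M lborel) (\<lambda>(v, w). \<beta> v * \<psi> (w - v))"
  proof (rule Fubini_integrable)
    show "integrable M (\<lambda>v. LINT w|lborel. norm (case (v, w) of (v, w) \<Rightarrow> \<beta> v * \<psi> (w - v)))"
      using \<beta> by (simp add: norm_mult shift_norm)
    show "AE v in M. integrable lborel (\<lambda>w. case (v, w) of (v, w) \<Rightarrow> \<beta> v * \<psi> (w - v))"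
      using shift by simp
  qed measurable
  show "integrable lborel (\<lambda>w. LINT v|M. \<beta> v * \<psi> (w - v))"
    by (rule integrable_snd[OF int])
  assume f [measurable]: "f \<in> borel_measurable borel" and B: "\<And>w. cmod (f w) \<le> B"
  have intf: "integrable (M \<Otimes>\<^sub>M lborel) (\<lambda>(v, w). f w * (\<beta> v * \<psi> (w - v)))"
  proof (rule Bochner_Integration.integrable_bound)
    show "integrable (M \<Otimes>\<^sub>M lborel) (\<lambda>p. of_real B * (case p of (v, w) \<Rightarrow> \<beta> v * \<psi> (w - v)) :: complex)"
      by (rule integrable_mult_right) (rule int)
    have "B \<ge> 0" using order_trans[OF norm_ge_zero B[of 0]] .
    then show "AE p in M \<Otimes>\<^sub>M lborel. norm (case p of (v, w) \<Rightarrow> f w * (\<beta> v * \<psi> (w - v)))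
        \<le> norm (of_real B * (case p of (v, w) \<Rightarrow> \<beta> v * \<psi> (w - v)) :: complex)"
      by (auto simp: norm_mult abs_of_nonneg split: prod.split intro!: AE_I2 mult_right_mono B)
  qed measurable
  have "(LINT w|lborel. f w * (LINT v|M. \<beta> v * \<psi> (w - v))) = (LINT w|lborel. LINT v|M. f w * (\<beta> v * \<psi> (w - v)))"
    by simp
  also have "\<dots> = (LINT v|M. LINT w|lborel. f w * (\<beta> v * \<psi> (w - v)))"
    by (rule Fubini_integral[OF intf])
  also have "\<dots> = (LINT v|M. \<beta> v * (LINT u|lborel. f (v + u) * \<psi> u))"
  proof (rule Bochner_Integration.integral_cong[OF refl])
    fix v
    have "(LINT w|lborel. f w * (\<beta> v * \<psi> (w - v))) = (LINT w|lborel. \<beta> v * (f w * \<psi> (w - v)))"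
      by (simp add: mult_ac)
    also have "\<dots> = \<beta> v * (LINT w|lborel. f w * \<psi> (w - v))" by simp
    also have "(LINT w|lborel. f w * \<psi> (w - v)) = (LINT u|lborel. f (v + u) * \<psi> u)"
      using lborel_integral_real_affine[of 1 "\<lambda>w. f w * \<psi> (w - v)" v] by simp
    finally show "(LINT w|lborel. f w * (\<beta> v * \<psi> (w - v))) = \<beta> v * (LINT u|lborel. f (v + u) * \<psi> u)" .
  qed
  finally show "(LINT w|lborel. f w * (LINT v|M. \<beta> v * \<psi> (w - v))) = (LINT v|M. \<beta> v * (LINT u|lborel. f (v + u) * \<psi> u))" .
qed

text \<open>
  This is the preceding exchange of integrals for a character in place of \<open>f\<close>.
\<close>

lemma fourier_L1_convolution:
  fixes M :: "real measure" and \<beta> \<psi> :: "real \<Rightarrow> complex"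
  assumes M: "sigma_finite_measure M" and id: "(\<lambda>v. v) \<in> borel_measurable M"
    and \<beta>: "integrable M \<beta>" and \<psi>: "integrable lborel \<psi>"
  shows "fourier_L1 (\<lambda>w. LINT v|M. \<beta> v * \<psi> (w - v)) s
    = (LINT v|M. \<beta> v * cnj_character (s * v)) * fourier_L1 \<psi> s"
proof -
  have "fourier_L1 (\<lambda>w. LINT v|M. \<beta> v * \<psi> (w - v)) s
    = (LINT v|M. \<beta> v * (LINT u|lborel. cnj_character (s * (v + u)) * \<psi> u))"
    unfolding fourier_L1_def
    by (rule convolution_Fubini(2)[OF assms, of _ 1]) (auto simp: norm_exp_eq_Re)
  also have "\<dots> = (LINT v|M. \<beta> v * cnj_character (s * v) * fourier_L1 \<psi> s)"
  proof (rule Bochner_Integration.integral_cong[OF refl])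
    fix v
    have "(\<lambda>u. cnj_character (s * (v + u)) * \<psi> u)
       = (\<lambda>u. cnj_character (s * v) * (cnj_character (s * u) * \<psi> u))"
      by (simp add: algebra_simps flip: exp_add)
    then show "\<beta> v * (LINT u|lborel. cnj_character (s * (v + u)) * \<psi> u)
       = \<beta> v * cnj_character (s * v) * fourier_L1 \<psi> s"
      by (simp add: fourier_L1_def)
  qed
  finally show ?thesis by simp
qed

lemma bounded_kernel_Fubini:
  fixes p q :: "real \<Rightarrow> complex" and k :: "real \<Rightarrow> real \<Rightarrow> complex"
  assumes p: "integrable lborel p" and q: "integrable lborel q"
    and k: "(\<lambda>(v, s). k v s) \<in> borel_measurable (borel \<Otimes>\<^sub>M borel)" "\<And>v s. cmod (k v s) \<le> 1"
  shows "(LINT v|lborel. p v * (LINT s|lborel. k v s * q s)) = (LINT s|lborel. q s * (LINT v|lborel. k v s * p v))"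
proof -
  have [measurable]: "p \<in> borel_measurable borel" "q \<in> borel_measurable borel"
    using p q by auto
  note k(1)[measurable]
  have kv: "integrable lborel (\<lambda>s. k v s * q s)" for v
    by (rule Bochner_Integration.integrable_bound[OF q])
      (use k(2) in \<open>auto simp: norm_mult intro!: mult_left_le_one_le\<close>)
  have int: "integrable (lborel \<Otimes>\<^sub>M lborel) (\<lambda>(v, s). p v * q s)"
  proof (rule lborel_pair.Fubini_integrable)
    show "integrable lborel (\<lambda>v. LINT s|lborel. norm (case (v, s) of (v, s) \<Rightarrow> p v * q s))"
      using p by (simp add: norm_mult)
    show "AE v in lborel. integrable lborel (\<lambda>s. case (v, s) of (v, s) \<Rightarrow> p v * q s)"
      using q by simp
  qed measurable
  have "integrable (lborel \<Otimes>\<^sub>M lborel) (\<lambda>(v, s). p v * (k v s * q s))"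
  proof (rule Bochner_Integration.integrable_bound[OF int])
    show "(\<lambda>(v, s). p v * (k v s * q s)) \<in> borel_measurable (lborel \<Otimes>\<^sub>M lborel)"
      by measurable
    show "AE x in lborel \<Otimes>\<^sub>M lborel. norm (case x of (v, s) \<Rightarrow> p v * (k v s * q s)) \<le> norm (case x of (v, s) \<Rightarrow> p v * q s)"
      using k(2) by (auto simp: norm_mult split: prod.split intro!: AE_I2 mult_left_mono mult_left_le_one_le)
  qed
  note F = lborel_pair.Fubini_integral[OF this]
  have "(LINT v|lborel. p v * (LINT s|lborel. k v s * q s)) = (LINT v|lborel. LINT s|lborel. p v * (k v s * q s))"
    by simp
  also have "\<dots> = (LINT s|lborel. LINT v|lborel. p v * (k v s * q s))" by (rule F[symmetric])
  also have "\<dots> = (LINT s|lborel. q s * (LINT v|lborel. k v s * p v))"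
    by (simp add: mult_ac flip: Bochner_Integration.integral_mult_right_zero)
  finally show ?thesis .
qed

lemma continuous_fourier_L1:
  assumes b: "integrable lborel b"
  shows "continuous_on UNIV (fourier_L1 b)"
  unfolding continuous_on_eq_continuous_within continuous_within_sequentially
proof (intro ballI allI impI)
  fix s :: real and X assume "(\<forall>n. X n \<in> UNIV) \<and> X \<longlonglongrightarrow> s"
  then have X: "X \<longlonglongrightarrow> s" by simp
  have [measurable]: "b \<in> borel_measurable borel" using b by auto
  show "(fourier_L1 b \<circ> X) \<longlonglongrightarrow> fourier_L1 b s"
    unfolding fourier_L1_def o_def
  proof (rule integral_dominated_convergence[where w="\<lambda>t. norm (b t)"])
    show "AE t in lborel. (\<lambda>n. cnj_character (X n * t) * b t) \<longlonglongrightarrow> cnj_character (s * t) * b t"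
      by (intro AE_I2 tendsto_intros X)
  qed (use b in \<open>auto simp: norm_mult norm_exp_eq_Re\<close>)
qed

lemma smoothing_error:
  fixes f \<psi> :: "real \<Rightarrow> complex"
  assumes f: "f \<in> borel_measurable borel" "\<And>t. cmod (f t) \<le> B"
    and \<psi>: "integrable lborel \<psi>" "(LINT u|lborel. \<psi> u) = 1" "(LINT u|lborel. cmod (\<psi> u)) \<le> \<Psi>"
    and tail: "(LINT u|lborel. indicator {u. \<bar>u\<bar> > \<eta>} u * cmod (\<psi> u)) \<le> \<epsilon>"
    and osc: "\<And>v. \<bar>v\<bar> \<le> \<eta> \<Longrightarrow> cmod (f (r + v) - f r) \<le> e" and e: "e \<ge> 0"
  shows "cmod ((LINT u|lborel. f (r + u) * \<psi> u) - f r) \<le> e * \<Psi> + 2 * B * \<epsilon>"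
proof -
  have [measurable]: "\<psi> \<in> borel_measurable borel" "f \<in> borel_measurable borel" using \<psi> f by auto
  have B: "B \<ge> 0" using order_trans[OF norm_ge_zero f(2)[of 0]] .
  have i1: "integrable lborel (\<lambda>u. f (r + u) * \<psi> u)"
    by (rule Bochner_Integration.integrable_bound[OF integrable_mult_right[OF \<psi>(1), of "of_real B"]])
      (use f(2) B in \<open>auto simp: norm_mult intro!: mult_right_mono\<close>)
  have i2: "integrable lborel (\<lambda>u. cmod (\<psi> u))" "integrable lborel (\<lambda>u. indicator {u. \<bar>u\<bar> > \<eta>} u * cmod (\<psi> u))"
    using \<psi>(1) by (auto intro!: integrable_norm integrable_real_mult_indicator simp: mult.commute[of "indicator _ _"])
  have d: "(LINT u|lborel. f (r + u) * \<psi> u) - f r = (LINT u|lborel. f (r + u) * \<psi> u - f r * \<psi> u)"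
    using \<psi>(1,2) i1 by (subst Bochner_Integration.integral_diff) auto
  have "cmod (LINT u|lborel. f (r + u) * \<psi> u - f r * \<psi> u) \<le> (LINT u|lborel. cmod (f (r + u) * \<psi> u - f r * \<psi> u))"
    by (rule integral_norm_bound)
  also have "\<dots> \<le> (LINT u|lborel. e * cmod (\<psi> u) + 2 * B * (indicator {u. \<bar>u\<bar> > \<eta>} u * cmod (\<psi> u)))"
  proof (rule integral_mono)
    show "integrable lborel (\<lambda>u. cmod (f (r + u) * \<psi> u - f r * \<psi> u))"
      using \<psi>(1) i1 by (intro integrable_norm Bochner_Integration.integrable_diff integrable_mult_right)
    show "integrable lborel (\<lambda>u. e * cmod (\<psi> u) + 2 * B * (indicator {u. \<bar>u\<bar> > \<eta>} u * cmod (\<psi> u)))"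
      by (intro Bochner_Integration.integrable_add integrable_mult_right i2)
    fix u
    have *: "cmod (f (r + u) * \<psi> u - f r * \<psi> u) = cmod (f (r + u) - f r) * cmod (\<psi> u)"
      by (simp add: norm_mult flip: left_diff_distrib)
    show "cmod (f (r + u) * \<psi> u - f r * \<psi> u) \<le> e * cmod (\<psi> u) + 2 * B * (indicator {u. \<bar>u\<bar> > \<eta>} u * cmod (\<psi> u))"
    proof (cases "\<bar>u\<bar> > \<eta>")
      case True
      have "cmod (f (r + u) - f r) \<le> 2 * B"
        using norm_triangle_ineq4[of "f (r + u)" "f r"] f(2)[of "r + u"] f(2)[of r] by linarith
      then have "cmod (f (r + u) - f r) * cmod (\<psi> u) \<le> 2 * B * cmod (\<psi> u)" by (rule mult_right_mono) simp
      then show ?thesis using True e unfolding * by (simp add: add_increasing)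
    next
      case False
      then show ?thesis using osc[of u] unfolding * by (simp add: mult_right_mono)
    qed
  qed
  also have "\<dots> = e * (LINT u|lborel. cmod (\<psi> u)) + 2 * B * (LINT u|lborel. indicator {u. \<bar>u\<bar> > \<eta>} u * cmod (\<psi> u))"
    by (subst Bochner_Integration.integral_add) (auto intro: i2 integrable_mult_right)
  also have "\<dots> \<le> e * \<Psi> + 2 * B * \<epsilon>"
    using \<psi>(3) tail e B by (intro add_mono mult_left_mono) auto
  finally show ?thesis by (simp add: d)
qed

text \<open>
  Translation by \<open>\<pi>/t\<close> changes the sign of the character, so the integral is half that of
  \<open>(h(s) - h(s + \<pi>/t)) e\<^sup>-\<^sup>i\<^sup>s\<^sup>t\<close>. The estimate depends on \<open>h\<close> only through the uniform continuity of \<open>P\<close>.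
\<close>

lemma uniform_Riemann_Lebesgue:
  fixes P :: "real \<Rightarrow> 'b::real_normed_vector"
  assumes P: "continuous_on UNIV P" "\<And>s. N < \<bar>s\<bar> \<Longrightarrow> P s = 0" and e: "e > 0"
  shows "\<exists>t0. \<forall>h. (\<forall>s s'. cmod (h s - h s') \<le> norm (P s - P s')) \<longrightarrow> (\<forall>s. N < \<bar>s\<bar> \<longrightarrow> h s = 0) \<longrightarrow>
    (\<forall>t\<ge>t0. cmod (LINT s|lborel. h s * cnj_character (s * t)) \<le> e)"
proof -
  define c where "c = 2 * \<bar>N\<bar> + 3"
  have c: "c > 0" by (simp add: c_def)
  have "uniformly_continuous_on {-\<bar>N\<bar>-1..\<bar>N\<bar>+1} P"
    by (rule compact_uniformly_continuous[OF continuous_on_subset[OF P(1)]]) auto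
  then obtain d where d: "d > 0" "\<And>s s'. s \<in> {-\<bar>N\<bar>-1..\<bar>N\<bar>+1} \<Longrightarrow> s' \<in> {-\<bar>N\<bar>-1..\<bar>N\<bar>+1} \<Longrightarrow> dist s' s < d \<Longrightarrow> dist (P s') (P s) < e / c"
    unfolding uniformly_continuous_on_def using e c by (metis divide_pos_pos)
  have osc: "norm (P s - P s') \<le> e / c" if "\<bar>s - s'\<bar> < min d 1" for s s'
  proof (cases "\<bar>s\<bar> \<le> \<bar>N\<bar> \<or> \<bar>s'\<bar> \<le> \<bar>N\<bar>")
    case True
    then have "s \<in> {-\<bar>N\<bar>-1..\<bar>N\<bar>+1}" "s' \<in> {-\<bar>N\<bar>-1..\<bar>N\<bar>+1}" using that by auto
    then show ?thesis using d(2)[of s' s] that by (auto simp: dist_norm)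
  next
    case False
    then have "P s = 0" "P s' = 0" by (auto intro: P(2))
    then show ?thesis using e c by simp
  qed
  define t0 where "t0 = pi / min d 1 + 1"
  show ?thesis
  proof (intro exI[of _ t0] allI impI)
    fix h :: "real \<Rightarrow> complex" and t
    assume "\<forall>s s'. cmod (h s - h s') \<le> norm (P s - P s')" "\<forall>s. N < \<bar>s\<bar> \<longrightarrow> h s = 0" and t: "t \<ge> t0"
    then have h: "\<And>s s'. cmod (h s - h s') \<le> norm (P s - P s')" and h0: "\<And>s. N < \<bar>s\<bar> \<Longrightarrow> h s = 0" by simp_all
    have tp: "t > 0" "pi / t < min d 1"
    proof -
      have m: "min d 1 > 0" using d(1) by simp
      then have "pi / min d 1 > 0" by simp
      then show tnn: "t > 0" using t unfolding t0_def by linarith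
      have "pi / min d 1 < t" using t unfolding t0_def by linarith
      then show "pi / t < min d 1" using m tnn by (simp only: pos_divide_less_eq mult.commute)
    qed
    define \<delta> where "\<delta> = pi / t"
    have \<delta>: "\<delta> > 0" "\<delta> < min d 1" using tp by (auto simp: \<delta>_def)
    let ?E = "\<lambda>s. cnj_character (s * t)"
    have hc: "continuous_on UNIV h"
      unfolding continuous_on_def
    proof
      fix s
      have "((\<lambda>u. P u - P s) \<longlongrightarrow> 0) (at s within UNIV)"
        using P(1) by (auto simp: continuous_on_def LIM_zero_iff)
      then have lim: "((\<lambda>u. norm (P u - P s)) \<longlongrightarrow> 0) (at s within UNIV)" by (rule tendsto_norm_zero)
      have "\<forall>\<^sub>F u in at s within UNIV. norm (h u - h s) \<le> norm (P u - P s)"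
        by (intro always_eventually allI h)
      then have "((\<lambda>u. h u - h s) \<longlongrightarrow> 0) (at s within UNIV)"
        using lim by (rule Lim_null_comparison)
      then show "(h \<longlongrightarrow> h s) (at s within UNIV)" by (rule LIM_zero_cancel)
    qed
    have hi: "integrable lborel (\<lambda>s. h s * ?E s)"
      by (rule continuous_compact_support_integrable[where N=N]) (auto intro!: continuous_intros hc simp: h0)
    define I where "I = (LINT s|lborel. h s * ?E s)"
    have I2: "I = (LINT s|lborel. - (h (\<delta> + s) * ?E s))"
    proof -
      have "I = (LINT s|lborel. h (\<delta> + s) * ?E (\<delta> + s))"
        using lborel_integral_real_affine[of 1 "\<lambda>s. h s * ?E s" \<delta>] by (simp add: I_def)
      also have "(\<lambda>s. ?E (\<delta> + s)) = (\<lambda>s. - ?E s)"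
      proof
        fix s
        have "?E (\<delta> + s) = exp (- (\<i> * complex_of_real pi)) * ?E s"
          using tp by (simp add: \<delta>_def algebra_simps add_divide_distrib flip: exp_add)
        then show "?E (\<delta> + s) = - ?E s" by (simp add: exp_minus)
      qed
      then have "(LINT s|lborel. h (\<delta> + s) * ?E (\<delta> + s)) = (LINT s|lborel. - (h (\<delta> + s) * ?E s))"
        by (metis (no_types, lifting) mult_minus_right)
      finally show ?thesis .
    qed
    have hi2: "integrable lborel (\<lambda>s. - (h (\<delta> + s) * ?E s))"
      by (rule continuous_compact_support_integrable[where N="\<bar>N\<bar> + 1"])
         (use \<delta> in \<open>auto intro!: continuous_intros continuous_on_compose2[OF hc] h0\<close>)
    have "(LINT s|lborel. h s * ?E s + - (h (\<delta> + s) * ?E s)) = I + I"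
      by (simp only: Bochner_Integration.integral_add[OF hi hi2] I_def[symmetric] I2[symmetric])
    then have "2 * I = (LINT s|lborel. h s * ?E s + - (h (\<delta> + s) * ?E s))" by simp
    then have "2 * cmod I = cmod (LINT s|lborel. h s * ?E s + - (h (\<delta> + s) * ?E s))"
      by (metis norm_mult norm_numeral)
    also have "\<dots> \<le> (LINT s|lborel. cmod (h s * ?E s + - (h (\<delta> + s) * ?E s)))"
      by (rule integral_norm_bound)
    also have "\<dots> \<le> (LINT s|lborel. indicator {-\<bar>N\<bar>-1..\<bar>N\<bar>+1} s * (e / c))"
    proof (rule integral_mono)
      show "integrable lborel (\<lambda>s. cmod (h s * ?E s + - (h (\<delta> + s) * ?E s)))"
        by (intro integrable_norm Bochner_Integration.integrable_add hi hi2)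
      fix s
      have "cmod (h s * ?E s + - (h (\<delta> + s) * ?E s)) = cmod (h s - h (\<delta> + s))"
        by (simp add: norm_mult norm_exp_eq_Re flip: left_diff_distrib)
      also have "\<dots> \<le> indicator {-\<bar>N\<bar>-1..\<bar>N\<bar>+1} s * (e / c)"
      proof (cases "s \<in> {-\<bar>N\<bar>-1..\<bar>N\<bar>+1}")
        case True
        have "cmod (h s - h (\<delta> + s)) \<le> e / c"
          by (rule order_trans[OF h osc]) (use \<delta> in simp)
        then show ?thesis using True by simp
      next
        case False
        then have "N < \<bar>s\<bar>" "N < \<bar>\<delta> + s\<bar>" using \<delta> by auto
        then have "h s = 0" "h (\<delta> + s) = 0" by (auto intro: h0)
        then show ?thesis using False by simp
      qed
      finally show "cmod (h s * ?E s + - (h (\<delta> + s) * ?E s)) \<le> indicator {-\<bar>N\<bar>-1..\<bar>N\<bar>+1} s * (e / c)" .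
    qed simp
    also have "\<dots> = (2 * \<bar>N\<bar> + 2) * (e / c)" by simp
    also have "\<dots> \<le> c * (e / c)" using e c by (intro mult_right_mono) (auto simp: c_def)
    finally have "cmod I \<le> e" using e c by simp
    then show "cmod (LINT s|lborel. h s * cnj_character (s * t)) \<le> e" by (simp add: I_def)
  qed
qed

section \<open>Decay away from the spectrum\<close>

lemma bounded_bilinear_scaleC: "bounded_bilinear (scaleC :: complex \<Rightarrow> 'a::complex_normed_vector \<Rightarrow> 'a)"
proof
  fix a b :: complex and x y :: 'a and r :: real
  show "(a + b) *\<^sub>C x = a *\<^sub>C x + b *\<^sub>C x" "a *\<^sub>C (x + y) = a *\<^sub>C x + a *\<^sub>C y"
    by (rule scaleC_add_left scaleC_add_right)+
  show "(r *\<^sub>R a) *\<^sub>C x = r *\<^sub>R a *\<^sub>C x" "a *\<^sub>C r *\<^sub>R x = r *\<^sub>R a *\<^sub>C x"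
    by (simp_all add: scaleC_scaleC scaleR_conv_of_real mult.commute flip: scaleC_of_real)
  show "\<exists>K. \<forall>a x. norm (a *\<^sub>C x :: 'a) \<le> norm a * norm x * K"
    by (intro exI[of _ 1]) (simp add: norm_scaleC)
qed

lemma continuous_on_extend_by_zero:
  fixes F :: "real \<Rightarrow> 'b::real_normed_vector"
  assumes "closed \<Lambda>" "open U" "\<Lambda> \<subseteq> U" "continuous_on (- \<Lambda>) F" "\<And>s. s \<in> U \<Longrightarrow> F s = 0"
  shows "continuous_on UNIV F"
proof -
  have "continuous_on U F"
    using assms(5) continuous_on_cong[of U U F "\<lambda>_. 0"] by simp
  then have "continuous_on (U \<union> - \<Lambda>) F"
    using assms by (intro continuous_on_open_Un) auto
  moreover have "U \<union> - \<Lambda> = UNIV" using assms(3) by auto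
  ultimately show ?thesis by simp
qed

text \<open>
  By Fubini, the representation of \<open>\<psi>\<close> as an inverse Fourier integral carries over to \<open>b * \<psi>\<close>.
\<close>

lemma convolution_band_limited:
  assumes b: "integrable lborel b"
    and m: "continuous_on UNIV m" "\<And>s. N < \<bar>s\<bar> \<Longrightarrow> m s = 0"
    and \<psi>: "\<And>u. \<psi> u = (LINT s|lborel. character (s * u) * m s)"
  shows "(LINT v|lborel. b v * \<psi> (w - v)) = (LINT s|lborel. character (s * w) * (m s * fourier_L1 b s))"
proof -
  have mi: "integrable lborel m" by (rule continuous_compact_support_integrable[OF m])
  have "(LINT v|lborel. b v * \<psi> (w - v)) = (LINT v|lborel. b v * (LINT s|lborel. character (s * (w - v)) * m s))"
    by (simp only: \<psi>)
  also have "\<dots> = (LINT s|lborel. m s * (LINT v|lborel. character (s * (w - v)) * b v))"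
    by (rule bounded_kernel_Fubini[OF b mi]) (auto simp: norm_exp_eq_Re)
  also have "\<dots> = (LINT s|lborel. character (s * w) * (m s * fourier_L1 b s))"
  proof (rule Bochner_Integration.integral_cong[OF refl])
    fix s
    have "(\<lambda>v. character (s * (w - v)) * b v)
        = (\<lambda>v. character (s * w) * (cnj_character (s * v) * b v))"
      by (simp add: algebra_simps flip: exp_add)
    then show "m s * (LINT v|lborel. character (s * (w - v)) * b v)
        = character (s * w) * (m s * fourier_L1 b s)"
      by (simp add: fourier_L1_def)
  qed
  finally show ?thesis .
qed

text \<open>
  Parseval's identity for an exponentially damped \<open>f\<close>, whose Fourier transform is the Laplace transform of
  \<open>f\<close> on the vertical line with real part \<open>\<alpha>\<close>.
\<close>

lemma laplace_pairing:
  assumes f: "f \<in> borel_measurable borel" "\<And>t. cmod (f t) \<le> B" "\<And>t. t < 0 \<Longrightarrow> f t = 0"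
    and g: "integrable lborel g" and \<alpha>: "\<alpha> > 0"
  shows "(LINT w|lborel. exp (- of_real (\<alpha> * (t + w))) * f (t + w) * (LINT s|lborel. character (s * w) * g s))
    = (LINT s|lborel. g s * laplace f (- \<i> * of_real s + of_real \<alpha>) * cnj_character (s * t))"
proof -
  let ?p = "\<lambda>r. exp (- complex_of_real \<alpha> * of_real r) * f r"
  have p: "integrable lborel ?p"
    using laplace_integrable(1)[OF f, of "of_real \<alpha>"] \<alpha> by simp
  have pt: "integrable lborel (\<lambda>w. ?p (t + w))"
    using lborel_integrable_real_affine[OF p, of 1 t] by simp
  have "(LINT w|lborel. ?p (t + w) * (LINT s|lborel. character (s * w) * g s))
    = (LINT s|lborel. g s * (LINT w|lborel. character (s * w) * ?p (t + w)))"
    by (rule bounded_kernel_Fubini[OF pt g]) (auto simp: norm_exp_eq_Re)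
  also have "\<dots> = (LINT s|lborel. g s * laplace f (- \<i> * of_real s + of_real \<alpha>) * cnj_character (s * t))"
  proof (rule Bochner_Integration.integral_cong[OF refl])
    fix s
    have "(LINT r|lborel. character (s * (r - t)) * ?p r) = (LINT w|lborel. character (s * w) * ?p (t + w))"
      using lborel_integral_real_affine[of 1 "\<lambda>r. character (s * (r - t)) * ?p r" t] by simp
    moreover have "(\<lambda>r. character (s * (r - t)) * ?p r)
        = (\<lambda>r. cnj_character (s * t) * (exp (- (- \<i> * of_real s + of_real \<alpha>) * of_real r) * f r))"
      by (simp add: algebra_simps flip: exp_add)
    ultimately have "(LINT w|lborel. character (s * w) * ?p (t + w))
        = cnj_character (s * t) * laplace f (- \<i> * of_real s + of_real \<alpha>)"
      by (simp add: laplace_def)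
    then show "g s * (LINT w|lborel. character (s * w) * ?p (t + w))
        = g s * laplace f (- \<i> * of_real s + of_real \<alpha>) * cnj_character (s * t)"
      by (simp only: mult_ac)
  qed
  finally show ?thesis by simp
qed

lemma continuous_laplace_vertical:
  assumes f: "f \<in> borel_measurable borel" "\<And>t. cmod (f t) \<le> B" "\<And>t. t < 0 \<Longrightarrow> f t = 0" and \<alpha>: "\<alpha> > 0"
  shows "continuous_on UNIV (\<lambda>s. laplace f (- \<i> * complex_of_real s + of_real \<alpha>))"
proof -
  let ?p = "\<lambda>r. exp (- complex_of_real \<alpha> * of_real r) * f r"
  have p: "integrable lborel ?p"
    using laplace_integrable(1)[OF f, of "of_real \<alpha>"] \<alpha> by simp
  have "laplace f (- \<i> * complex_of_real s + of_real \<alpha>) = fourier_L1 ?p (- s)" for s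
  proof -
    have "(\<lambda>r. exp (- (- \<i> * of_real s + of_real \<alpha>) * of_real r) * f r) = (\<lambda>r. cnj_character (- s * r) * ?p r)"
      by (simp add: algebra_simps flip: exp_add)
    then show ?thesis by (simp add: laplace_def fourier_L1_def)
  qed
  moreover have "continuous_on UNIV (\<lambda>s. fourier_L1 ?p (- s))"
    by (rule continuous_on_compose2[OF continuous_fourier_L1[OF p]]) (auto intro!: continuous_intros)
  ultimately show ?thesis by simp
qed

context bounded_C0_semigroup
begin

lemma orbit_fun_neg: "t < 0 \<Longrightarrow> orbit_fun \<xi> x t = 0"
  by (simp add: orbit_fun_def)

lemma orbit_fun_le:
  assumes "contractive_functional \<xi>" "norm x \<le> 1"
  shows "cmod (orbit_fun \<xi> x t) \<le> K"
  using orbit_fun_bound[OF assms(1), of x t] mult_left_mono[OF assms(2) K_nonneg] by simp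

text \<open>
  Damping by \<open>exp (-\<alpha> t)\<close> makes Parseval's identity applicable; as \<open>\<alpha> \<down> 0\<close> the Laplace transforms converge
  to the resolvent on the support of \<open>m F b\<close>, and what remains is the Fourier integral of \<open>P\<close>.
\<close>

lemma band_limited_decay:
  assumes closed: "closed (real_spectrum_iA T)" and b: "integrable lborel b"
    and U: "open U" "real_spectrum_iA T \<subseteq> U" "\<And>s. s \<in> U \<Longrightarrow> fourier_L1 b s = 0"
    and \<psi>i: "integrable lborel \<psi>"
    and m: "continuous_on UNIV m" "\<And>s. N < \<bar>s\<bar> \<Longrightarrow> m s = 0"
    and \<psi>: "\<And>u. \<psi> u = (LINT s|lborel. character (s * u) * m s)"
    and e: "e > 0"
  shows "\<exists>t0. \<forall>\<xi> x t. contractive_functional \<xi> \<longrightarrow> norm x \<le> 1 \<longrightarrow> t \<ge> t0 \<longrightarrow>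
     cmod (LINT w|lborel. orbit_fun \<xi> x (t + w) * (LINT v|lborel. b v * \<psi> (w - v))) \<le> e"
proof -
  define \<Lambda> where "\<Lambda> = real_spectrum_iA T"
  define g where "g s = m s * fourier_L1 b s" for s
  have gc: "continuous_on UNIV g"
    unfolding g_def by (intro continuous_intros m continuous_fourier_L1 b)
  have g0: "g s = 0" if "N < \<bar>s\<bar>" for s using m(2)[OF that] by (simp add: g_def)
  have gU: "g s = 0" if "s \<in> U" for s using U(3)[OF that] by (simp add: g_def)
  have gi: "integrable lborel g" by (rule continuous_compact_support_integrable[OF gc g0])
  define R where "R s = (SOME R. is_resolvent (generator_dom T) (generator T) (- \<i> * of_real s) R)" for s
  have R: "is_resolvent (generator_dom T) (generator T) (- \<i> * of_real s) (R s)" if "s \<notin> \<Lambda>" for s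
    using not_in_real_spectrum[of s T] that unfolding R_def \<Lambda>_def by (metis someI)
  have Rc: "continuous_on (- \<Lambda>) R"
    by (rule continuous_on_resolvent[OF R]) simp
  define P where "P s = g s *\<^sub>C R s" for s
  \<comment> \<open>A bound for the error of the Laplace transform, complex-valued only to share the integrability lemma.\<close>
  define Q where "Q s = complex_of_real (cmod (g s) * (norm (R s))\<^sup>2)" for s
  have Pc: "continuous_on UNIV P"
  proof (rule continuous_on_extend_by_zero)
    show "continuous_on (- \<Lambda>) P"
      unfolding P_def by (intro bounded_bilinear.continuous_on[OF bounded_bilinear_scaleC] Rc continuous_on_subset[OF gc]) auto
    show "P s = 0" if "s \<in> U" for s
      using gU[OF that] norm_scaleC[of 0 "R s"] by (simp add: P_def)
  qed (use U closed in \<open>auto simp: \<Lambda>_def\<close>)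
  have P0: "P s = 0" if "N < \<bar>s\<bar>" for s
    using g0[OF that] norm_scaleC[of 0 "R s"] by (simp add: P_def)
  have Qc: "continuous_on UNIV Q"
  proof (rule continuous_on_extend_by_zero)
    show "continuous_on (- \<Lambda>) Q"
      unfolding Q_def by (intro continuous_intros Rc continuous_on_subset[OF gc]) auto
  qed (use U closed gU in \<open>auto simp: \<Lambda>_def Q_def\<close>)
  have Qi: "integrable lborel Q"
    by (rule continuous_compact_support_integrable[OF Qc, of N]) (simp add: Q_def g0)
  obtain t0 where t0: "\<forall>h. (\<forall>s s'. cmod (h s - h s') \<le> norm (P s - P s')) \<longrightarrow> (\<forall>s. N < \<bar>s\<bar> \<longrightarrow> h s = 0) \<longrightarrow>
      (\<forall>t\<ge>t0. cmod (LINT s|lborel. h s * cnj_character (s * t)) \<le> e)"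
    using uniform_Riemann_Lebesgue[OF Pc P0 e] by (rule exE)
  show ?thesis
  proof (intro exI[of _ t0] allI impI)
    fix \<xi> :: "'a \<Rightarrow> complex" and x :: 'a and t :: real
    assume \<xi>: "contractive_functional \<xi>" and x: "norm x \<le> 1" and t: "t \<ge> t0"
    note \<xi>D = contractive_functionalD[OF \<xi>]
    define f where "f = orbit_fun \<xi> x"
    have f: "f \<in> borel_measurable borel" "\<And>r. cmod (f r) \<le> K" "\<And>r. r < 0 \<Longrightarrow> f r = 0"
      unfolding f_def by (rule orbit_fun_measurable[OF \<xi>] orbit_fun_le[OF \<xi> x] orbit_fun_neg | assumption)+
    note f(1)[measurable]
    define c where "c w = (LINT v|lborel. b v * \<psi> (w - v))" for w
    have ci: "integrable lborel c"
      unfolding c_def by (rule convolution_Fubini(1)[OF _ _ b \<psi>i]) (auto intro: sigma_finite_lborel)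
    then have [measurable]: "c \<in> borel_measurable borel" by auto
    have c_eq: "c w = (LINT s|lborel. character (s * w) * g s)" for w
      unfolding c_def g_def by (rule convolution_band_limited[OF b m \<psi>])
    define h where "h s = \<xi> (P s x)" for s
    have hd: "cmod (h s - h s') \<le> norm (P s - P s')" for s s'
    proof -
      have "h s - h s' = \<xi> ((P s - P s') x)" by (simp add: h_def \<xi>D(5) blinfun.diff_left)
      then have "cmod (h s - h s') \<le> norm (P s - P s') * norm x"
        using order_trans[OF \<xi>D(3) norm_blinfun] by simp
      also have "\<dots> \<le> norm (P s - P s') * 1" using x by (intro mult_left_mono) auto
      finally show ?thesis by simp
    qed
    have h0: "h s = 0" if "N < \<bar>s\<bar>" for s using P0[OF that] by (simp add: h_def \<xi>D(6))
    have hc: "continuous_on UNIV h"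
      unfolding h_def by (intro bounded_linear.continuous_on[OF \<xi>D(4)] continuous_intros Pc)
    let ?E = "\<lambda>s. cnj_character (s * t)"
    let ?L = "\<lambda>\<alpha> s. laplace f (- \<i> * complex_of_real s + of_real \<alpha>)"
    define I where "I = (LINT s|lborel. h s * ?E s)"
    define CQ where "CQ = (LINT s|lborel. (1 + K) * cmod (Q s))"
    have hi: "integrable lborel (\<lambda>s. h s * ?E s)"
      by (rule continuous_compact_support_integrable[where N=N]) (auto intro!: continuous_intros hc simp: h0)
    \<comment> \<open>The damped pairing, tending to the pairing of \<open>f\<close> with \<open>b * \<psi>\<close> as \<open>\<alpha>\<close> tends to \<open>0\<close>.\<close>
    define J where "J \<alpha> = (LINT w|lborel. exp (- of_real (\<alpha> * (t + w))) * f (t + w) * c w)" for \<alpha>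
    have JI: "cmod (J \<alpha> - I) \<le> \<alpha> * CQ" if \<alpha>: "\<alpha> > 0" for \<alpha>
    proof -
      have Ji: "integrable lborel (\<lambda>s. g s * ?L \<alpha> s * ?E s)"
        by (rule continuous_compact_support_integrable[where N=N])
           (auto intro!: continuous_intros gc continuous_laplace_vertical[OF f \<alpha>, simplified] simp: g0)
      have "J \<alpha> = (LINT s|lborel. g s * ?L \<alpha> s * ?E s)"
        unfolding J_def c_eq by (rule laplace_pairing[OF f gi \<alpha>])
      then have "J \<alpha> - I = (LINT s|lborel. g s * ?L \<alpha> s * ?E s - h s * ?E s)"
        using Bochner_Integration.integral_diff[OF Ji hi] by (simp add: I_def)
      then have "cmod (J \<alpha> - I) \<le> (LINT s|lborel. cmod (g s * ?L \<alpha> s * ?E s - h s * ?E s))"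
        using integral_norm_bound by simp
      also have "\<dots> \<le> (LINT s|lborel. \<alpha> * ((1 + K) * cmod (Q s)))"
      proof (rule integral_mono)
        show "integrable lborel (\<lambda>s. cmod (g s * ?L \<alpha> s * ?E s - h s * ?E s))"
          by (intro integrable_norm Bochner_Integration.integrable_diff Ji hi)
        show "integrable lborel (\<lambda>s. \<alpha> * ((1 + K) * cmod (Q s)))"
          by (intro integrable_mult_right integrable_norm Qi)
        fix s
        have hg: "h s = g s * \<xi> (R s x)" by (simp add: h_def P_def scaleC_blinfun.rep_eq \<xi>D(2))
        have "cmod (g s * ?L \<alpha> s * ?E s - h s * ?E s) = cmod (g s) * cmod (?L \<alpha> s - \<xi> (R s x))"
          unfolding hg by (simp add: norm_mult norm_exp_eq_Re mult.assoc flip: left_diff_distrib right_diff_distrib)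
        also have "\<dots> \<le> cmod (g s) * (\<alpha> * ((1 + K) * (norm (R s))\<^sup>2))"
        proof (cases "s \<in> \<Lambda>")
          case True
          then have "g s = 0" using gU U(2) by (auto simp: \<Lambda>_def)
          then show ?thesis by simp
        next
          case False
          have "cmod (?L \<alpha> s - \<xi> (R s x)) \<le> \<alpha> * ((1 + K) * (norm (R s))\<^sup>2)"
            unfolding f_def by (rule laplace_orbit_resolvent[OF R[OF False] _ \<alpha> \<xi> x]) simp
          then show ?thesis by (intro mult_left_mono) auto
        qed
        also have "\<dots> = \<alpha> * ((1 + K) * cmod (Q s))" by (simp add: Q_def norm_mult norm_power)
        finally show "cmod (g s * ?L \<alpha> s * ?E s - h s * ?E s) \<le> \<alpha> * ((1 + K) * cmod (Q s))" .
      qed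
      also have "\<dots> = \<alpha> * CQ" by (simp add: CQ_def)
      finally show ?thesis .
    qed
    define \<alpha> where "\<alpha> n = 1 / real (Suc n)" for n
    have \<alpha>: "\<alpha> n > 0" "\<alpha> \<longlonglongrightarrow> 0" for n
      unfolding \<alpha>_def using lim_1_over_n[THEN LIMSEQ_Suc] by auto
    have "(\<lambda>n. J (\<alpha> n)) \<longlonglongrightarrow> (LINT w|lborel. f (t + w) * c w)"
      unfolding J_def
    proof (rule integral_dominated_convergence[where w="\<lambda>w. K * cmod (c w)"])
      show "AE w in lborel. (\<lambda>n. exp (- of_real (\<alpha> n * (t + w))) * f (t + w) * c w) \<longlonglongrightarrow> f (t + w) * c w"
      proof (rule AE_I2)
        fix w
        have "(\<lambda>n. exp (- of_real (\<alpha> n * (t + w))) * f (t + w) * c w) \<longlonglongrightarrow> exp (- of_real (0 * (t + w))) * f (t + w) * c w"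
          by (intro tendsto_intros \<alpha>)
        then show "(\<lambda>n. exp (- of_real (\<alpha> n * (t + w))) * f (t + w) * c w) \<longlonglongrightarrow> f (t + w) * c w" by simp
      qed
      show "AE w in lborel. norm (exp (- of_real (\<alpha> n * (t + w))) * f (t + w) * c w) \<le> K * cmod (c w)" for n
      proof (rule AE_I2)
        fix w
        have "cmod (exp (- of_real (\<alpha> n * (t + w))) * f (t + w)) \<le> K"
        proof (cases "t + w < 0")
          case False
          then have "0 \<le> \<alpha> n * (t + w)" using \<alpha>(1)[of n] by simp
          then have "exp (- (\<alpha> n * (t + w))) * cmod (f (t + w)) \<le> 1 * K"
            using f(2) by (intro mult_mono) auto
          then show ?thesis by (simp add: norm_mult norm_exp_eq_Re)
        qed (simp add: f(3) K_nonneg)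
        then show "norm (exp (- of_real (\<alpha> n * (t + w))) * f (t + w) * c w) \<le> K * cmod (c w)"
          by (simp add: norm_mult mult_right_mono)
      qed
    qed (use ci in auto)
    moreover have "(\<lambda>n. J (\<alpha> n)) \<longlonglongrightarrow> I"
    proof (rule LIM_zero_cancel, rule Lim_null_comparison)
      show "\<forall>\<^sub>F n in sequentially. norm (J (\<alpha> n) - I) \<le> \<alpha> n * CQ"
        by (intro always_eventually allI JI \<alpha>)
      show "(\<lambda>n. \<alpha> n * CQ) \<longlonglongrightarrow> 0" by (rule tendsto_mult_left_zero[OF \<alpha>(2)])
    qed
    ultimately have "(LINT w|lborel. f (t + w) * c w) = I" by (rule LIMSEQ_unique)
    then show "cmod (LINT w|lborel. orbit_fun \<xi> x (t + w) * (LINT v|lborel. b v * \<psi> (w - v))) \<le> e"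
      using t0[rule_format, of h t] hd h0 t by (simp add: I_def f_def c_def)
  qed
qed

end

context bounded_C0_semigroup
begin

abbreviation smoothing_defect :: "(real \<Rightarrow> complex) \<Rightarrow> ('a \<Rightarrow> complex) \<Rightarrow> 'a \<Rightarrow> real \<Rightarrow> complex" where
  "smoothing_defect \<psi> \<xi> x r \<equiv> (LINT u|lborel. orbit_fun \<xi> x (r + u) * \<psi> u) - orbit_fun \<xi> x r"

text \<open>
  Asymptotic equicontinuity determines how narrow the kernel has to be.
\<close>

lemma orbit_smoothing:
  assumes aa: "asymptotically_analytic T" and e: "e > 0"
  obtains \<psi> m N \<Psi> r0 where "integrable lborel \<psi>" "continuous_on UNIV m" "\<And>s. N < \<bar>s\<bar> \<Longrightarrow> m s = 0"
    "\<And>u. \<psi> u = (LINT s|lborel. character (s * u) * m s)"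
    "\<Psi> \<ge> 0" "\<And>\<xi> x r. contractive_functional \<xi> \<Longrightarrow> norm x \<le> 1 \<Longrightarrow>
       cmod (smoothing_defect \<psi> \<xi> x r) \<le> \<Psi>"
    "\<And>\<xi> x r. contractive_functional \<xi> \<Longrightarrow> norm x \<le> 1 \<Longrightarrow> r \<ge> r0 \<Longrightarrow>
       cmod (smoothing_defect \<psi> \<xi> x r) \<le> e"
proof -
  obtain \<Psi>' where ker: "\<And>\<eta> \<epsilon>. \<eta> > 0 \<Longrightarrow> \<epsilon> > 0 \<Longrightarrow> \<exists>\<psi> m N. integrable lborel \<psi> \<and> (LINT u|lborel. \<psi> u) = 1
      \<and> (LINT u|lborel. cmod (\<psi> u)) \<le> \<Psi>'
      \<and> (LINT u|lborel. indicator {u. \<bar>u\<bar> > \<eta>} u * cmod (\<psi> u)) < \<epsilon>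
      \<and> band_limited \<psi> m N"
    using band_limited_kernel by blast
  define \<epsilon> where "\<epsilon> = e / (\<bar>\<Psi>'\<bar> + 2 * K + 1)"
  have d: "\<bar>\<Psi>'\<bar> + 2 * K + 1 > 0" using K_nonneg by (simp add: add_nonneg_pos)
  have \<epsilon>: "\<epsilon> > 0" using e d by (simp add: \<epsilon>_def)
  obtain \<eta> r0 where \<eta>: "\<eta> > 0"
    and eq: "\<And>\<xi> x r v. contractive_functional \<xi> \<Longrightarrow> norm x \<le> 1 \<Longrightarrow> r \<ge> r0 \<Longrightarrow> \<bar>v\<bar> \<le> \<eta> \<Longrightarrow>
       cmod (orbit_fun \<xi> x (r + v) - orbit_fun \<xi> x r) \<le> \<epsilon>"
    using asymptotic_equicontinuity[OF aa \<epsilon>] by metis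
  obtain \<psi> m N where \<psi>: "integrable lborel \<psi>" "(LINT u|lborel. \<psi> u) = 1" "(LINT u|lborel. cmod (\<psi> u)) \<le> \<Psi>'"
      and tail: "(LINT u|lborel. indicator {u. \<bar>u\<bar> > \<eta>} u * cmod (\<psi> u)) < \<epsilon>"
      and m: "continuous_on UNIV m" "\<forall>s. N < \<bar>s\<bar> \<longrightarrow> m s = 0"
      and \<psi>m: "\<forall>u. \<psi> u = (LINT s|lborel. character (s * u) * m s)"
    using ker[OF \<eta> \<epsilon>] by blast
  have \<Psi>0: "0 \<le> \<Psi>'" using \<psi>(3) by (rule order_trans[rotated]) simp
  show ?thesis
  proof (rule that[of \<psi> m N "K * \<Psi>' + K" r0])
    show "K * \<Psi>' + K \<ge> 0" using K_nonneg \<Psi>0 by simp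
    fix \<xi> :: "'a \<Rightarrow> complex" and x :: 'a and r :: real
    assume \<xi>: "contractive_functional \<xi>" and x: "norm x \<le> 1"
    note f = orbit_fun_measurable[OF \<xi>, of x] orbit_fun_le[OF \<xi> x]
    note f(1)[measurable]
    have [measurable]: "\<psi> \<in> borel_measurable borel" using \<psi>(1) by auto
    have "cmod (LINT u|lborel. orbit_fun \<xi> x (r + u) * \<psi> u) \<le> (LINT u|lborel. K * cmod (\<psi> u))"
    proof (rule order_trans[OF integral_norm_bound integral_mono])
      show i: "integrable lborel (\<lambda>u. K * cmod (\<psi> u))" using \<psi>(1) by simp
      show le: "cmod (orbit_fun \<xi> x (r + u) * \<psi> u) \<le> K * cmod (\<psi> u)" for u
        using f(2) by (simp add: norm_mult mult_right_mono)
      show "integrable lborel (\<lambda>u. cmod (orbit_fun \<xi> x (r + u) * \<psi> u))"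
        by (rule Bochner_Integration.integrable_bound[OF i]) (use le K_nonneg in \<open>auto simp: abs_mult\<close>)
    qed
    also have "\<dots> \<le> K * \<Psi>'" using \<psi>(3) K_nonneg by (simp add: mult_left_mono)
    finally show "cmod (smoothing_defect \<psi> \<xi> x r) \<le> K * \<Psi>' + K"
      using f(2)[of r] by (intro order_trans[OF norm_triangle_ineq4] add_mono)
    assume r: "r \<ge> r0"
    have "cmod (smoothing_defect \<psi> \<xi> x r) \<le> \<epsilon> * \<Psi>' + 2 * K * \<epsilon>"
      by (rule smoothing_error[OF f \<psi> less_imp_le[OF tail]]) (use eq[OF \<xi> x r] \<epsilon> in auto)
    also have "\<dots> \<le> \<epsilon> * (\<bar>\<Psi>'\<bar> + 2 * K + 1)" using \<epsilon> \<Psi>0 by (simp add: algebra_simps)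
    also have "\<dots> = e" using d by (simp add: \<epsilon>_def)
    finally show "cmod (smoothing_defect \<psi> \<xi> x r) \<le> e" .
  qed (use \<psi> m \<psi>m in auto)
qed

lemma integrable_orbit_mult:
  assumes \<xi>: "contractive_functional \<xi>" and x: "norm x \<le> 1" and b: "integrable lborel b"
  shows "integrable lborel (\<lambda>v. orbit_fun \<xi> x (t + v) * b v)"
proof (rule Bochner_Integration.integrable_bound[OF integrable_mult_right[OF b, of "of_real K"]])
  have [measurable]: "b \<in> borel_measurable borel" "orbit_fun \<xi> x \<in> borel_measurable borel"
    using b orbit_fun_measurable[OF \<xi>] by auto
  show "(\<lambda>v. orbit_fun \<xi> x (t + v) * b v) \<in> borel_measurable lborel" by measurable
  show "AE v in lborel. norm (orbit_fun \<xi> x (t + v) * b v) \<le> norm (of_real K * b v)"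
    using orbit_fun_le[OF \<xi> x] K_nonneg by (auto simp: norm_mult intro!: mult_right_mono)
qed

text \<open>
  Smoothing the orbits moves the kernel over to \<open>b\<close>. The smoothing error is small only for late times, but
  early times are met by \<open>b\<close> only far to the left, where it has little mass.
\<close>

lemma spectral_gap_decay:
  assumes aa: "asymptotically_analytic T"
    and closed: "closed (real_spectrum_iA T)" and b: "integrable lborel b"
    and U: "open U" "real_spectrum_iA T \<subseteq> U" "\<And>s. s \<in> U \<Longrightarrow> fourier_L1 b s = 0"
    and e: "e > 0"
  shows "\<exists>t0. \<forall>\<xi> x t. contractive_functional \<xi> \<longrightarrow> norm x \<le> 1 \<longrightarrow> t \<ge> t0 \<longrightarrow>
     cmod (LINT v|lborel. orbit_fun \<xi> x (t + v) * b v) \<le> e"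
proof -
  define B where "B = (LINT v|lborel. cmod (b v))"
  have B: "B \<ge> 0" by (simp add: B_def)
  have [measurable]: "b \<in> borel_measurable borel" using b by auto
  define \<rho> where "\<rho> = e / 3 / (B + 1)"
  have \<rho>: "\<rho> > 0" using e B by (simp add: \<rho>_def)
  have \<rho>B: "\<rho> * B \<le> e / 3"
  proof -
    have "\<rho> * B \<le> \<rho> * (B + 1)" using \<rho> by simp
    moreover have h: "B + 1 \<noteq> 0" using B by linarith
    have "\<rho> * (B + 1) = e / 3"
      by (rule iffD1[OF nonzero_eq_divide_eq[OF h] \<rho>_def])
    ultimately show ?thesis by simp
  qed
  obtain \<psi> m N \<Psi> r0 where \<psi>i: "integrable lborel \<psi>"
    and m: "continuous_on UNIV m" "\<And>s. N < \<bar>s\<bar> \<Longrightarrow> m s = 0"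
    and \<psi>: "\<And>u. \<psi> u = (LINT s|lborel. character (s * u) * m s)"
    and \<Psi>: "\<Psi> \<ge> 0" "\<And>\<xi> x r. contractive_functional \<xi> \<Longrightarrow> norm x \<le> 1 \<Longrightarrow>
       cmod (smoothing_defect \<psi> \<xi> x r) \<le> \<Psi>"
    and sm: "\<And>\<xi> x r. contractive_functional \<xi> \<Longrightarrow> norm x \<le> 1 \<Longrightarrow> r \<ge> r0 \<Longrightarrow>
       cmod (smoothing_defect \<psi> \<xi> x r) \<le> \<rho>"
    by (rule orbit_smoothing[OF aa \<rho>]) blast
  have [measurable]: "\<psi> \<in> borel_measurable borel" using \<psi>i by auto
  have e3: "e / 3 > 0" using e by simp
  obtain t1 where t1: "\<forall>\<xi> x t. contractive_functional \<xi> \<longrightarrow> norm x \<le> 1 \<longrightarrow> t \<ge> t1 \<longrightarrow>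
     cmod (LINT w|lborel. orbit_fun \<xi> x (t + w) * (LINT v|lborel. b v * \<psi> (w - v))) \<le> e / 3"
    using band_limited_decay[OF closed b U \<psi>i m \<psi> e3] by (rule exE)
  have bi: "integrable lborel (\<lambda>v. indicator {..<a} v * cmod (b v))" for a :: real
    by (rule Bochner_Integration.integrable_bound[OF integrable_norm[OF b]]) (auto simp: indicator_def)
  have "((\<lambda>t. LINT v|lborel. indicator {..<r0 - t} v * cmod (b v)) \<longlongrightarrow> (LINT v|(lborel::real measure). (0::real))) at_top"
  proof (rule integral_dominated_convergence_at_top[where w="\<lambda>v. cmod (b v)"])
    show "AE v in lborel. ((\<lambda>t. indicator {..<r0 - t} v * cmod (b v)) \<longlongrightarrow> 0) at_top"
    proof (rule AE_I2)
      fix v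
      have "\<forall>\<^sub>F t in at_top. indicator {..<r0 - t} v * cmod (b v) = 0"
        using eventually_ge_at_top[of "r0 - v"] by eventually_elim (simp add: indicator_def)
      then show "((\<lambda>t. indicator {..<r0 - t} v * cmod (b v)) \<longlongrightarrow> 0) at_top" by (rule tendsto_eventually)
    qed
  qed (use b in \<open>auto simp: indicator_def intro!: always_eventually\<close>)
  then have "\<forall>\<^sub>F t in at_top. (LINT v|lborel. indicator {..<r0 - t} v * cmod (b v)) < e / 3 / (\<Psi> + 1)"
    by (rule order_tendstoD(2)) (use e \<Psi> in simp)
  then obtain t2 where t2: "\<And>t. t \<ge> t2 \<Longrightarrow> (LINT v|lborel. indicator {..<r0 - t} v * cmod (b v)) < e / 3 / (\<Psi> + 1)"
    by (auto simp: eventually_at_top_linorder)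
  show ?thesis
  proof (intro exI[of _ "max t1 t2"] allI impI)
    fix \<xi> :: "'a \<Rightarrow> complex" and x :: 'a and t :: real
    assume \<xi>: "contractive_functional \<xi>" and x: "norm x \<le> 1" and t: "t \<ge> max t1 t2"
    let ?f = "orbit_fun \<xi> x"
    note f = orbit_fun_measurable[OF \<xi>, of x] orbit_fun_le[OF \<xi> x]
    note f(1)[measurable]
    define E where "E r = (LINT u|lborel. ?f (r + u) * \<psi> u) - ?f r" for r
    have Em [measurable]: "E \<in> borel_measurable borel" unfolding E_def by measurable
    have E1: "cmod (E r) \<le> \<Psi>" for r unfolding E_def by (rule \<Psi>(2)[OF \<xi> x])
    have E2: "cmod (E r) \<le> \<rho>" if "r \<ge> r0" for r unfolding E_def by (rule sm[OF \<xi> x that])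
    have Ei: "integrable lborel (\<lambda>v. b v * E (t + v))"
      by (rule Bochner_Integration.integrable_bound[OF integrable_mult_right[OF b, of "of_real \<Psi>"]])
        (use E1 \<Psi>(1) in \<open>auto simp: norm_mult mult.commute[of "cmod (b _)"] intro!: mult_right_mono\<close>)
    have fi: "integrable lborel (\<lambda>v. b v * ?f (t + v))"
      using integrable_orbit_mult[OF \<xi> x b, of t] by (simp only: mult.commute)
    have "(LINT w|lborel. ?f (t + w) * (LINT v|lborel. b v * \<psi> (w - v))) = (LINT v|lborel. b v * (LINT u|lborel. ?f (t + (v + u)) * \<psi> u))"
      by (rule convolution_Fubini(2)[OF sigma_finite_lborel _ b \<psi>i _ f(2)]) auto
    also have "\<dots> = (LINT v|lborel. b v * ?f (t + v) + b v * E (t + v))"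
      by (simp add: E_def algebra_simps)
    also have "\<dots> = (LINT v|lborel. b v * ?f (t + v)) + (LINT v|lborel. b v * E (t + v))"
      by (rule Bochner_Integration.integral_add[OF fi Ei])
    finally have eqn: "(LINT v|lborel. ?f (t + v) * b v) = (LINT w|lborel. ?f (t + w) * (LINT v|lborel. b v * \<psi> (w - v))) - (LINT v|lborel. b v * E (t + v))"
      by (simp add: mult.commute)
    have "cmod (LINT v|lborel. b v * E (t + v)) \<le> (LINT v|lborel. cmod (b v * E (t + v)))"
      by (rule integral_norm_bound)
    also have "\<dots> \<le> (LINT v|lborel. \<rho> * cmod (b v) + \<Psi> * (indicator {..<r0 - t} v * cmod (b v)))"
    proof (rule integral_mono)
      show "integrable lborel (\<lambda>v. \<rho> * cmod (b v) + \<Psi> * (indicator {..<r0 - t} v * cmod (b v)))"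
        by (intro Bochner_Integration.integrable_add integrable_mult_right integrable_norm b bi)
      fix v
      show "cmod (b v * E (t + v)) \<le> \<rho> * cmod (b v) + \<Psi> * (indicator {..<r0 - t} v * cmod (b v))"
      proof (cases "v < r0 - t")
        case True
        have "cmod (b v * E (t + v)) \<le> \<Psi> * cmod (b v)"
          using E1[of "t + v"] by (simp add: norm_mult mult.commute[of _ "cmod (E _)"] mult_right_mono)
        then show ?thesis using True \<rho> by (simp add: add_increasing)
      next
        case False
        then have "cmod (E (t + v)) \<le> \<rho>" by (intro E2) simp
        then show ?thesis using False by (simp add: norm_mult mult.commute[of _ "cmod (E _)"] mult_right_mono)
      qed
    qed (rule integrable_norm[OF Ei])
    also have "\<dots> = \<rho> * B + \<Psi> * (LINT v|lborel. indicator {..<r0 - t} v * cmod (b v))"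
      unfolding B_def by (subst Bochner_Integration.integral_add) (use b bi in auto)
    also have "\<dots> \<le> e / 3 + e / 3"
    proof (rule add_mono[OF \<rho>B])
      have "\<Psi> * (LINT v|lborel. indicator {..<r0 - t} v * cmod (b v)) \<le> (\<Psi> + 1) * (e / 3 / (\<Psi> + 1))"
        using t2[of t] t \<Psi>(1) by (intro mult_mono) (auto intro!: integral_nonneg_AE)
      moreover have h: "\<Psi> + 1 \<noteq> 0" using \<Psi>(1) by linarith
      have "(\<Psi> + 1) * (e / 3 / (\<Psi> + 1)) = e / 3"
        using iffD1[OF nonzero_eq_divide_eq[OF h] refl, of "e / 3"] by (simp only: mult.commute)
      ultimately show "\<Psi> * (LINT v|lborel. indicator {..<r0 - t} v * cmod (b v)) \<le> e / 3" by (simp only:)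
    qed
    finally have "cmod (LINT v|lborel. b v * E (t + v)) \<le> e / 3 + e / 3" .
    moreover have "cmod (LINT w|lborel. ?f (t + w) * (LINT v|lborel. b v * \<psi> (w - v))) \<le> e / 3"
      using t1 \<xi> x t by simp
    ultimately have "cmod (LINT w|lborel. ?f (t + w) * (LINT v|lborel. b v * \<psi> (w - v))) + cmod (LINT v|lborel. b v * E (t + v)) \<le> e"
      by linarith
    then show "cmod (LINT v|lborel. ?f (t + v) * b v) \<le> e"
      unfolding eqn by (rule order_trans[OF norm_triangle_ineq4])
  qed
qed

end

section \<open>Decay for measures with vanishing Fourier transform\<close>

lemma norm_blinfun_le_functionals:
  fixes B :: "'a::complex_normed_vector \<Rightarrow>\<^sub>L 'a"
  assumes "\<And>\<xi> x. contractive_functional \<xi> \<Longrightarrow> norm x \<le> 1 \<Longrightarrow> cmod (\<xi> (B x)) \<le> e"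
  shows "norm B \<le> e"
proof (rule norm_blinfun_bound)
  have le: "norm (B x) \<le> e" if "norm x \<le> 1" for x
  proof (rule norm_le_functionals)
    fix \<xi> :: "'a \<Rightarrow> complex" assume "contractive_functional \<xi>"
    then show "cmod (\<xi> (B x)) \<le> e" using that by (rule assms)
  qed
  show "0 \<le> e" using le[of 0] by simp
  fix x
  show "norm (B x) \<le> e * norm x"
  proof (cases "x = 0")
    case False
    have "norm (B (x /\<^sub>R norm x)) \<le> e" by (rule le) (simp add: False)
    then show ?thesis using False by (simp add: blinfun.scaleR_right field_simps)
  qed simp
qed

context bounded_C0_semigroup
begin

lemma functional_complex_measure_integral:
  assumes p: "\<And>p. p \<in> {p1, p2, p3, p4} \<Longrightarrow> finite_measure p \<and> sets p = sets borel_Rplus"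
    and v: "complex_measure_integral borel_Rplus \<mu> (\<lambda>t. T t x) =
        vector_integral p1 (\<lambda>t. T t x) - vector_integral p2 (\<lambda>t. T t x)
        + \<i> *\<^sub>C (vector_integral p3 (\<lambda>t. T t x) - vector_integral p4 (\<lambda>t. T t x))"
    and \<xi>: "contractive_functional \<xi>"
  shows "\<xi> (complex_measure_integral borel_Rplus \<mu> (\<lambda>t. T t x)) =
     (LINT t|p1. \<xi> (T t x)) - (LINT t|p2. \<xi> (T t x)) + \<i> * ((LINT t|p3. \<xi> (T t x)) - (LINT t|p4. \<xi> (T t x)))"
proof -
  note \<xi>D = contractive_functionalD[OF \<xi>]
  have "\<xi> (vector_integral p (\<lambda>t. T t x)) = (LINT t|p. \<xi> (T t x))" if "p \<in> {p1, p2, p3, p4}" for p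
    using assms(1)[OF that] by (intro vector_integral_functional[OF _ _ continuous_orbit norm_T \<xi>]) auto
  then show ?thesis unfolding v by (simp add: \<xi>D(1,2,5))
qed

lemma measurable_orbit_halfline:
  assumes p: "sets p = sets borel_Rplus" and \<xi>: "contractive_functional \<xi>"
  shows "(\<lambda>t. \<xi> (T t x)) \<in> borel_measurable p"
proof -
  have "(\<lambda>t. \<xi> (T t x)) \<in> borel_measurable borel_Rplus"
    by (rule borel_measurable_continuous_on_restrict[OF continuous_functional_orbit[OF \<xi>]])
  then show ?thesis by (simp add: measurable_cong_sets[OF p refl])
qed

end

lemma finite_measure_integral_bound:
  fixes h :: "'b \<Rightarrow> complex"
  assumes p: "finite_measure p" and h: "h \<in> borel_measurable p" "\<And>t. t \<in> space p \<Longrightarrow> cmod (h t) \<le> C"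
  shows "integrable p h" "cmod (LINT t|p. h t) \<le> C * measure p (space p)"
proof -
  interpret finite_measure p by fact
  show i: "integrable p h"
    by (rule integrable_const_bound[of _ C]) (use h in auto)
  have "cmod (LINT t|p. h t) \<le> (LINT t|p. cmod (h t))" by (rule integral_norm_bound)
  also have "\<dots> \<le> (LINT t|p. C)"
    by (rule integral_mono) (use i h in auto)
  finally show "cmod (LINT t|p. h t) \<le> C * measure p (space p)" by (simp add: mult.commute)
qed

lemma space_Rplus: "sets p = sets borel_Rplus \<Longrightarrow> space p = {0..}"
  by (drule sets_eq_imp_space_eq) (simp add: space_restrict_space)

lemma id_measurable_Rplus: "sets p = sets borel_Rplus \<Longrightarrow> (\<lambda>v. v) \<in> borel_measurable p"
  by (simp add: measurable_cong_sets[OF _ refl, of p borel_Rplus] measurable_restrict_space1)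

context bounded_C0_semigroup
begin

text \<open>
  Functionals reduce linearity and boundedness of the integral to the scalar case.
\<close>

lemma measure_calculus_apply:
  assumes \<mu>: "complex_measure borel_Rplus \<mu>"
  shows "measure_calculus T \<mu> x = complex_measure_integral borel_Rplus \<mu> (\<lambda>t. T t x)"
proof -
  obtain p1 p2 p3 p4 where p': "\<forall>p\<in>{p1, p2, p3, p4}. finite_measure p \<and> sets p = sets borel_Rplus"
    and v': "\<forall>f :: real \<Rightarrow> 'a. complex_measure_integral borel_Rplus \<mu> f =
        vector_integral p1 f - vector_integral p2 f + \<i> *\<^sub>C (vector_integral p3 f - vector_integral p4 f)"
    using complex_measure_finite_parts[OF \<mu>, where 'b='a] by (elim exE conjE) (rule that)
  note p = bspec[OF p'] and v = spec[OF v']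
  define \<Phi> where "\<Phi> x = complex_measure_integral borel_Rplus \<mu> (\<lambda>t. T t x)" for x
  have \<xi>\<Phi>: "\<xi> (\<Phi> x) = (LINT t|p1. \<xi> (T t x)) - (LINT t|p2. \<xi> (T t x)) + \<i> * ((LINT t|p3. \<xi> (T t x)) - (LINT t|p4. \<xi> (T t x)))"
    if "contractive_functional \<xi>" for \<xi> x
    unfolding \<Phi>_def by (rule functional_complex_measure_integral[OF p v that])
  have int: "integrable p (\<lambda>t. \<xi> (T t x))" "cmod (LINT t|p. \<xi> (T t x)) \<le> K * norm x * measure p (space p)"
    if "contractive_functional \<xi>" "p \<in> {p1, p2, p3, p4}" for \<xi> x p
  proof -
    have p: "finite_measure p" "sets p = sets borel_Rplus" using p[OF that(2)] by auto
    have "cmod (\<xi> (T t x)) \<le> K * norm x" if "t \<in> space p" for t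
      using order_trans[OF contractive_functionalD(3)[OF \<open>contractive_functional \<xi>\<close>] norm_T[of t x]] that space_Rplus[OF p(2)] by simp
    then show "integrable p (\<lambda>t. \<xi> (T t x))" "cmod (LINT t|p. \<xi> (T t x)) \<le> K * norm x * measure p (space p)"
      using finite_measure_integral_bound[OF p(1) measurable_orbit_halfline[OF p(2) that(1)]] by blast+
  qed
  have "bounded_linear \<Phi>"
  proof (rule bounded_linear_intro)
    fix x y :: 'a and r :: real
    show "\<Phi> (x + y) = \<Phi> x + \<Phi> y"
    proof (rule eq_functionals)
      fix \<xi> :: "'a \<Rightarrow> complex" assume \<xi>: "contractive_functional \<xi>"
      note D = contractive_functionalD[OF \<xi>]
      have "(LINT t|p. \<xi> (T t (x + y))) = (LINT t|p. \<xi> (T t x)) + (LINT t|p. \<xi> (T t y))" if "p \<in> {p1, p2, p3, p4}" for p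
        using int(1)[OF \<xi> that] by (simp add: blinfun.add_right D(1))
      then show "\<xi> (\<Phi> (x + y)) = \<xi> (\<Phi> x + \<Phi> y)"
        unfolding D(1)[of "\<Phi> x" "\<Phi> y"] \<xi>\<Phi>[OF \<xi>] by (simp add: algebra_simps)
    qed
    show "\<Phi> (r *\<^sub>R x) = r *\<^sub>R \<Phi> x"
    proof (rule eq_functionals)
      fix \<xi> :: "'a \<Rightarrow> complex" assume \<xi>: "contractive_functional \<xi>"
      note D = contractive_functionalD[OF \<xi>]
      have s: "\<xi> (r *\<^sub>R z) = of_real r * \<xi> z" for z
        using D(2)[of "of_real r" z] by (simp add: scaleC_of_real)
      have "(LINT t|p. \<xi> (T t (r *\<^sub>R x))) = of_real r * (LINT t|p. \<xi> (T t x))" for p :: "real measure"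
        by (simp add: blinfun.scaleR_right s)
      then show "\<xi> (\<Phi> (r *\<^sub>R x)) = \<xi> (r *\<^sub>R \<Phi> x)"
        unfolding s[of "\<Phi> x"] \<xi>\<Phi>[OF \<xi>] by (simp add: algebra_simps)
    qed
    show "norm (\<Phi> x) \<le> norm x * (K * (measure p1 (space p1) + measure p2 (space p2) + (measure p3 (space p3) + measure p4 (space p4))))"
    proof (rule norm_le_functionals)
      fix \<xi> :: "'a \<Rightarrow> complex" assume \<xi>: "contractive_functional \<xi>"
      have "cmod (\<xi> (\<Phi> x)) \<le> (cmod (LINT t|p1. \<xi> (T t x)) + cmod (LINT t|p2. \<xi> (T t x))) + (cmod (LINT t|p3. \<xi> (T t x)) + cmod (LINT t|p4. \<xi> (T t x)))"
        unfolding \<xi>\<Phi>[OF \<xi>]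
        by (rule order_trans[OF norm_triangle_ineq]) (simp add: norm_mult norm_triangle_ineq4 add_mono)
      also have "\<dots> \<le> (K * norm x * measure p1 (space p1) + K * norm x * measure p2 (space p2)) + (K * norm x * measure p3 (space p3) + K * norm x * measure p4 (space p4))"
        by (intro add_mono int(2)[OF \<xi>]) auto
      finally show "cmod (\<xi> (\<Phi> x)) \<le> norm x * (K * (measure p1 (space p1) + measure p2 (space p2) + (measure p3 (space p3) + measure p4 (space p4))))"
        by (simp add: algebra_simps)
    qed
  qed
  then show ?thesis
    unfolding measure_calculus_def using bounded_linear_Blinfun_apply[of \<Phi>] by (simp add: \<Phi>_def[abs_def])
qed

text \<open>
  All times \<open>t + s\<close> are late, because the measure lives on the half-line; hence the smoothing error is
  uniformly small.
\<close>

lemma measure_smoothing: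
  assumes p: "finite_measure p" "sets p = sets borel_Rplus" and \<psi>: "integrable lborel \<psi>"
    and \<xi>: "contractive_functional \<xi>" and x: "norm x \<le> 1" and t: "t \<ge> r0"
    and sm: "\<And>r. r \<ge> r0 \<Longrightarrow> cmod (smoothing_defect \<psi> \<xi> x r) \<le> \<rho>"
  shows "cmod ((LINT w|lborel. orbit_fun \<xi> x (t + w) * (LINT v|p. 1 * \<psi> (w - v))) - (LINT s|p. orbit_fun \<xi> x (t + s)))
     \<le> \<rho> * measure p (space p)"
proof -
  interpret finite_measure p by fact
  let ?f = "orbit_fun \<xi> x"
  note id = id_measurable_Rplus[OF p(2)]
  note id [measurable]
  note f = orbit_fun_measurable[OF \<xi>, of x] orbit_fun_le[OF \<xi> x]
  have [measurable]: "?f \<in> borel_measurable borel" "\<psi> \<in> borel_measurable borel" using f \<psi> by auto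
  define G where "G r = (LINT u|lborel. ?f (r + u) * \<psi> u)" for r
  have [measurable]: "G \<in> borel_measurable borel" unfolding G_def by measurable
  have Em: "(\<lambda>s. G (t + s) - ?f (t + s)) \<in> borel_measurable p" by measurable
  have Eb: "cmod (G (t + s) - ?f (t + s)) \<le> \<rho>" if "s \<in> space p" for s
    unfolding G_def using that t space_Rplus[OF p(2)] by (intro sm) auto
  have fi: "integrable p (\<lambda>s. ?f (t + s))"
    by (rule finite_measure_integral_bound(1)[OF p(1) _ f(2)]) measurable
  have "(LINT w|lborel. ?f (t + w) * (LINT v|p. 1 * \<psi> (w - v))) = (LINT v|p. 1 * (LINT u|lborel. ?f (t + (v + u)) * \<psi> u))"
    by (rule convolution_Fubini(2)[OF _ id _ \<psi> _ f(2)]) (auto intro: sigma_finite_measure_axioms)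
  also have "\<dots> = (LINT v|p. (G (t + v) - ?f (t + v)) + ?f (t + v))" by (simp add: G_def add.assoc)
  also have "\<dots> = (LINT v|p. G (t + v) - ?f (t + v)) + (LINT v|p. ?f (t + v))"
    by (rule Bochner_Integration.integral_add[OF finite_measure_integral_bound(1)[OF p(1) Em Eb] fi])
  finally show ?thesis using finite_measure_integral_bound(2)[OF p(1) Em Eb] by simp
qed

end

theorem theorem3p4:
  fixes T :: "real \<Rightarrow> 'a::complex_banach \<Rightarrow>\<^sub>L 'a"
    and \<mu> :: "real set \<Rightarrow> complex"
  assumes "C0_semigroup T"
    and "bounded_semigroup T"
    and "asymptotically_analytic T"
    and "spectral_synthesis (real_spectrum_iA T)"
    and "complex_measure borel_Rplus \<mu>"
    and "\<forall>s\<in>real_spectrum_iA T. fourier_measure \<mu> s = 0"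
  shows "((\<lambda>t. norm (T t o\<^sub>L measure_calculus T \<mu>)) \<longlongrightarrow> 0) at_top"
proof -
  obtain K where K: "\<And>t. t \<ge> 0 \<Longrightarrow> norm (T t) \<le> K" using assms(2) by (auto simp: bounded_semigroup_def)
  interpret bounded_C0_semigroup T K by standard (use assms(1) K in auto)
  obtain p1 p2 p3 p4 where p': "\<forall>p\<in>{p1, p2, p3, p4}. finite_measure p \<and> sets p = sets borel_Rplus"
    and v': "\<forall>f :: real \<Rightarrow> 'a. complex_measure_integral borel_Rplus \<mu> f =
        vector_integral p1 f - vector_integral p2 f + \<i> *\<^sub>C (vector_integral p3 f - vector_integral p4 f)"
    and s': "\<forall>g :: real \<Rightarrow> complex. complex_measure_integral borel_Rplus \<mu> g =
        (LINT t|p1. g t) - (LINT t|p2. g t) + \<i> * ((LINT t|p3. g t) - (LINT t|p4. g t))"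
    using complex_measure_finite_parts[OF assms(5), where 'b='a] by (elim exE conjE) (rule that)
  note p = bspec[OF p'] and v = spec[OF v'] and s = spec[OF s']
  define V where "V = (measure p1 (space p1) + measure p2 (space p2)) + (measure p3 (space p3) + measure p4 (space p4))"
  have V: "V \<ge> 0" by (simp add: V_def)
  have comb: "cmod (a1 - a2 + \<i> * (a3 - a4) - (b1 - b2 + \<i> * (b3 - b4))) \<le> (cmod (a1 - b1) + cmod (a2 - b2)) + (cmod (a3 - b3) + cmod (a4 - b4))"
    for a1 a2 a3 a4 b1 b2 b3 b4
  proof -
    have "a1 - a2 + \<i> * (a3 - a4) - (b1 - b2 + \<i> * (b3 - b4)) = ((a1 - b1) - (a2 - b2)) + \<i> * ((a3 - b3) - (a4 - b4))"
      by (simp add: algebra_simps)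
    then show ?thesis
      by (simp only:) (rule order_trans[OF norm_triangle_ineq], simp add: norm_mult norm_triangle_ineq4 add_mono del: diff_diff_eq2)
  qed
  have "\<exists>t0. \<forall>t\<ge>t0. norm (T t o\<^sub>L measure_calculus T \<mu>) \<le> \<epsilon>" if \<epsilon>: "\<epsilon> > 0" for \<epsilon>
  proof -
    \<comment> \<open>One third of \<open>\<epsilon>\<close> each for the smoothing, for the approximation of \<open>\<psi> * \<mu>\<close>, and for the decay of the approximation.\<close>
    define \<rho> where "\<rho> = \<epsilon> / 3 / (V + 1)"
    have \<rho>: "\<rho> > 0" using \<epsilon> V by (simp add: \<rho>_def)
    have h: "V + 1 \<noteq> 0" "K + 1 \<noteq> 0" using V K_nonneg by linarith+
    have \<rho>V: "\<rho> * V \<le> \<epsilon> / 3"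
    proof -
      have "\<rho> * V \<le> \<rho> * (V + 1)" using \<rho> by simp
      also have "\<dots> = \<epsilon> / 3" by (rule iffD1[OF nonzero_eq_divide_eq[OF h(1)] \<rho>_def])
      finally show ?thesis .
    qed
    obtain \<psi> m N \<Psi> r0 where \<psi>: "integrable lborel \<psi>"
      and sm: "\<And>\<xi> x r. contractive_functional \<xi> \<Longrightarrow> norm x \<le> 1 \<Longrightarrow> r \<ge> r0 \<Longrightarrow>
        cmod (smoothing_defect \<psi> \<xi> x r) \<le> \<rho>"
      by (rule orbit_smoothing[OF assms(3) \<rho>]) blast
    define a where "a q w = (LINT v|q. 1 * \<psi> (w - v))" for q w
    have ai: "integrable lborel (a q)"
      and af: "fourier_L1 (a q) s = (LINT t|q. cnj_character (s * t)) * fourier_L1 \<psi> s"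
      if "q \<in> {p1, p2, p3, p4}" for q s
    proof -
      interpret finite_measure q using p[OF that] by simp
      have q: "sigma_finite_measure q" "(\<lambda>v. v) \<in> borel_measurable q" "integrable q (\<lambda>v. 1 :: complex)"
        using p[OF that] sigma_finite_measure_axioms by (auto intro: id_measurable_Rplus)
      show "integrable lborel (a q)" unfolding a_def[abs_def] by (rule convolution_Fubini(1)[OF q \<psi>])
      show "fourier_L1 (a q) s = (LINT t|q. cnj_character (s * t)) * fourier_L1 \<psi> s"
        unfolding a_def[abs_def] using fourier_L1_convolution[OF q \<psi>, of s] by simp
    qed
    have aip: "integrable lborel (a p1)" "integrable lborel (a p2)" "integrable lborel (a p3)" "integrable lborel (a p4)"
      using ai by auto
    \<comment> \<open>The function \<open>\<psi> * \<mu>\<close>.\<close>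
    define A where "A w = a p1 w - a p2 w + \<i> * (a p3 w - a p4 w)" for w
    have Ai: "integrable lborel A"
      unfolding A_def by (intro Bochner_Integration.integrable_add Bochner_Integration.integrable_diff integrable_mult_right aip)
    have pairing: "(LINT w|lborel. g w * A w) = (LINT w|lborel. g w * a p1 w) - (LINT w|lborel. g w * a p2 w)
        + \<i> * ((LINT w|lborel. g w * a p3 w) - (LINT w|lborel. g w * a p4 w))"
      if g: "\<And>b. integrable lborel b \<Longrightarrow> integrable lborel (\<lambda>w. g w * b w)" for g
    proof -
      note gi = aip[THEN g]
      have "(LINT w|lborel. g w * A w) = (LINT w|lborel. (g w * a p1 w - g w * a p2 w) + \<i> * (g w * a p3 w - g w * a p4 w))"
        by (simp add: A_def algebra_simps)
      also have "\<dots> = (LINT w|lborel. g w * a p1 w - g w * a p2 w) + (LINT w|lborel. \<i> * (g w * a p3 w - g w * a p4 w))"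
        by (intro Bochner_Integration.integral_add Bochner_Integration.integrable_diff integrable_mult_right gi)
      finally show ?thesis by (simp add: Bochner_Integration.integral_diff gi)
    qed
    have "fourier_L1 A s = 0" if "s \<in> real_spectrum_iA T" for s
    proof -
      have "integrable lborel (\<lambda>w. cnj_character (s * w) * b w)" if b: "integrable lborel b" for b
        by (rule Bochner_Integration.integrable_bound[OF b]) (use b in \<open>auto simp: norm_mult norm_exp_eq_Re\<close>)
      then have "fourier_L1 A s = fourier_L1 (a p1) s - fourier_L1 (a p2) s + \<i> * (fourier_L1 (a p3) s - fourier_L1 (a p4) s)"
        unfolding fourier_L1_def by (rule pairing)
      also have "\<dots> = fourier_measure \<mu> s * fourier_L1 \<psi> s"
        unfolding fourier_measure_def s by (simp add: af algebra_simps)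
      also have "\<dots> = 0" using assms(6) that by simp
      finally show ?thesis .
    qed
    moreover have "\<epsilon> / 3 / (K + 1) > 0" using \<epsilon> K_nonneg by simp
    ultimately have "\<exists>b. integrable lborel b \<and> (\<exists>U. open U \<and> real_spectrum_iA T \<subseteq> U \<and> (\<forall>s\<in>U. fourier_L1 b s = 0))
        \<and> (LINT t|lborel. cmod (A t - b t)) < \<epsilon> / 3 / (K + 1)"
      using assms(4) Ai unfolding spectral_synthesis_def by simp
    then obtain b U where b: "integrable lborel b" and U: "open U" "real_spectrum_iA T \<subseteq> U" "\<And>s. s \<in> U \<Longrightarrow> fourier_L1 b s = 0"
      and ab: "(LINT t|lborel. cmod (A t - b t)) < \<epsilon> / 3 / (K + 1)"
      by (elim exE conjE) (rule that, auto)
    have closed: "closed (real_spectrum_iA T)" using assms(4) by (simp add: spectral_synthesis_def)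
    have \<epsilon>3: "\<epsilon> / 3 > 0" using \<epsilon> by simp
    obtain t1 where t1: "\<forall>\<xi> x t. contractive_functional \<xi> \<longrightarrow> norm x \<le> 1 \<longrightarrow> t \<ge> t1 \<longrightarrow>
       cmod (LINT v|lborel. orbit_fun \<xi> x (t + v) * b v) \<le> \<epsilon> / 3"
      using spectral_gap_decay[OF assms(3) closed b U \<epsilon>3] by (rule exE)
    show ?thesis
    proof (intro exI[of _ "max 0 (max r0 t1)"] allI impI)
      fix t assume t: "t \<ge> max 0 (max r0 t1)"
      show "norm (T t o\<^sub>L measure_calculus T \<mu>) \<le> \<epsilon>"
      proof (rule norm_blinfun_le_functionals)
        fix \<xi> :: "'a \<Rightarrow> complex" and x :: 'a assume \<xi>: "contractive_functional \<xi>" and x: "norm x \<le> 1"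
        let ?f = "\<lambda>s. orbit_fun \<xi> x (t + s)"
        note D = contractive_functionalD[OF \<xi>]
        have tnn: "t \<ge> 0" using t by simp
        define \<Phi> where "\<Phi> = complex_measure_integral borel_Rplus \<mu> (\<lambda>s. T s x)"
        \<comment> \<open>The functional \<open>\<xi> \<circ> T t\<close>, rescaled so that it is contractive.\<close>
        define \<eta> where "\<eta> y = \<xi> (T t y) / of_real (K + 1)" for y
        have c\<eta>: "contractive_functional \<eta>"
          unfolding contractive_functional_def
        proof (intro conjI allI)
          fix y z :: 'a and c
          show "\<eta> (y + z) = \<eta> y + \<eta> z" by (simp add: \<eta>_def blinfun.add_right D(1) add_divide_distrib)
          show "\<eta> (c *\<^sub>C y) = c * \<eta> y" by (simp add: \<eta>_def T_complex[OF tnn] D(2))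
          have "cmod (\<xi> (T t y)) \<le> K * norm y" by (rule order_trans[OF D(3) norm_T[OF tnn]])
          also have "\<dots> \<le> norm y * (K + 1)" by (simp add: algebra_simps)
          finally have "cmod (\<xi> (T t y)) / (K + 1) \<le> norm y"
            using K_nonneg by (simp add: pos_divide_le_eq)
          moreover have "cmod (of_real (K + 1)) = K + 1" using K_nonneg unfolding norm_of_real by simp
          ultimately show "cmod (\<eta> y) \<le> norm y" unfolding \<eta>_def norm_divide by simp
        qed
        have q: "(LINT s|q. \<eta> (T s x)) = (LINT s|q. ?f s) / of_real (K + 1)" if "q \<in> {p1, p2, p3, p4}" for q
        proof -
          have "(LINT s|q. \<eta> (T s x)) = (LINT s|q. ?f s / of_real (K + 1))"
          proof (rule Bochner_Integration.integral_cong[OF refl])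
            fix s assume "s \<in> space q"
            then have "s \<ge> 0" using p[OF that] space_Rplus[of q] by simp
            then show "\<eta> (T s x) = ?f s / of_real (K + 1)"
              using tnn T_add[OF tnn] by (simp add: \<eta>_def orbit_fun_def)
          qed
          then show ?thesis by simp
        qed
        let ?I = "\<lambda>q. LINT s|q. ?f s"
        have "\<xi> (T t \<Phi>) / of_real (K + 1) = (?I p1 - ?I p2 + \<i> * (?I p3 - ?I p4)) / of_real (K + 1)"
          using functional_complex_measure_integral[OF p v c\<eta>, of x, folded \<Phi>_def]
          by (simp add: q \<eta>_def[of \<Phi>] add_divide_distrib diff_divide_distrib right_diff_distrib)
        moreover have "complex_of_real (K + 1) \<noteq> 0" using h(2) by (simp only: of_real_eq_0_iff not_False_eq_True)
        ultimately have eq: "\<xi> (T t \<Phi>) = ?I p1 - ?I p2 + \<i> * (?I p3 - ?I p4)"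
          by (simp only: divide_cancel_right) simp
        let ?J = "\<lambda>q. LINT w|lborel. ?f w * a q w"
        have JI: "cmod (?J q - ?I q) \<le> \<rho> * measure q (space q)" if "q \<in> {p1, p2, p3, p4}" for q
          unfolding a_def using t p[OF that] by (intro measure_smoothing[OF _ _ \<psi> \<xi> x _ sm[OF \<xi> x]]) auto
        have fA: "(LINT w|lborel. ?f w * A w) = ?J p1 - ?J p2 + \<i> * (?J p3 - ?J p4)"
          by (rule pairing) (rule integrable_orbit_mult[OF \<xi> x])
        have "cmod ((LINT w|lborel. ?f w * A w) - \<xi> (T t \<Phi>)) \<le> (\<rho> * measure p1 (space p1) + \<rho> * measure p2 (space p2)) + (\<rho> * measure p3 (space p3) + \<rho> * measure p4 (space p4))"
          unfolding fA eq by (rule order_trans[OF comb]) (intro add_mono JI; simp)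
        also have "\<dots> = \<rho> * V" by (simp add: V_def algebra_simps)
        finally have 1: "cmod ((LINT w|lborel. ?f w * A w) - \<xi> (T t \<Phi>)) \<le> \<epsilon> / 3" using \<rho>V by simp
        have Ab: "integrable lborel (\<lambda>w. A w - b w)" using Ai b by (rule Bochner_Integration.integrable_diff)
        have "(LINT w|lborel. ?f w * A w) - (LINT w|lborel. ?f w * b w) = (LINT w|lborel. ?f w * (A w - b w))"
          by (simp add: right_diff_distrib Bochner_Integration.integral_diff integrable_orbit_mult[OF \<xi> x] Ai b)
        also have "cmod \<dots> \<le> (LINT w|lborel. K * cmod (A w - b w))"
        proof (rule order_trans[OF integral_norm_bound integral_mono])
          show "integrable lborel (\<lambda>w. cmod (?f w * (A w - b w)))" by (rule integrable_norm[OF integrable_orbit_mult[OF \<xi> x Ab]])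
          show "integrable lborel (\<lambda>w. K * cmod (A w - b w))" by (rule integrable_mult_right[OF integrable_norm[OF Ab]])
          show "cmod (?f w * (A w - b w)) \<le> K * cmod (A w - b w)" for w
            using orbit_fun_le[OF \<xi> x] by (simp add: norm_mult mult_right_mono)
        qed
        also have "\<dots> = K * (LINT w|lborel. cmod (A w - b w))" by simp
        also have "\<dots> \<le> K * (\<epsilon> / 3 / (K + 1))" using ab K_nonneg by (intro mult_left_mono) auto
        also have "\<dots> \<le> (K + 1) * (\<epsilon> / 3 / (K + 1))" using \<epsilon> K_nonneg by (intro mult_right_mono) auto
        also have "\<dots> = \<epsilon> / 3"
          using iffD1[OF nonzero_eq_divide_eq[OF h(2)] refl, of "\<epsilon> / 3"] by (simp only: mult.commute)
        finally have 2: "cmod ((LINT w|lborel. ?f w * A w) - (LINT w|lborel. ?f w * b w)) \<le> \<epsilon> / 3" .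
        have 3: "cmod (LINT w|lborel. ?f w * b w) \<le> \<epsilon> / 3" using t1 \<xi> x t by simp
        have "cmod (\<xi> (T t \<Phi>)) \<le> \<epsilon>"
          using 1 2 3 norm_triangle_ineq[of "(LINT w|lborel. ?f w * A w) - (LINT w|lborel. ?f w * b w)" "LINT w|lborel. ?f w * b w"]
            norm_triangle_ineq4[of "LINT w|lborel. ?f w * A w" "(LINT w|lborel. ?f w * A w) - \<xi> (T t \<Phi>)"] by simp
        then show "cmod (\<xi> ((T t o\<^sub>L measure_calculus T \<mu>) x)) \<le> \<epsilon>"
          by (simp add: measure_calculus_apply[OF assms(5)] \<Phi>_def)
      qed
    qed
  qed
  note key = this
  show ?thesis
  proof (rule tendstoI)
    fix e :: real assume "e > 0"
    then obtain t0 where t0: "\<forall>t\<ge>t0. norm (T t o\<^sub>L measure_calculus T \<mu>) \<le> e / 2" using key[of "e / 2"] by auto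
    show "\<forall>\<^sub>F t in at_top. dist (norm (T t o\<^sub>L measure_calculus T \<mu>)) 0 < e"
      using eventually_ge_at_top[of t0]
    proof eventually_elim
      case (elim t)
      then have "norm (T t o\<^sub>L measure_calculus T \<mu>) \<le> e / 2" using t0 by blast
      then show ?case using \<open>e > 0\<close> by simp
    qed
  qed
qed

end
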